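(* There exists a non-zero, real, signed measure $\mu$ on $\mathbb{R}$ which is pure point, $$\mu=\sum_{\lambda\in\Lambda}\mu(\lambda)\,\delta_\lambda,\qquad \mu(\lambda)\neq 0\quad(\lambda\in\Lambda),$$ and whose Fourier transform (in the sense of temperate distributions) is also a pure point measure, $$\widehat{\mu}=\sum_{s\in S}\widehat{\mu}(s)\,\delta_s,\qquad \widehat{\mu}(s)\neq 0\quad(s\in S),$$ such that: (i) $\Lambda$ and $S$ are both discrete closed sets in $\mathbb{R}$; (ii) $\Lambda$ contains only finitely many elements of any arithmetic progression.
   Context: A "measure" on $\mathbb{R}$ means a complex, locally finite (usually infinite) measure which is also a temperate (tempered) distribution. A real, signed measure is one taking real values (not necessarily positive). $\delta_x$ denotes the unit point mass at $x$. A set $\Lambda\subset\mathbb{R}$ is a discrete closed set if it has finitely many points in every bounded interval. The Fourier transform of a Schwartz function is $\widehat{\varphi}(t)=\int_{\mathbb{R}}\varphi(x)e^{-2\pi i t x}\,dx$, and the Fourier transform of a temperate distribution $\alpha$ is defined by $\langle\widehat{\alpha},\varphi\rangle=\langle\alpha,\widehat{\varphi}\rangle$ for every Schwartz function $\varphi$. An arithmetic progression in $\mathbb{R}$ is a set of the form $\{a+kd:k\in\mathbb{Z}\}$ with $a\in\mathbb{R}$, $d>0$. *)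

theory Defs
  imports "HOL-Analysis.Analysis"
begin

section \<open>Schwartz functions and temperate distributions on the real line\<close>

definition nth_deriv :: "nat \<Rightarrow> (real \<Rightarrow> complex) \<Rightarrow> real \<Rightarrow> complex" where
  "nth_deriv n = (\<lambda>f x. vector_derivative f (at x)) ^^ n"

definition smooth :: "(real \<Rightarrow> complex) \<Rightarrow> bool" where
  "smooth f \<longleftrightarrow> (\<forall>n x. nth_deriv n f differentiable (at x))"

definition schwartz :: "(real \<Rightarrow> complex) set" where
  "schwartz = {f. smooth f \<and> (\<forall>m n. bounded (range (\<lambda>x. x ^ m *\<^sub>R nth_deriv n f x)))}"

definition test_functions :: "(real \<Rightarrow> complex) set" where
  "test_functions = {f. smooth f \<and> compact (closure {x. f x \<noteq> 0})}"

definition schwartz_seminorm :: "nat \<Rightarrow> nat \<Rightarrow> (real \<Rightarrow> complex) \<Rightarrow> real" where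
  "schwartz_seminorm m n f = (SUP x. norm (x ^ m *\<^sub>R nth_deriv n f x))"

definition schwartz_converges :: "(nat \<Rightarrow> real \<Rightarrow> complex) \<Rightarrow> (real \<Rightarrow> complex) \<Rightarrow> bool" where
  "schwartz_converges f g \<longleftrightarrow>
    (\<forall>m n. (\<lambda>k. schwartz_seminorm m n (\<lambda>x. f k x - g x)) \<longlonglongrightarrow> 0)"

text \<open>
  Functionals are total HOL functions; only their values on Schwartz functions matter.
  The Schwartz space is metrizable, so sequential continuity is continuity.
\<close>

definition temperate_distribution :: "((real \<Rightarrow> complex) \<Rightarrow> complex) \<Rightarrow> bool" where
  "temperate_distribution T \<longleftrightarrow>
    (\<forall>f\<in>schwartz. \<forall>g\<in>schwartz. T (\<lambda>x. f x + g x) = T f + T g) \<and>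
    (\<forall>c. \<forall>f\<in>schwartz. T (\<lambda>x. c * f x) = c * T f) \<and>
    (\<forall>f g. range f \<subseteq> schwartz \<and> g \<in> schwartz \<and> schwartz_converges f g \<longrightarrow>
      (\<lambda>k. T (f k)) \<longlonglongrightarrow> T g)"

definition fourier :: "(real \<Rightarrow> complex) \<Rightarrow> real \<Rightarrow> complex" where
  "fourier f t = (LINT x|lborel. f x * exp (- 2 * of_real pi * \<i> * of_real t * of_real x))"

definition fourier_distribution ::
    "((real \<Rightarrow> complex) \<Rightarrow> complex) \<Rightarrow> (real \<Rightarrow> complex) \<Rightarrow> complex" where
  "fourier_distribution T f = T (fourier f)"


section \<open>Complex, locally finite measures on the real line\<close>

definition bounded_borel :: "real set set" where
  "bounded_borel = {B. B \<in> sets borel \<and> bounded B}"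

text \<open>
  A complex, locally finite measure is a countably additive complex set function on the
  bounded Borel sets (its total variation on a bounded set is then automatically finite).
  The values on other sets are irrelevant.
\<close>

definition complex_measure :: "(real set \<Rightarrow> complex) \<Rightarrow> bool" where
  "complex_measure \<mu> \<longleftrightarrow>
    (\<forall>A :: nat \<Rightarrow> real set.
      range A \<subseteq> bounded_borel \<and> disjoint_family A \<and> bounded (\<Union>i. A i) \<longrightarrow>
      (\<lambda>i. \<mu> (A i)) sums \<mu> (\<Union>i. A i))"

definition real_measure :: "(real set \<Rightarrow> complex) \<Rightarrow> bool" where
  "real_measure \<mu> \<longleftrightarrow> (\<forall>B\<in>bounded_borel. \<mu> B \<in> \<real>)"

definition nonzero_measure :: "(real set \<Rightarrow> complex) \<Rightarrow> bool" where
  "nonzero_measure \<mu> \<longleftrightarrow> (\<exists>B\<in>bounded_borel. \<mu> B \<noteq> 0)"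

text \<open>
  \<open>\<mu> = h N\<close> for a positive measure \<open>N\<close>. Every complex, locally finite measure has
  such a representation, for instance its polar decomposition with \<open>N\<close> the total variation.
\<close>

definition has_complex_density ::
    "(real set \<Rightarrow> complex) \<Rightarrow> real measure \<Rightarrow> (real \<Rightarrow> complex) \<Rightarrow> bool" where
  "has_complex_density \<mu> N h \<longleftrightarrow>
    sets N = sets borel \<and>
    (\<forall>B\<in>bounded_borel. set_integrable N B h \<and> \<mu> B = (LINT x:B|N. h x))"

text \<open>
  The integral of \<open>f\<close> against \<open>\<mu>\<close>, for bounded Borel functions \<open>f\<close> of bounded support;
  its value does not depend on the representation \<open>\<mu> = h N\<close>.
\<close>

definition has_measure_integral ::
    "(real set \<Rightarrow> complex) \<Rightarrow> (real \<Rightarrow> complex) \<Rightarrow> complex \<Rightarrow> bool" where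
  "has_measure_integral \<mu> f I \<longleftrightarrow>
    (\<exists>N h. has_complex_density \<mu> N h \<and> I = (LINT x|N. f x * h x))"

text \<open>
  The measure \<open>\<mu>\<close> is the temperate distribution \<open>T\<close>. The pairing is compared on compactly
  supported test functions only, because a Schwartz function need not be absolutely integrable
  against a temperate measure; test functions are dense, so \<open>T\<close> is determined by \<open>\<mu>\<close>.
\<close>

definition is_temperate_measure ::
    "(real set \<Rightarrow> complex) \<Rightarrow> ((real \<Rightarrow> complex) \<Rightarrow> complex) \<Rightarrow> bool" where
  "is_temperate_measure \<mu> T \<longleftrightarrow>
    complex_measure \<mu> \<and> temperate_distribution T \<and>
    (\<forall>f\<in>test_functions. has_measure_integral \<mu> f (T f))"

text \<open>\<open>\<mu>\<close> is the sum over \<open>x \<in> \<Lambda>\<close> of \<open>\<mu> {x}\<close> times the unit point mass at \<open>x\<close>,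
  with no zero terms.\<close>

definition pure_point_on :: "(real set \<Rightarrow> complex) \<Rightarrow> real set \<Rightarrow> bool" where
  "pure_point_on \<mu> \<Lambda> \<longleftrightarrow>
    (\<forall>B\<in>bounded_borel. ((\<lambda>x. \<mu> {x}) has_sum \<mu> B) (\<Lambda> \<inter> B)) \<and>
    (\<forall>x\<in>\<Lambda>. \<mu> {x} \<noteq> 0)"


section \<open>Subsets of the real line\<close>

definition discrete_closed :: "real set \<Rightarrow> bool" where
  "discrete_closed \<Lambda> \<longleftrightarrow> (\<forall>a b. finite (\<Lambda> \<inter> {a..b}))"

definition arith_progression :: "real \<Rightarrow> real \<Rightarrow> real set" where
  "arith_progression a d = {a + of_int k * d | k :: int. True}"

end

theory Submission
  imports Defs "HOL-Probability.Probability" "HOL-Complex_Analysis.Complex_Analysis"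
begin

text \<open>
  The measure is a sum over a shifted lattice of dimension three. If \<open>g\<close> is an odd Schwartz function,
  then \<open>x \<mapsto> g(|x|)/|x|\<close> is a radial function on three-dimensional space, and its Fourier transform
  is again of this form, with \<open>g\<close> replaced by \<open>\<i> g^\<close>. Poisson summation over a lattice, applied to such
  functions, is therefore a statement about one-dimensional Fourier transforms: point masses of weight
  \<open>\<plusminus>1/|x|\<close> at the points \<open>\<plusminus>|x|\<close>, for \<open>x\<close> in a translate of the lattice, have as Fourier transform point
  masses at the points \<open>\<plusminus>|\<xi>|\<close>, for \<open>\<xi>\<close> in a translate of the dual lattice. Both families of lengths
  are discrete and closed. Here the points are \<open>x = m + v\<close> with \<open>m\<close> integral and \<open>v = (\<theta>, \<theta>^4, 0)\<close>,
  carrying the sign \<open>(-1)^m3\<close>; this sign moves the dual lattice to \<open>\<xi> = k - (0, 0, 1/2)\<close>, and neither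
  translate contains the origin, where \<open>g(|x|)/|x|\<close> would produce a derivative of a point mass.

  Gaussians reduce the summation formula to dimension one. For \<open>g(x) = x exp(- \<pi> t x^2)\<close> it is a
  product of three functional equations of theta functions (\<open>product_theta_identity\<close>). Both sides are
  analytic in \<open>t\<close>, so the Taylor coefficients at \<open>t\<close> agree; they amount to the formula for all
  \<open>x^(2k+1) exp(- \<pi> t x^2)\<close>, and recombining them yields the odd part of every translate
  \<open>exp(- \<pi> t (x - y)^2)\<close> (\<open>translated_gaussian_identity\<close>). Integrating over \<open>y\<close> against a Schwartz function \<open>f\<close>
  gives the formula for the convolution of \<open>f\<close> with a Gaussian, and letting the Gaussian shrink gives it
  for \<open>f\<close> (\<open>summation_formula\<close>).

  Long progressions are excluded by the choice of \<open>\<theta>\<close>. If \<open>(a + k d)^2 = |m + v|^2\<close> for three different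
  integers \<open>k\<close>, then \<open>d^2\<close>, \<open>2 a d\<close> and \<open>a^2 - |v|^2\<close> all lie in the rational span of \<open>1, \<theta>, \<theta>^4\<close>.
  The relation \<open>(2 a d)^2 = 4 d^2 a^2\<close> then becomes a polynomial equation for \<open>\<theta>\<close> with rational
  coefficients, and for transcendental \<open>\<theta>\<close> all its coefficients vanish. This forces the quadratic
  form \<open>|v|^2\<close> to be proportional to the square of a linear form, which is impossible unless \<open>d = 0\<close>
  (\<open>no_three_terms\<close>). So every progression contains at most two of the points \<open>\<plusminus>|m + v|\<close>.
\<close>

section \<open>Gaussians and their Fourier transforms\<close>

text \<open>
  Everything about Gaussian integrals is transported from the normal distribution, whose moments and
  characteristic function are known.
\<close>
lemma gaussian_eq_normal_density:
  assumes "t > 0"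
  shows "exp (- pi * t * (x - y)\<^sup>2) = normal_density y (1 / sqrt (2 * pi * t)) x / sqrt t"
  using assms unfolding normal_density_def
  by (simp add: power_divide real_sqrt_divide real_sqrt_mult field_simps)

lemma integrable_gaussian_moment_abs:
  assumes "t > 0"
  shows "integrable lborel (\<lambda>x. \<bar>x - y\<bar> ^ k * exp (- pi * t * (x - y)\<^sup>2))"
proof -
  have "integrable lborel (\<lambda>x. (normal_density y (1 / sqrt (2 * pi * t)) x * \<bar>x - y\<bar> ^ k) / sqrt t)"
    using assms by (intro integrable_divide integrable_normal_moment_abs) auto
  then show ?thesis
    unfolding gaussian_eq_normal_density[OF assms] by (simp add: mult.commute)
qed

lemma integrable_gaussian:
  assumes "t > 0"
  shows "integrable lborel (\<lambda>x. exp (- pi * t * (x - y)\<^sup>2))"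
  using integrable_gaussian_moment_abs[OF assms, of y 0] by simp

lemma integral_gaussian:
  assumes "t > 0"
  shows "(\<integral>x. exp (- pi * t * (x - y)\<^sup>2) \<partial>lborel) = 1 / sqrt t"
  unfolding gaussian_eq_normal_density[OF assms]
  using assms by simp

lemma integrable_mult_unimodular:
  fixes f g :: "'a \<Rightarrow> complex"
  assumes "integrable M f" "g \<in> borel_measurable M" "\<And>x. norm (g x) \<le> 1"
  shows "integrable M (\<lambda>x. f x * g x)"
  by (rule Bochner_Integration.integrable_bound[OF assms(1)])
     (use assms in \<open>auto simp: norm_mult intro!: AE_I2 mult_left_le\<close>)

lemma fourier_kernel:
  "exp (- 2 * of_real pi * \<i> * of_real t * of_real x) = cis (- 2 * pi * t * x)"
  by (simp add: cis_conv_exp algebra_simps)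

lemma fourier_cis: "fourier f t = (\<integral>x. f x * cis (- 2 * pi * t * x) \<partial>lborel)"
  unfolding fourier_def fourier_kernel ..

lemma borel_measurable_cis [measurable]: "cis \<in> borel_measurable borel"
  by (intro borel_measurable_continuous_onI continuous_intros)

text \<open>
  Rescaling \<open>x = y + c u\<close> with \<open>c^2 = 1 / (2 \<pi> t)\<close> turns the integral into the characteristic function of
  the standard normal distribution.
\<close>
lemma fourier_gaussian:
  assumes "t > 0"
  shows "fourier (\<lambda>x. of_real (exp (- pi * t * (x - y)\<^sup>2))) \<xi> =
    of_real (exp (- pi * \<xi>\<^sup>2 / t) / sqrt t) * cis (- 2 * pi * \<xi> * y)"
proof -
  define c where "c = 1 / sqrt (2 * pi * t)"
  have c: "c > 0" "c\<^sup>2 = 1 / (2 * pi * t)" using assms by (auto simp: c_def power_divide)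
  have "char std_normal_distribution (- 2 * pi * \<xi> * c) =
     (\<integral>u. std_normal_density u *\<^sub>R cis (- 2 * pi * \<xi> * c * u) \<partial>lborel)"
    unfolding char_def by (subst integral_density) (auto simp: cis_conv_exp)
  also have "char std_normal_distribution (- 2 * pi * \<xi> * c) = of_real (exp (- pi * \<xi>\<^sup>2 / t))"
    using assms c by (simp add: char_std_normal_distribution power_mult_distrib power2_eq_square field_simps)
  finally have std: "(\<integral>u. std_normal_density u *\<^sub>R cis (- 2 * pi * \<xi> * c * u) \<partial>lborel) =
     of_real (exp (- pi * \<xi>\<^sup>2 / t))" ..
  have "fourier (\<lambda>x. of_real (exp (- pi * t * (x - y)\<^sup>2))) \<xi> =
     c *\<^sub>R (\<integral>u. of_real (exp (- pi * t * (c * u)\<^sup>2)) * cis (- 2 * pi * \<xi> * (y + c * u)) \<partial>lborel)"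
    unfolding fourier_cis
    by (subst lborel_integral_real_affine[where c = c and t = y]) (use c in auto)
  also have "\<dots> = c *\<^sub>R (\<integral>u. (sqrt (2 * pi) * cis (- 2 * pi * \<xi> * y)) *
      (std_normal_density u *\<^sub>R cis (- 2 * pi * \<xi> * c * u)) \<partial>lborel)"
  proof (intro arg_cong[where f = "scaleR c"] Bochner_Integration.integral_cong refl)
    fix u
    have "pi * t * (c * u)\<^sup>2 = u\<^sup>2 / 2" using c assms by (simp add: power_mult_distrib)
    then have "exp (- pi * t * (c * u)\<^sup>2) = sqrt (2 * pi) * std_normal_density u"
      by (simp add: std_normal_density_def)
    moreover have "cis (- 2 * pi * \<xi> * (y + c * u)) = cis (- 2 * pi * \<xi> * y) * cis (- 2 * pi * \<xi> * c * u)"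
      by (simp add: cis_mult algebra_simps)
    ultimately show "of_real (exp (- pi * t * (c * u)\<^sup>2)) * cis (- 2 * pi * \<xi> * (y + c * u)) =
      (sqrt (2 * pi) * cis (- 2 * pi * \<xi> * y)) *
      (std_normal_density u *\<^sub>R cis (- 2 * pi * \<xi> * c * u))"
      by (simp add: scaleR_conv_of_real mult_ac)
  qed
  also have "\<dots> = c *\<^sub>R ((sqrt (2 * pi) * cis (- 2 * pi * \<xi> * y)) * of_real (exp (- pi * \<xi>\<^sup>2 / t)))"
    by (simp only: integral_mult_right_zero std)
  also have "\<dots> = of_real (exp (- pi * \<xi>\<^sup>2 / t) / sqrt t) * cis (- 2 * pi * \<xi> * y)"
    using assms by (simp add: c_def scaleR_conv_of_real real_sqrt_mult field_simps)
  finally show ?thesis .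
qed

lemma has_bochner_integral_gaussian_sin:
  assumes "t > 0"
  shows "has_bochner_integral lborel (\<lambda>x. exp (- pi * t * (x - y)\<^sup>2) * sin (2 * pi * \<xi> * x))
    (exp (- pi * \<xi>\<^sup>2 / t) / sqrt t * sin (2 * pi * \<xi> * y))"
proof -
  have int: "integrable lborel (\<lambda>x. of_real (exp (- pi * t * (x - y)\<^sup>2)) * cis (- 2 * pi * \<xi> * x))"
    using integrable_gaussian[OF assms]
    by (intro integrable_mult_unimodular) auto
  have "has_bochner_integral lborel (\<lambda>x. of_real (exp (- pi * t * (x - y)\<^sup>2)) * cis (- 2 * pi * \<xi> * x))
     (of_real (exp (- pi * \<xi>\<^sup>2 / t) / sqrt t) * cis (- 2 * pi * \<xi> * y))"
    using int fourier_gaussian[OF assms, of y \<xi>] unfolding fourier_cis has_bochner_integral_iff by simp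
  from has_bochner_integral_minus[OF has_bochner_integral_Im[OF this]]
  show ?thesis by (simp add: algebra_simps)
qed

lemma integral_vector_derivative_UNIV:
  fixes F f :: "real \<Rightarrow> complex"
  assumes "\<And>x. (F has_vector_derivative f x) (at x)" "continuous_on UNIV f" "integrable lborel f"
    and "(F \<longlongrightarrow> 0) at_top" "(F \<longlongrightarrow> 0) at_bot"
  shows "(\<integral>x. f x \<partial>lborel) = 0"
proof -
  have "(LBINT x=-\<infinity>..\<infinity>. f x) = 0 - 0"
  proof (rule interval_integral_FTC_integrable)
    show "isCont f x" for x using assms(2) by (simp add: continuous_on_eq_continuous_at)
    show "set_integrable lborel (einterval (- \<infinity>) \<infinity>) f"
      using assms(3) by (simp add: set_integrable_def)
    show "((F \<circ> real_of_ereal) \<longlongrightarrow> 0) (at_right (- \<infinity>))" "((F \<circ> real_of_ereal) \<longlongrightarrow> 0) (at_left \<infinity>)"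
      using assms(4,5) by (simp_all add: ereal_tendsto_simps)
  qed (use assms in auto)
  then show ?thesis by (simp add: interval_lebesgue_integral_def set_lebesgue_integral_def)
qed

lemma fourier_vector_derivative:
  fixes f f' :: "real \<Rightarrow> complex"
  assumes deriv: "\<And>x. (f has_vector_derivative f' x) (at x)" and cont: "continuous_on UNIV f'"
    and int: "integrable lborel f" "integrable lborel f'"
    and lim: "(f \<longlongrightarrow> 0) at_top" "(f \<longlongrightarrow> 0) at_bot"
  shows "fourier f' \<xi> = 2 * of_real pi * \<i> * of_real \<xi> * fourier f \<xi>"
proof -
  define e where "e x = cis (- 2 * pi * \<xi> * x)" for x
  define c where "c = - 2 * of_real pi * \<i> * of_real \<xi>"
  have e: "(e has_vector_derivative c * e x) (at x)" for x
  proof -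
    have "((\<lambda>x. exp (c * of_real x)) has_vector_derivative c * exp (c * of_real x)) (at x)"
      by (auto intro!: derivative_eq_intros has_vector_derivative_real_field)
    moreover have "e = (\<lambda>x. exp (c * of_real x))"
      unfolding e_def c_def by (auto simp: cis_conv_exp algebra_simps)
    ultimately show ?thesis by simp
  qed
  have ne: "norm (e x) = 1" for x by (simp add: e_def)
  have me [measurable]: "e \<in> borel_measurable borel" unfolding e_def by measurable
  have int': "integrable lborel (\<lambda>x. f' x * e x)" "integrable lborel (\<lambda>x. f x * e x)"
    using int ne by (auto intro!: integrable_mult_unimodular)
  have contf: "continuous_on UNIV f" "continuous_on UNIV e"
    using deriv e by (auto intro!: continuous_at_imp_continuous_on has_vector_derivative_continuous)
  have "(\<integral>x. f' x * e x + c * (f x * e x) \<partial>lborel) = 0"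
  proof (rule integral_vector_derivative_UNIV[where F = "\<lambda>x. f x * e x"])
    show "((\<lambda>x. f x * e x) has_vector_derivative f' x * e x + c * (f x * e x)) (at x)" for x
      using has_vector_derivative_mult[OF deriv e, of x] by (simp add: algebra_simps)
    show "((\<lambda>x. f x * e x) \<longlongrightarrow> 0) at_top" "((\<lambda>x. f x * e x) \<longlongrightarrow> 0) at_bot"
      by (rule tendsto_norm_zero_cancel, simp only: norm_mult ne mult_1_right,
          rule tendsto_norm_zero, rule lim)+
  qed (use int' cont contf in \<open>auto intro!: continuous_intros\<close>)
  then have "(\<integral>x. f' x * e x \<partial>lborel) + c * (\<integral>x. f x * e x \<partial>lborel) = 0"
    using int' by simp
  then show ?thesis
    unfolding fourier_cis e_def[symmetric] by (simp add: c_def add_eq_0_iff)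
qed

lemma tendsto_gaussian_at_infinity:
  assumes "t > 0"
  shows "((\<lambda>x. exp (- pi * t * x\<^sup>2)) \<longlongrightarrow> 0) at_top" "((\<lambda>x. exp (- pi * t * x\<^sup>2)) \<longlongrightarrow> 0) at_bot"
  using assms by real_asymp+

text \<open>
  The Gaussian is, up to the factor \<open>- 2 \<pi> t x\<close>, its own derivative, so this is the rule for the
  Fourier transform of a derivative. The right-hand side is the reason for the weight \<open>3/2\<close> in the
  identities below: a centred odd Gaussian transforms with the factor \<open>1 / (t sqrt t)\<close>.
\<close>
lemma has_bochner_integral_gaussian_times_sin:
  assumes t: "t > 0"
  shows "has_bochner_integral lborel (\<lambda>x. x * exp (- pi * t * x\<^sup>2) * sin (2 * pi * \<xi> * x))
    (\<xi> * exp (- pi * \<xi>\<^sup>2 / t) / (t * sqrt t))"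
proof -
  let ?f = "\<lambda>x. complex_of_real (exp (- pi * t * x\<^sup>2))"
  let ?f' = "\<lambda>x. complex_of_real (- 2 * pi * t * x * exp (- pi * t * x\<^sup>2))"
  have int1: "integrable lborel (\<lambda>x. x * exp (- pi * t * x\<^sup>2))"
    using integrable_gaussian_moment_abs[OF t, of 0 1]
    by (subst integrable_norm_cancel[where f="\<lambda>x. x * exp (- pi * t * x\<^sup>2)"]) (auto simp: abs_mult)
  have int: "integrable lborel ?f'" 
    using integrable_mult_right[OF int1, of "- 2 * pi * t"] by (subst complex_of_real_integrable_eq) (simp add: mult_ac)
  have "fourier ?f' \<xi> = 2 * of_real pi * \<i> * of_real \<xi> * fourier ?f \<xi>"
  proof (rule fourier_vector_derivative)
    show "(?f has_vector_derivative ?f' x) (at x)" for x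
      by (rule has_vector_derivative_of_real)
         (auto intro!: derivative_eq_intros simp flip: has_real_derivative_iff_has_vector_derivative)
    show "integrable lborel ?f" using integrable_gaussian[OF t, of 0] by simp
    show "integrable lborel ?f'" by fact
    show "(?f \<longlongrightarrow> 0) at_top" "(?f \<longlongrightarrow> 0) at_bot"
      using tendsto_gaussian_at_infinity[OF t, THEN tendsto_of_real] by (simp_all only: of_real_0)
  qed (auto intro!: continuous_intros)
  also have "fourier ?f \<xi> = of_real (exp (- pi * \<xi>\<^sup>2 / t) / sqrt t)"
    using fourier_gaussian[OF t, of 0 \<xi>] by simp
  finally have eq: "fourier ?f' \<xi> = 2 * of_real pi * \<i> * of_real \<xi> * of_real (exp (- pi * \<xi>\<^sup>2 / t) / sqrt t)" .
  have "has_bochner_integral lborel (\<lambda>x. ?f' x * cis (- 2 * pi * \<xi> * x)) (fourier ?f' \<xi>)"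
    unfolding fourier_cis has_bochner_integral_iff
    using int by (auto intro!: integrable_mult_unimodular)
  from has_bochner_integral_Im[OF this]
  have "has_bochner_integral lborel (\<lambda>x. (2 * pi * t) * (x * exp (- pi * t * x\<^sup>2) * sin (2 * pi * \<xi> * x)))
    (2 * pi * \<xi> * exp (- pi * \<xi>\<^sup>2 / t) / sqrt t)"
    unfolding eq by (simp add: algebra_simps)
  from has_bochner_integral_mult_right[OF this, of "1 / (2 * pi * t)"]
  show ?thesis using t by (simp add: field_simps)
qed


section \<open>Comparing expansions coefficient by coefficient\<close>

text \<open>
  Convergence at real arguments gives a holomorphic function near \<open>0\<close>, whose zeros would be isolated.
\<close>
lemma power_series_zero_on_reals:
  fixes c :: "nat \<Rightarrow> complex"
  assumes \<rho>: "\<rho> > 0" and zero: "\<And>h. \<bar>h\<bar> < \<rho> \<Longrightarrow> (\<lambda>k. of_real h ^ k * c k) sums 0"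
  shows "c k = 0"
proof (rule ccontr)
  assume "c k \<noteq> 0"
  have "c 0 = 0"
    using sums_unique2[OF zero[of 0], of "c 0"] \<rho> powser_sums_zero[of c] by (simp add: mult.commute)
  with \<open>c k \<noteq> 0\<close> have "k > 0" by (cases k) auto
  define F where "F x = (\<Sum>n. c n * (x - 0) ^ n)" for x
  have sm: "(\<lambda>n. c n * (x - 0) ^ n) sums F x" if x: "norm (x - 0) < \<rho>" for x
  proof -
    obtain h where h: "norm x < h" "h < \<rho>" using x dense[of "norm x" \<rho>] by auto
    then have "\<bar>h\<bar> < \<rho>" "norm x < norm (of_real h :: complex)"
      using norm_ge_zero[of x] by (auto simp del: norm_ge_zero)
    then have "summable (\<lambda>n. c n * x ^ n)"
      using zero[THEN sums_summable, of h] by (auto intro: powser_inside simp: mult.commute)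
    then show ?thesis by (simp add: F_def summable_sums)
  qed
  have F_real: "F (of_real h) = 0" if "\<bar>h\<bar> < \<rho>" for h
    using zero[OF that] by (simp add: F_def sums_iff mult.commute)
  obtain s where s: "0 < s" "\<And>z. z \<in> cball 0 s - {0} \<Longrightarrow> F z \<noteq> 0"
    using powser_0_nonzero[OF \<rho> sm _ \<open>c k \<noteq> 0\<close> \<open>k > 0\<close>] F_real[of 0] \<rho> by auto
  have "F (of_real (min s \<rho> / 2)) = 0" using s \<rho> by (intro F_real) auto
  moreover have "of_real (min s \<rho> / 2) \<in> cball (0::complex) s - {0}" using s \<rho> by (auto simp: norm_divide)
  ultimately show False using s by blast
qed

text \<open>
  The bound on \<open>f x k\<close> is the one that Cauchy's inequality gives for Taylor coefficients. It dominates
  the power series \<open>\<Sum>k. h^k * f x k\<close> for \<open>|h| < \<rho>\<close> and, equally, the series with any coefficients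
  \<open>c k\<close> that are summable against \<open>1 / \<rho>^k\<close>.
\<close>
lemma integral_coeff_sums:
  fixes f :: "'a \<Rightarrow> nat \<Rightarrow> complex"
  assumes \<rho>: "\<rho> > 0" and meas [measurable]: "\<And>k. (\<lambda>x. f x k) \<in> borel_measurable M"
    and G: "integrable M G" and bound: "\<And>x k. x \<in> space M \<Longrightarrow> norm (f x k) * \<rho> ^ k \<le> G x"
    and c: "summable (\<lambda>k. norm (c k) / \<rho> ^ k)"
  shows "(\<lambda>k. c k * (\<integral>x. f x k \<partial>M)) sums (\<integral>x. (\<Sum>k. c k * f x k) \<partial>M)"
proof -
  have b: "norm (c k * f x k) \<le> norm (c k) / \<rho> ^ k * G x" if "x \<in> space M" for x k
    using mult_left_mono[OF bound[OF that, of k], of "norm (c k) / \<rho> ^ k"] \<rho>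
    by (simp add: norm_mult)
  have int: "integrable M (\<lambda>x. c k * f x k)" for k
    by (rule Bochner_Integration.integrable_bound[OF integrable_mult_right[OF G, of "norm (c k) / \<rho> ^ k"]])
       (measurable, rule AE_I2, simp only: real_norm_def, rule order_trans[OF b abs_ge_self])
  have 1: "AE x in M. summable (\<lambda>k. norm (c k * f x k))"
    using b by (intro AE_I2 summable_comparison_test'[OF summable_mult2[OF c]]) (auto simp: norm_mult)
  have 2: "summable (\<lambda>k. \<integral>x. norm (c k * f x k) \<partial>M)"
  proof (rule summable_comparison_test'[OF summable_mult2[OF c, of "\<integral>x. G x \<partial>M"]])
    fix k
    have "(\<integral>x. norm (c k * f x k) \<partial>M) \<le> (\<integral>x. norm (c k) / \<rho> ^ k * G x \<partial>M)"
      using b by (intro integral_mono_AE integrable_norm int integrable_mult_right G AE_I2) auto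
    then show "norm (\<integral>x. norm (c k * f x k) \<partial>M) \<le> norm (c k) / \<rho> ^ k * (\<integral>x. G x \<partial>M)"
      by (simp add: integral_nonneg_AE)
  qed
  have f: "(\<integral>x. c k * f x k \<partial>M) = c k * (\<integral>x. f x k \<partial>M)" for k
    by (rule integral_mult_right_zero)
  show ?thesis
    using sums_integral[OF int 1 2] unfolding f .
qed

text \<open>
  Two integrals of power series that agree for all small \<open>h\<close> have the same coefficients, hence still
  agree when the powers \<open>h^k\<close> are replaced by other numbers \<open>c k\<close>. This is the step from centred to
  translated Gaussians: a Gaussian in \<open>x\<close> of slightly different width is a power series in
  \<open>x^2\<close>, and a translated Gaussian has the same powers of \<open>x^2\<close> with other coefficients.
\<close>
lemma integral_expansion_transfer:
  fixes f :: "'a \<Rightarrow> nat \<Rightarrow> complex" and g :: "'b \<Rightarrow> nat \<Rightarrow> complex"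
  assumes \<rho>: "\<rho> > 0"
    and f: "\<And>k. (\<lambda>x. f x k) \<in> borel_measurable M" "integrable M F"
      "\<And>x k. x \<in> space M \<Longrightarrow> norm (f x k) * \<rho> ^ k \<le> F x"
    and g: "\<And>k. (\<lambda>x. g x k) \<in> borel_measurable N" "integrable N G"
      "\<And>x k. x \<in> space N \<Longrightarrow> norm (g x k) * \<rho> ^ k \<le> G x"
    and eq: "\<And>h. \<bar>h\<bar> < \<rho> \<Longrightarrow>
      (\<integral>x. (\<Sum>k. of_real h ^ k * f x k) \<partial>M) = (\<integral>x. (\<Sum>k. of_real h ^ k * g x k) \<partial>N)"
    and c: "summable (\<lambda>k. norm (c k) / \<rho> ^ k)"
  shows "(\<integral>x. (\<Sum>k. c k * f x k) \<partial>M) = (\<integral>x. (\<Sum>k. c k * g x k) \<partial>N)"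
proof -
  have coeff: "(\<integral>x. f x k \<partial>M) = (\<integral>x. g x k \<partial>N)" for k
  proof -
    have "(\<lambda>k. of_real h ^ k * ((\<integral>x. f x k \<partial>M) - (\<integral>x. g x k \<partial>N))) sums 0" if "\<bar>h\<bar> < \<rho>" for h
    proof -
      have "summable (\<lambda>k. norm ((of_real h :: complex) ^ k) / \<rho> ^ k)"
        using that \<rho> summable_geometric[of "\<bar>h\<bar> / \<rho>"] by (simp add: norm_power power_divide)
      from sums_diff[OF integral_coeff_sums[OF \<rho> f this] integral_coeff_sums[OF \<rho> g this]]
      show ?thesis using eq[OF that] by (simp add: right_diff_distrib)
    qed
    from power_series_zero_on_reals[OF \<rho> this] show ?thesis by simp
  qed
  show ?thesis
    using sums_unique2[OF integral_coeff_sums[OF \<rho> f c]] integral_coeff_sums[OF \<rho> g c] coeff by simp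
qed

text \<open>
  The Taylor coefficients of \<open>h \<mapsto> exp(- \<pi> (t - h) p^2)\<close>.
\<close>
definition gauss_coeff :: "real \<Rightarrow> real \<Rightarrow> nat \<Rightarrow> real" where
  "gauss_coeff t p k = (pi * p\<^sup>2) ^ k / fact k * exp (- pi * t * p\<^sup>2)"

text \<open>
  The numbers \<open>c k\<close> that turn the coefficients \<open>gauss_coeff t p k\<close> into
  \<open>exp(- \<pi> t p^2) sinh(2 \<pi> t y p) / p\<close>, which up to a constant is the odd part of
  \<open>exp(- \<pi> t (p - y)^2)\<close> divided by \<open>p\<close>.
\<close>
definition sinh_coeff :: "real \<Rightarrow> real \<Rightarrow> nat \<Rightarrow> real" where
  "sinh_coeff t y k = (2 * pi * t * y) ^ (2 * k + 1) * fact k / (fact (2 * k + 1) * pi ^ k)"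

lemma power_div_fact_le_exp:
  fixes x :: real
  assumes "x \<ge> 0"
  shows "x ^ k / fact k \<le> exp x"
proof -
  have "(\<Sum>i\<in>{k}. x ^ i /\<^sub>R fact i) \<le> (\<Sum>i. x ^ i /\<^sub>R fact i)"
    using assms by (intro sum_le_suminf summable_exp_generic) auto
  then show ?thesis by (simp add: exp_def field_simps)
qed

lemma gauss_coeff_sums: "(\<lambda>k. h ^ k * gauss_coeff t p k) sums exp (- pi * (t - h) * p\<^sup>2)"
proof -
  have "(\<lambda>k. (pi * h * p\<^sup>2) ^ k /\<^sub>R fact k * exp (- pi * t * p\<^sup>2)) sums (exp (pi * h * p\<^sup>2) * exp (- pi * t * p\<^sup>2))"
    by (intro sums_mult2 exp_converges)
  moreover have "exp (pi * h * p\<^sup>2) * exp (- pi * t * p\<^sup>2) = exp (- pi * (t - h) * p\<^sup>2)"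
    by (simp add: exp_add[symmetric] algebra_simps)
  ultimately show ?thesis by (simp add: gauss_coeff_def power_mult_distrib field_simps)
qed

lemma gauss_coeff_bound:
  assumes "t > 0"
  shows "\<bar>gauss_coeff t p k\<bar> * (t / 2) ^ k \<le> exp (- pi * (t / 2) * p\<^sup>2)"
proof -
  have "\<bar>gauss_coeff t p k\<bar> * (t / 2) ^ k = (pi * (t / 2) * p\<^sup>2) ^ k / fact k * exp (- pi * t * p\<^sup>2)"
    unfolding gauss_coeff_def by (simp add: abs_mult power_mult_distrib power_divide field_simps)
  also have "\<dots> \<le> exp (pi * (t / 2) * p\<^sup>2) * exp (- pi * t * p\<^sup>2)"
    using assms by (intro mult_right_mono power_div_fact_le_exp) auto
  also have "\<dots> = exp (- pi * (t / 2) * p\<^sup>2)"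
    by (simp add: exp_add[symmetric] field_simps)
  finally show ?thesis .
qed

lemma sinh_series: "(\<lambda>k. x ^ (2 * k + 1) / fact (2 * k + 1)) sums sinh (x :: real)"
proof -
  have "(\<lambda>n. if even n then 0 else x ^ n /\<^sub>R fact n) sums sinh x" by (rule sinh_converges)
  then have "(\<lambda>k. if even (2 * k + 1) then 0 else x ^ (2 * k + 1) /\<^sub>R fact (2 * k + 1)) sums sinh x"
    by (subst sums_mono_reindex[where g = "\<lambda>k. 2 * k + 1", unfolded o_def])
       (auto simp: strict_mono_def elim!: oddE)
  then show ?thesis by (simp add: field_simps)
qed

lemma sinh_coeff_gauss_coeff_sums:
  "(\<lambda>k. sinh_coeff t y k * (gauss_coeff t p k * p)) sums (sinh (2 * pi * t * y * p) * exp (- pi * t * p\<^sup>2))"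
proof -
  have "sinh_coeff t y k * (gauss_coeff t p k * p) =
    (2 * pi * t * y * p) ^ (2 * k + 1) / fact (2 * k + 1) * exp (- pi * t * p\<^sup>2)" for k
    unfolding sinh_coeff_def gauss_coeff_def
    by (simp add: power_mult_distrib power_mult[symmetric] field_simps del: fact_Suc)
  then show ?thesis using sums_mult2[OF sinh_series] by simp
qed

lemma fact_square_le: "fact k * fact k \<le> (fact (2 * k + 1) :: real)"
proof -
  have "fact k * fact k dvd (fact (k + k) :: nat)" by (rule fact_fact_dvd_fact)
  then have "fact k * fact k \<le> (fact (2 * k) :: nat)" by (intro dvd_imp_le) (auto simp: mult_2)
  also have "\<dots> \<le> fact (2 * k + 1)" by (intro fact_mono) auto
  finally have "real (fact k * fact k) \<le> real (fact (2 * k + 1))" by (rule of_nat_mono)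
  then show ?thesis by (simp del: fact_Suc)
qed

text \<open>
  The estimate \<open>k! k! \<le> (2k+1)!\<close> leaves a factor \<open>1 / k!\<close>, which beats every geometric growth.
\<close>
lemma summable_sinh_coeff:
  assumes "\<rho> > 0"
  shows "summable (\<lambda>k. \<bar>sinh_coeff t y k\<bar> / \<rho> ^ k)"
proof -
  define X where "X = \<bar>2 * pi * t * y\<bar>"
  define u where "u = X\<^sup>2 / (pi * \<rho>)"
  show ?thesis
  proof (rule summable_comparison_test'[where N = 0])
    show "summable (\<lambda>k. X * (u ^ k /\<^sub>R fact k))"
      by (intro summable_mult summable_exp_generic)
    fix k
    have "norm (\<bar>sinh_coeff t y k\<bar> / \<rho> ^ k) = X * u ^ k * (fact k / fact (2 * k + 1))"
    proof -
      have "\<bar>sinh_coeff t y k\<bar> = X ^ (2 * k + 1) * fact k / (fact (2 * k + 1) * pi ^ k)"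
        by (simp add: sinh_coeff_def X_def abs_mult power_abs del: fact_Suc)
      then show ?thesis
        using assms unfolding u_def
        by (simp add: power_mult_distrib power_divide power_mult[symmetric] field_simps del: fact_Suc)
    qed
    also have "\<dots> \<le> X * u ^ k * (1 / fact k)"
      using fact_square_le[of k] assms unfolding u_def
      by (intro mult_left_mono) (auto simp: field_simps X_def simp del: fact_Suc)
    finally show "norm (\<bar>sinh_coeff t y k\<bar> / \<rho> ^ k) \<le> X * (u ^ k /\<^sub>R fact k)"
      by (simp add: field_simps)
  qed
qed

text \<open>
  On the Fourier side a Gaussian of width parameter \<open>z\<close> contributes this function of \<open>z\<close>, by
  \<open>has_bochner_integral_gaussian_times_sin\<close>.
\<close>
definition dual_kernel :: "real \<Rightarrow> complex \<Rightarrow> complex" where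
  "dual_kernel q z = exp (- of_real (pi * q\<^sup>2) / z) / (z * csqrt z)"

text \<open>
  The Taylor coefficients of \<open>h \<mapsto> dual_kernel q (t - h)\<close>.
\<close>
definition dual_coeff :: "real \<Rightarrow> real \<Rightarrow> nat \<Rightarrow> complex" where
  "dual_coeff t q k = (- 1) ^ k * ((deriv ^^ k) (dual_kernel q) (of_real t) / fact k)"

lemma dual_kernel_of_real:
  assumes "s > 0"
  shows "dual_kernel q (of_real s) = of_real (exp (- pi * q\<^sup>2 / s) / (s * sqrt s))"
  using assms unfolding dual_kernel_def by (simp add: exp_of_real[symmetric])

lemma holomorphic_dual_kernel: "dual_kernel q holomorphic_on {z. Re z > 0}"
  unfolding dual_kernel_def
  by (intro holomorphic_intros) (auto simp: complex_nonpos_Reals_iff)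

lemma cball_half_subset:
  assumes "t > 0"
  shows "cball (of_real t) (t / 2) \<subseteq> {z. Re z > 0}"
proof safe
  fix z assume "z \<in> cball (complex_of_real t) (t / 2)"
  then have "\<bar>Re (of_real t - z)\<bar> \<le> t / 2"
    using abs_Re_le_cmod[of "of_real t - z"] by (simp add: dist_norm)
  then have "\<bar>t - Re z\<bar> \<le> t / 2" by simp
  then show "Re z > 0" using assms by linarith
qed

lemma dual_coeff_sums:
  assumes "t > 0" "\<bar>h\<bar> < t / 2"
  shows "(\<lambda>k. of_real h ^ k * dual_coeff t q k) sums of_real (exp (- pi * q\<^sup>2 / (t - h)) / ((t - h) * sqrt (t - h)))"
proof -
  have "(\<lambda>k. (deriv ^^ k) (dual_kernel q) (of_real t) / fact k * (of_real (t - h) - of_real t) ^ k) sums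
     dual_kernel q (of_real (t - h))"
  proof (rule holomorphic_power_series)
    show "dual_kernel q holomorphic_on ball (of_real t) (t / 2)"
      using cball_half_subset[OF assms(1)] ball_subset_cball
      by (blast intro: holomorphic_on_subset[OF holomorphic_dual_kernel])
    show "of_real (t - h) \<in> ball (complex_of_real t) (t / 2)"
      using assms by (simp add: dist_norm)
  qed
  moreover have "(of_real (t - h) - of_real t :: complex) ^ k = of_real h ^ k * (- 1) ^ k" for k
    by (simp add: power_minus[of "of_real h"])
  moreover have "dual_kernel q (of_real (t - h)) = of_real (exp (- pi * q\<^sup>2 / (t - h)) / ((t - h) * sqrt (t - h)))"
    using assms by (intro dual_kernel_of_real) auto
  ultimately show ?thesis
    by (simp only: dual_coeff_def mult_ac times_divide_eq_right)
qed

text \<open>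
  Cauchy's inequality on the disc of radius \<open>t/2\<close> about \<open>t\<close>. There \<open>Re (1/z) \<ge> 2 / (9 t)\<close>, so the
  coefficients still decay like a Gaussian in \<open>q\<close>; this is what makes their sum over a lattice converge.
\<close>
lemma dual_coeff_bound:
  assumes t: "t > 0"
  shows "norm (dual_coeff t q k) * (t / 2) ^ k \<le> exp (- pi * q\<^sup>2 * (2 / (9 * t))) / (t / 2 * sqrt (t / 2))"
proof -
  have "norm ((deriv ^^ k) (dual_kernel q) (of_real t)) \<le>
      fact k * (exp (- pi * q\<^sup>2 * (2 / (9 * t))) / (t / 2 * sqrt (t / 2))) / (t / 2) ^ k"
  proof (rule Cauchy_inequality)
    show "dual_kernel q holomorphic_on ball (of_real t) (t / 2)"
      using cball_half_subset[OF t] ball_subset_cball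
      by (blast intro: holomorphic_on_subset[OF holomorphic_dual_kernel])
    show "continuous_on (cball (of_real t) (t / 2)) (dual_kernel q)"
      using cball_half_subset[OF t] holomorphic_dual_kernel
      by (blast intro: continuous_on_subset holomorphic_on_imp_continuous_on)
    fix z :: complex assume z: "norm (of_real t - z) = t / 2"
    have Re: "Re z \<ge> t / 2"
      using abs_Re_le_cmod[of "of_real t - z"] z by (simp add: abs_if split: if_splits)
    then have nz: "norm z \<ge> t / 2" using complex_Re_le_cmod[of z] by linarith
    have nz': "norm z \<le> 3 / 2 * t"
      using norm_triangle_ineq4[of "of_real t" "of_real t - z"] z t by simp
    have "2 / (9 * t) = (t / 2) / (3 / 2 * t)\<^sup>2" using t by (simp add: power2_eq_square field_simps)
    also have "\<dots> \<le> Re z / (norm z)\<^sup>2"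
      using Re nz nz' t by (intro frac_le power_mono) auto
    also have "\<dots> = Re (1 / z)" by (simp add: Re_divide cmod_power2)
    finally have Re1: "2 / (9 * t) \<le> Re (1 / z)" .
    have "norm (exp (- of_real (pi * q\<^sup>2) / z)) = exp (- (pi * q\<^sup>2) * Re (1 / z))"
      by (simp add: norm_exp_eq_Re Re_divide)
    also have "\<dots> \<le> exp (- pi * q\<^sup>2 * (2 / (9 * t)))"
      using mult_left_mono[OF Re1, of "pi * q\<^sup>2"] by simp
    finally have e: "norm (exp (- of_real (pi * q\<^sup>2) / z)) \<le> exp (- pi * q\<^sup>2 * (2 / (9 * t)))" .
    have "norm (csqrt z) = sqrt (norm z)" by simp
    then have d: "norm (z * csqrt z) \<ge> t / 2 * sqrt (t / 2)"
      unfolding norm_mult using nz t by (intro mult_mono) auto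
    show "norm (dual_kernel q z) \<le> exp (- pi * q\<^sup>2 * (2 / (9 * t))) / (t / 2 * sqrt (t / 2))"
      unfolding dual_kernel_def norm_divide using e d t by (intro frac_le) auto
  qed (use t in auto)
  then show ?thesis
    using t by (simp add: dual_coeff_def norm_mult norm_power norm_divide field_simps)
qed


section \<open>From centred to translated Gaussians\<close>

text \<open>
  The coefficients \<open>dual_coeff t q\<close> are essentially Laguerre polynomials, but they can be summed without
  knowing them, through \<open>integral_expansion_transfer\<close>, with Lebesgue measure on one side and a single point on the other: for every
  small \<open>h\<close>, the kernel at \<open>t - h\<close> is the sine transform of \<open>x exp(- \<pi> (t - h) x^2)\<close>. Recombining with
  \<open>sinh_coeff\<close> then gives the sine transform of the odd part of a translated Gaussian.
\<close>
lemma sums_dual_coeff_sinh_coeff: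
  assumes t: "t > 0" and q: "q > 0"
  shows "(\<Sum>k. of_real (sinh_coeff t y k) * dual_coeff t q k) =
    of_real (exp (pi * t * y\<^sup>2) * (exp (- pi * q\<^sup>2 / t) / sqrt t * (sin (2 * pi * q * y) / q)))"
proof -
  define s where "s x = sin (2 * pi * q * x) / q" for x
  let ?f = "\<lambda>x k. complex_of_real (s x * x * gauss_coeff t x k)"
  let ?N = "count_space {()}"
  have N: "(\<integral>x. f x \<partial>?N) = f ()" for f :: "unit \<Rightarrow> complex"
    by (simp add: lebesgue_integral_count_space_finite)
  have s_bound: "\<bar>s x\<bar> \<le> 1 / q" for x
    using q by (simp add: s_def divide_right_mono)
  have "(\<integral>x. (\<Sum>k. of_real (sinh_coeff t y k) * ?f x k) \<partial>lborel) =
     (\<integral>x. (\<Sum>k. of_real (sinh_coeff t y k) * dual_coeff t q k) \<partial>?N)"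
  proof (rule integral_expansion_transfer[where \<rho> = "t / 2"])
    show "(\<lambda>x. ?f x k) \<in> borel_measurable lborel" for k
      unfolding s_def gauss_coeff_def by measurable
    show "integrable lborel (\<lambda>x. 1 / q * (\<bar>x\<bar> * exp (- pi * (t / 2) * x\<^sup>2)))"
      using integrable_gaussian_moment_abs[of "t / 2" 0 1] t by (intro integrable_mult_right) simp
    show "norm (?f x k) * (t / 2) ^ k \<le> 1 / q * (\<bar>x\<bar> * exp (- pi * (t / 2) * x\<^sup>2))" for x k
    proof -
      have "norm (?f x k) * (t / 2) ^ k = \<bar>s x\<bar> * (\<bar>x\<bar> * (\<bar>gauss_coeff t x k\<bar> * (t / 2) ^ k))"
        by (simp add: abs_mult norm_mult)
      also have "\<dots> \<le> 1 / q * (\<bar>x\<bar> * exp (- pi * (t / 2) * x\<^sup>2))"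
        using gauss_coeff_bound[OF t, of x k] t q s_bound[of x]
        by (intro mult_mono mult_left_mono) auto
      finally show ?thesis .
    qed
    show "(\<lambda>x. dual_coeff t q k) \<in> borel_measurable ?N" for k by simp
    show "norm (dual_coeff t q k) * (t / 2) ^ k \<le> exp (- pi * q\<^sup>2 * (2 / (9 * t))) / (t / 2 * sqrt (t / 2))" for k
      by (rule dual_coeff_bound[OF t])
    show "summable (\<lambda>k. norm (complex_of_real (sinh_coeff t y k)) / (t / 2) ^ k)"
      using summable_sinh_coeff[of "t / 2"] t by simp
    fix h :: real assume h: "\<bar>h\<bar> < t / 2"
    have "(\<lambda>k. of_real h ^ k * ?f x k) sums of_real (s x * x * exp (- pi * (t - h) * x\<^sup>2))" for x
      using sums_of_real[OF sums_mult[OF gauss_coeff_sums[of h t x], of "s x * x"], where 'a = complex]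
      by (simp add: mult_ac)
    then have "(\<integral>x. (\<Sum>k. of_real h ^ k * ?f x k) \<partial>lborel) =
       (\<integral>x. of_real (s x * x * exp (- pi * (t - h) * x\<^sup>2)) \<partial>lborel)"
      by (simp add: sums_iff)
    also have "\<dots> = of_real (\<integral>x. (x * exp (- pi * (t - h) * x\<^sup>2) * sin (2 * pi * q * x)) / q \<partial>lborel)"
      unfolding integral_complex_of_real by (simp add: s_def mult_ac)
    also have "\<dots> = of_real (exp (- pi * q\<^sup>2 / (t - h)) / ((t - h) * sqrt (t - h)))"
      using has_bochner_integral_gaussian_times_sin[of "t - h" q] h t q
      by (simp add: has_bochner_integral_iff)
    also have "\<dots> = (\<Sum>k. of_real h ^ k * dual_coeff t q k)"
      using dual_coeff_sums[OF t h, of q] by (simp add: sums_iff)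
    finally show "(\<integral>x. (\<Sum>k. of_real h ^ k * ?f x k) \<partial>lborel) =
       (\<integral>x. (\<Sum>k. of_real h ^ k * dual_coeff t q k) \<partial>?N)"
      by (simp only: N)
  qed (use t in \<open>auto intro: integrable_count_space\<close>)
  moreover have "(\<integral>x. (\<Sum>k. of_real (sinh_coeff t y k) * ?f x k) \<partial>lborel) =
     of_real (\<integral>x. s x * (sinh (2 * pi * t * y * x) * exp (- pi * t * x\<^sup>2)) \<partial>lborel)"
  proof -
    have "(\<lambda>k. of_real (sinh_coeff t y k) * ?f x k) sums
       of_real (s x * (sinh (2 * pi * t * y * x) * exp (- pi * t * x\<^sup>2)))" for x
      using sums_of_real[OF sums_mult[OF sinh_coeff_gauss_coeff_sums[of t y x], of "s x"], where 'a = complex]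
      by (simp add: mult_ac)
    then show ?thesis
      unfolding integral_complex_of_real[symmetric] by (simp add: sums_iff)
  qed
  moreover have "(\<integral>x. s x * (sinh (2 * pi * t * y * x) * exp (- pi * t * x\<^sup>2)) \<partial>lborel) =
     exp (pi * t * y\<^sup>2) * (exp (- pi * q\<^sup>2 / t) / sqrt t * (sin (2 * pi * q * y) / q))"
  proof -
    let ?g = "\<lambda>y x. exp (- pi * t * (x - y)\<^sup>2) * sin (2 * pi * q * x)"
    have "s x * (sinh (2 * pi * t * y * x) * exp (- pi * t * x\<^sup>2)) =
       exp (pi * t * y\<^sup>2) / (2 * q) * (?g y x - ?g (- y) x)" for x
    proof -
      have "exp (- pi * t * (x - y)\<^sup>2) = exp (- pi * t * x\<^sup>2) * exp (2 * pi * t * y * x) * exp (- (pi * t * y\<^sup>2))"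
        "exp (- pi * t * (x - - y)\<^sup>2) = exp (- pi * t * x\<^sup>2) * exp (- (2 * pi * t * y * x)) * exp (- (pi * t * y\<^sup>2))"
        unfolding exp_add[symmetric] by (simp_all add: power2_eq_square algebra_simps)
      then show ?thesis
        using q by (simp add: s_def sinh_def exp_minus field_simps)
    qed
    then have "(\<integral>x. s x * (sinh (2 * pi * t * y * x) * exp (- pi * t * x\<^sup>2)) \<partial>lborel) =
      exp (pi * t * y\<^sup>2) / (2 * q) * (\<integral>x. ?g y x - ?g (- y) x \<partial>lborel)"
      by simp
    also have "(\<integral>x. ?g y x - ?g (- y) x \<partial>lborel) =
      exp (- pi * q\<^sup>2 / t) / sqrt t * sin (2 * pi * q * y) - exp (- pi * q\<^sup>2 / t) / sqrt t * sin (2 * pi * q * - y)"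
      using has_bochner_integral_diff[OF has_bochner_integral_gaussian_sin[OF t, of y q]
        has_bochner_integral_gaussian_sin[OF t, of "- y" q]]
      by (rule has_bochner_integral_integral_eq)
    finally show ?thesis using q by (simp add: field_simps)
  qed
  ultimately show ?thesis by (simp only: N)
qed

text \<open>
  An identity between sums of centred Gaussians, known for all widths, implies the corresponding
  identity for translated Gaussians. The same transfer principle is used once more, now between the two
  index sets.
\<close>
lemma translated_gaussian_identity:
  fixes A :: "'i \<Rightarrow> complex" and P :: "'i \<Rightarrow> real" and B :: "'j \<Rightarrow> complex" and Q :: "'j \<Rightarrow> real"
  assumes P: "\<And>i. P i > 0" and Q: "\<And>j. Q j > 0"
    and intA: "\<And>t. t > 0 \<Longrightarrow> integrable (count_space UNIV) (\<lambda>i. norm (A i) * exp (- pi * t * (P i)\<^sup>2))"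
    and intB: "\<And>t. t > 0 \<Longrightarrow> integrable (count_space UNIV) (\<lambda>j. norm (B j) * exp (- pi * t * (Q j)\<^sup>2))"
    and gauss: "\<And>t. t > 0 \<Longrightarrow>
      (\<integral>i. A i * of_real (exp (- pi * t * (P i)\<^sup>2)) \<partial>count_space UNIV) =
      of_real (1 / (t * sqrt t)) * (\<integral>j. B j * of_real (exp (- pi * (Q j)\<^sup>2 / t)) \<partial>count_space UNIV)"
    and t: "t > 0"
  shows "(\<integral>i. A i * of_real (sinh (2 * pi * t * y * P i) * exp (- pi * t * (P i)\<^sup>2) / P i) \<partial>count_space UNIV) =
    (\<integral>j. B j * of_real (exp (pi * t * y\<^sup>2) * (exp (- pi * (Q j)\<^sup>2 / t) / sqrt t * (sin (2 * pi * Q j * y) / Q j))) \<partial>count_space UNIV)"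
proof -
  let ?f = "\<lambda>i k. A i * of_real (gauss_coeff t (P i) k)"
  let ?g = "\<lambda>j k. B j * dual_coeff t (Q j) k"
  have "(\<integral>i. (\<Sum>k. of_real (sinh_coeff t y k) * ?f i k) \<partial>count_space UNIV) =
     (\<integral>j. (\<Sum>k. of_real (sinh_coeff t y k) * ?g j k) \<partial>count_space UNIV)"
  proof (rule integral_expansion_transfer[where \<rho> = "t / 2"])
    show "integrable (count_space UNIV) (\<lambda>i. norm (A i) * exp (- pi * (t / 2) * (P i)\<^sup>2))"
      using t by (intro intA) simp
    show "norm (?f i k) * (t / 2) ^ k \<le> norm (A i) * exp (- pi * (t / 2) * (P i)\<^sup>2)" for i k
      using mult_left_mono[OF gauss_coeff_bound[OF t, of "P i" k], of "norm (A i)"]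
      by (simp add: norm_mult mult_ac)
    show "integrable (count_space UNIV)
        (\<lambda>j. (norm (B j) * exp (- pi * (2 / (9 * t)) * (Q j)\<^sup>2)) * (1 / (t / 2 * sqrt (t / 2))))"
      using t by (intro integrable_mult_left intB) simp
    show "norm (?g j k) * (t / 2) ^ k \<le>
        (norm (B j) * exp (- pi * (2 / (9 * t)) * (Q j)\<^sup>2)) * (1 / (t / 2 * sqrt (t / 2)))" for j k
      using mult_left_mono[OF dual_coeff_bound[OF t, of "Q j" k], of "norm (B j)"]
      by (simp add: norm_mult mult_ac)
    show "summable (\<lambda>k. norm (complex_of_real (sinh_coeff t y k)) / (t / 2) ^ k)"
      using summable_sinh_coeff[of "t / 2"] t by simp
    fix h :: real assume h: "\<bar>h\<bar> < t / 2"
    then have th: "t - h > 0" using t by linarith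
    have "(\<lambda>k. of_real h ^ k * ?f i k) sums (A i * of_real (exp (- pi * (t - h) * (P i)\<^sup>2)))" for i
      using sums_mult[OF sums_of_real[OF gauss_coeff_sums[of h t "P i"], where 'a = complex], of "A i"]
      by (simp add: mult_ac)
    then have "(\<integral>i. (\<Sum>k. of_real h ^ k * ?f i k) \<partial>count_space UNIV) =
       (\<integral>i. A i * of_real (exp (- pi * (t - h) * (P i)\<^sup>2)) \<partial>count_space UNIV)"
      by (simp add: sums_iff)
    also have "\<dots> = (\<integral>j. of_real (1 / ((t - h) * sqrt (t - h))) * (B j * of_real (exp (- pi * (Q j)\<^sup>2 / (t - h)))) \<partial>count_space UNIV)"
      unfolding gauss[OF th] by (simp only: integral_mult_right_zero)
    also have "\<dots> = (\<integral>j. (\<Sum>k. of_real h ^ k * ?g j k) \<partial>count_space UNIV)"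
    proof (rule Bochner_Integration.integral_cong[OF refl])
      fix j
      have "(\<lambda>k. of_real h ^ k * ?g j k) sums
        (of_real (1 / ((t - h) * sqrt (t - h))) * (B j * of_real (exp (- pi * (Q j)\<^sup>2 / (t - h)))))"
        using sums_mult[OF dual_coeff_sums[OF t h, of "Q j"], of "B j"] by (simp add: mult_ac)
      then show "of_real (1 / ((t - h) * sqrt (t - h))) * (B j * of_real (exp (- pi * (Q j)\<^sup>2 / (t - h)))) =
        (\<Sum>k. of_real h ^ k * ?g j k)" by (simp only: sums_iff)
    qed
    finally show "(\<integral>i. (\<Sum>k. of_real h ^ k * ?f i k) \<partial>count_space UNIV) =
      (\<integral>j. (\<Sum>k. of_real h ^ k * ?g j k) \<partial>count_space UNIV)" .
  qed (use t in auto)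
  moreover have "(\<Sum>k. of_real (sinh_coeff t y k) * ?f i k) =
    A i * of_real (sinh (2 * pi * t * y * P i) * exp (- pi * t * (P i)\<^sup>2) / P i)" for i
  proof -
    have "(\<lambda>k. sinh_coeff t y k * gauss_coeff t (P i) k) sums
      (sinh (2 * pi * t * y * P i) * exp (- pi * t * (P i)\<^sup>2) / P i)"
      using sums_divide[OF sinh_coeff_gauss_coeff_sums[of t y "P i"], of "P i"] P[of i]
      by simp
    from sums_mult[OF sums_of_real[OF this, where 'a = complex], of "A i"]
    show ?thesis by (simp add: sums_iff mult_ac)
  qed
  moreover have "(\<Sum>k. of_real (sinh_coeff t y k) * ?g j k) =
    B j * of_real (exp (pi * t * y\<^sup>2) * (exp (- pi * (Q j)\<^sup>2 / t) / sqrt t * (sin (2 * pi * Q j * y) / Q j)))" for j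
  proof -
    have "summable (\<lambda>k. norm (of_real (sinh_coeff t y k) * dual_coeff t (Q j) k))"
    proof (rule summable_comparison_test'[where N = 0])
      let ?C = "exp (- pi * (Q j)\<^sup>2 * (2 / (9 * t))) / (t / 2 * sqrt (t / 2))"
      show "summable (\<lambda>k. \<bar>sinh_coeff t y k\<bar> / (t / 2) ^ k * ?C)"
        using t by (intro summable_mult2 summable_sinh_coeff) simp
      fix k
      show "norm (norm (of_real (sinh_coeff t y k) * dual_coeff t (Q j) k)) \<le> \<bar>sinh_coeff t y k\<bar> / (t / 2) ^ k * ?C"
        using mult_left_mono[OF dual_coeff_bound[OF t, of "Q j" k], of "\<bar>sinh_coeff t y k\<bar> / (t / 2) ^ k"] t
        by (simp add: norm_mult)
    qed
    then have "summable (\<lambda>k. of_real (sinh_coeff t y k) * dual_coeff t (Q j) k)"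
      by (rule summable_norm_cancel)
    from suminf_mult[OF this, of "B j"] show ?thesis
      unfolding sums_dual_coeff_sinh_coeff[OF t Q] by (simp only: mult.left_commute[of _ "B j"])
  qed
  ultimately show ?thesis by simp
qed


section \<open>Convolution with narrow Gaussians\<close>

lemma Fubini_count_space_lborel:
  fixes F :: "'i::countable \<Rightarrow> real \<Rightarrow> complex"
  assumes int: "\<And>i. integrable lborel (F i)"
    and norm: "integrable (count_space UNIV) (\<lambda>i. \<integral>y. norm (F i y) \<partial>lborel)"
  shows "(\<integral>i. (\<integral>y. F i y \<partial>lborel) \<partial>count_space UNIV) = (\<integral>y. (\<integral>i. F i y \<partial>count_space UNIV) \<partial>lborel)"
proof -
  interpret pair_sigma_finite "count_space (UNIV :: 'i set)" "lborel :: real measure"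
    by (intro pair_sigma_finite.intro sigma_finite_measure_count_space_countable)
       (auto intro: lborel.sigma_finite_measure_axioms)
  have "integrable (count_space UNIV \<Otimes>\<^sub>M lborel) (case_prod F)"
  proof (rule Fubini_integrable)
    show "case_prod F \<in> borel_measurable (count_space UNIV \<Otimes>\<^sub>M lborel)"
      using int by (intro measurable_pair_measure_countable1) auto
  qed (use int norm in auto)
  from Fubini_integral[OF this] show ?thesis by simp
qed

text \<open>
  Peetre's inequality: convolution with a rapidly decreasing function preserves polynomial decay.
\<close>
lemma weight_peetre:
  fixes x s :: real
  shows "1 + x\<^sup>2 \<le> 2 * (1 + (x - s)\<^sup>2) * (1 + s\<^sup>2)"
proof -
  have "0 \<le> (x - 2 * s)\<^sup>2 + 1 + 2 * ((x - s) * s)\<^sup>2" by simp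
  then show ?thesis by (simp add: power2_eq_square algebra_simps)
qed

text \<open>
  The Gaussian of total mass \<open>1\<close> that concentrates at the origin as \<open>t \<rightarrow> \<infinity>\<close>.
\<close>
definition gauss_kernel :: "real \<Rightarrow> real \<Rightarrow> real" where
  "gauss_kernel t x = sqrt t * exp (- pi * t * x\<^sup>2)"

text \<open>
  The substitution \<open>y = x - s / sqrt t\<close> moves the dependence on \<open>t\<close> from the kernel into the argument
  of \<open>f\<close>, where both the bound and the limit for large \<open>t\<close> can be read off.
\<close>
lemma has_bochner_integral_gauss_kernel_iff:
  fixes f :: "real \<Rightarrow> 'a :: {real_normed_field, banach, second_countable_topology}"
  assumes "t > 0"
  shows "has_bochner_integral lborel (\<lambda>y. f y * of_real (gauss_kernel t (x - y))) I \<longleftrightarrow>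
    has_bochner_integral lborel (\<lambda>s. f (x - s / sqrt t) * of_real (exp (- pi * s\<^sup>2))) I"
proof -
  define c where "c = - 1 / sqrt t"
  have c: "c \<noteq> 0" "\<bar>c\<bar> = 1 / sqrt t" using assms by (auto simp: c_def)
  have "f (x + c * s) * of_real (gauss_kernel t (x - (x + c * s))) =
     sqrt t *\<^sub>R (f (x - s / sqrt t) * of_real (exp (- pi * s\<^sup>2)))" for s
    using assms by (simp add: c_def gauss_kernel_def power_divide scaleR_conv_of_real mult_ac)
  then have "has_bochner_integral lborel (\<lambda>y. f y * of_real (gauss_kernel t (x - y))) I \<longleftrightarrow>
     has_bochner_integral lborel (\<lambda>s. sqrt t *\<^sub>R (f (x - s / sqrt t) * of_real (exp (- pi * s\<^sup>2)))) (sqrt t *\<^sub>R I)"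
    using assms by (subst lborel_has_bochner_integral_real_affine_iff[OF c(1), of _ _ x])
       (simp add: c(2))
  also have "\<dots> \<longleftrightarrow> has_bochner_integral lborel (\<lambda>s. f (x - s / sqrt t) * of_real (exp (- pi * s\<^sup>2))) I"
    using assms has_bochner_integral_scaleR_right[of "1 / sqrt t" lborel "\<lambda>s. sqrt t *\<^sub>R (f (x - s / sqrt t) * of_real (exp (- pi * s\<^sup>2)))" "sqrt t *\<^sub>R I"]
      has_bochner_integral_scaleR_right[of "sqrt t" lborel "\<lambda>s. f (x - s / sqrt t) * of_real (exp (- pi * s\<^sup>2))" I]
    by auto
  finally show ?thesis .
qed

lemma integrable_weight_gaussian: "integrable lborel (\<lambda>s::real. (1 + s\<^sup>2) ^ 3 * exp (- pi * s\<^sup>2))"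
proof -
  have int: "integrable lborel (\<lambda>s::real. \<bar>s\<bar> ^ k * exp (- pi * s\<^sup>2))" for k
    using integrable_gaussian_moment_abs[of 1 0 k] by simp
  have "integrable lborel (\<lambda>s::real. \<bar>s\<bar> ^ 0 * exp (- pi * s\<^sup>2) + 3 * (\<bar>s\<bar> ^ 2 * exp (- pi * s\<^sup>2)) +
     3 * (\<bar>s\<bar> ^ 4 * exp (- pi * s\<^sup>2)) + \<bar>s\<bar> ^ 6 * exp (- pi * s\<^sup>2))"
    by (intro Bochner_Integration.integrable_add integrable_mult_right int)
  moreover have "\<bar>s\<bar> ^ 0 * exp (- pi * s\<^sup>2) + 3 * (\<bar>s\<bar> ^ 2 * exp (- pi * s\<^sup>2)) +
     3 * (\<bar>s\<bar> ^ 4 * exp (- pi * s\<^sup>2)) + \<bar>s\<bar> ^ 6 * exp (- pi * s\<^sup>2) = (1 + s\<^sup>2) ^ 3 * exp (- pi * s\<^sup>2)" for s :: real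
    by (simp add: power_even_abs algebra_simps power3_eq_cube power2_eq_square numeral_eq_Suc)
  ultimately show ?thesis by simp
qed

definition gauss_mass :: real where
  "gauss_mass = (\<integral>s. (1 + s\<^sup>2) ^ 3 * exp (- pi * s\<^sup>2) \<partial>lborel)"

text \<open>
  The bound is uniform in \<open>t \<ge> 1\<close>, as needed for the limit \<open>t \<rightarrow> \<infinity>\<close> under the sum over the index set.
\<close>
lemma gauss_convolution_bound:
  fixes f :: "real \<Rightarrow> real"
  assumes t: "t \<ge> 1" and meas: "f \<in> borel_measurable borel"
    and bound: "\<And>x. \<bar>f x\<bar> \<le> C / (1 + x\<^sup>2) ^ 3"
  shows "integrable lborel (\<lambda>y. f y * gauss_kernel t (x - y))"
    and "(\<integral>y. f y * gauss_kernel t (x - y) \<partial>lborel) \<le> 8 * C * gauss_mass / (1 + x\<^sup>2) ^ 3"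
proof -
  have C: "C \<ge> 0" using bound[of 0] by simp
  let ?g = "\<lambda>s. f (x - s / sqrt t) * exp (- pi * s\<^sup>2)"
  let ?h = "\<lambda>s. 8 * C / (1 + x\<^sup>2) ^ 3 * ((1 + s\<^sup>2) ^ 3 * exp (- pi * s\<^sup>2))"
  have b: "\<bar>?g s\<bar> \<le> ?h s" for s
  proof -
    have p1: "0 < 1 + u\<^sup>2" for u :: real by (simp add: add_pos_nonneg)
    have "s\<^sup>2 / t \<le> s\<^sup>2 / 1" using t by (intro divide_left_mono) auto
    then have st: "(s / sqrt t)\<^sup>2 \<le> s\<^sup>2" using t by (simp add: power_divide)
    have "1 + x\<^sup>2 \<le> 2 * (1 + (x - s / sqrt t)\<^sup>2) * (1 + (s / sqrt t)\<^sup>2)" by (rule weight_peetre)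
    also have "\<dots> \<le> 2 * (1 + (x - s / sqrt t)\<^sup>2) * (1 + s\<^sup>2)"
      using st by (intro mult_left_mono) auto
    finally have "(1 + x\<^sup>2) ^ 3 \<le> (2 * (1 + (x - s / sqrt t)\<^sup>2) * (1 + s\<^sup>2)) ^ 3"
      by (intro power_mono) auto
    also have "\<dots> = 2 ^ 3 * (1 + (x - s / sqrt t)\<^sup>2) ^ 3 * (1 + s\<^sup>2) ^ 3"
      by (simp only: power_mult_distrib)
    finally have "(1 + x\<^sup>2) ^ 3 \<le> 8 * (1 + (x - s / sqrt t)\<^sup>2) ^ 3 * (1 + s\<^sup>2) ^ 3"
      by simp
    then have w: "1 / (1 + (x - s / sqrt t)\<^sup>2) ^ 3 \<le> 8 * (1 + s\<^sup>2) ^ 3 / (1 + x\<^sup>2) ^ 3"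
      using p1 by (simp add: divide_simps mult_ac)
    have "\<bar>f (x - s / sqrt t)\<bar> \<le> C * (1 / (1 + (x - s / sqrt t)\<^sup>2) ^ 3)"
      using bound[of "x - s / sqrt t"] by simp
    also have "\<dots> \<le> C * (8 * (1 + s\<^sup>2) ^ 3 / (1 + x\<^sup>2) ^ 3)"
      by (intro mult_left_mono w C)
    finally have "\<bar>f (x - s / sqrt t)\<bar> * exp (- pi * s\<^sup>2) \<le> C * (8 * (1 + s\<^sup>2) ^ 3 / (1 + x\<^sup>2) ^ 3) * exp (- pi * s\<^sup>2)"
      by (rule mult_right_mono) simp
    then show ?thesis by (simp add: abs_mult mult_ac)
  qed
  have inth: "integrable lborel ?h" by (intro integrable_mult_right integrable_weight_gaussian)
  have intg: "integrable lborel ?g"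
    by (rule Bochner_Integration.integrable_bound[OF inth])
       (use meas in measurable, rule AE_I2, simp only: real_norm_def, rule order_trans[OF b abs_ge_self])
  have eq: "has_bochner_integral lborel (\<lambda>y. f y * gauss_kernel t (x - y)) (\<integral>s. ?g s \<partial>lborel)"
    using has_bochner_integral_integrable[OF intg] t
    by (subst has_bochner_integral_gauss_kernel_iff[where f = f, unfolded of_real_eq_id id_apply]) auto
  show "integrable lborel (\<lambda>y. f y * gauss_kernel t (x - y))"
    using eq by (simp add: has_bochner_integral_iff)
  have "(\<integral>s. ?g s \<partial>lborel) \<le> (\<integral>s. ?h s \<partial>lborel)"
    using b by (intro integral_mono intg inth) (auto intro: order_trans[OF abs_ge_self])
  then show "(\<integral>y. f y * gauss_kernel t (x - y) \<partial>lborel) \<le> 8 * C * gauss_mass / (1 + x\<^sup>2) ^ 3"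
    using has_bochner_integral_integral_eq[OF eq] by (simp add: gauss_mass_def)
qed

lemma gauss_convolution_tendsto:
  fixes f :: "real \<Rightarrow> complex"
  assumes cont: "continuous_on UNIV f" and bound: "\<And>x. norm (f x) \<le> C"
  shows "(\<lambda>n. \<integral>y. f y * of_real (gauss_kernel (real (Suc n)) (x - y)) \<partial>lborel) \<longlonglongrightarrow> f x"
proof -
  have [measurable]: "f \<in> borel_measurable borel"
    using cont by (rule borel_measurable_continuous_onI)
  let ?g = "\<lambda>n s. f (x - s / sqrt (real (Suc n))) * of_real (exp (- pi * s\<^sup>2))"
  have int1: "integrable lborel (\<lambda>s::real. exp (- pi * s\<^sup>2))"
    using integrable_gaussian[of 1 0] by simp
  have inth: "integrable lborel (\<lambda>s. C * exp (- pi * s\<^sup>2))"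
    using int1 by (rule integrable_mult_right)
  have bd: "norm (?g n s) \<le> C * exp (- pi * s\<^sup>2)" for n s
    using bound by (simp add: norm_mult mult_right_mono)
  have lim: "(\<lambda>n. ?g n s) \<longlonglongrightarrow> f x * of_real (exp (- pi * s\<^sup>2))" for s
  proof -
    have "(\<lambda>n. x - s / sqrt (real (Suc n))) \<longlonglongrightarrow> x"
      by real_asymp
    then show ?thesis
      using cont by (intro tendsto_mult tendsto_const)
        (auto intro: continuous_on_tendsto_compose[OF cont])
  qed
  have "(\<lambda>n. \<integral>s. ?g n s \<partial>lborel) \<longlonglongrightarrow> (\<integral>s. f x * of_real (exp (- pi * s\<^sup>2)) \<partial>lborel)"
    by (rule integral_dominated_convergence[where w = "\<lambda>s. C * exp (- pi * s\<^sup>2)"])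
       (use inth lim bd in auto)
  moreover have "(\<integral>s. f x * of_real (exp (- pi * s\<^sup>2)) \<partial>lborel) = f x"
    using integral_gaussian[of 1 0] by simp
  moreover have "(\<integral>s. ?g n s \<partial>lborel) = (\<integral>y. f y * of_real (gauss_kernel (real (Suc n)) (x - y)) \<partial>lborel)" for n
  proof -
    have "integrable lborel (?g n)"
      by (rule Bochner_Integration.integrable_bound[OF inth])
         (use bd in \<open>auto intro!: AE_I2 intro: order_trans[OF _ abs_ge_self]\<close>)
    then have "has_bochner_integral lborel (\<lambda>y. f y * of_real (gauss_kernel (real (Suc n)) (x - y))) (\<integral>s. ?g n s \<partial>lborel)"
      by (subst has_bochner_integral_gauss_kernel_iff) (auto simp: has_bochner_integral_integrable)
    then show ?thesis by (simp add: has_bochner_integral_integral_eq)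
  qed
  ultimately show ?thesis by (simp only:)
qed

lemma gaussian_le_weight:
  fixes p :: real
  assumes t: "t > 0"
  shows "exp (- pi * t * p\<^sup>2) \<le> 24 * exp (pi * t) / (pi * t) ^ 4 / (1 + p\<^sup>2) ^ 4"
proof -
  have p1: "0 < 1 + p\<^sup>2" by (simp add: add_pos_nonneg)
  have "(1 + p\<^sup>2) ^ 4 = (pi * t * (1 + p\<^sup>2)) ^ 4 / fact 4 * (24 / (pi * t) ^ 4)"
    using t by (simp add: power_mult_distrib fact_numeral)
  also have "\<dots> \<le> exp (pi * t * (1 + p\<^sup>2)) * (24 / (pi * t) ^ 4)"
    using t p1 by (intro mult_right_mono power_div_fact_le_exp) auto
  also have "\<dots> = 24 * exp (pi * t) / (pi * t) ^ 4 * exp (pi * t * p\<^sup>2)"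
    by (simp add: exp_add[symmetric] algebra_simps)
  finally have "(1 + p\<^sup>2) ^ 4 * exp (- pi * t * p\<^sup>2) \<le>
     24 * exp (pi * t) / (pi * t) ^ 4 * exp (pi * t * p\<^sup>2) * exp (- pi * t * p\<^sup>2)"
    by (rule mult_right_mono) simp
  also have "\<dots> = 24 * exp (pi * t) / (pi * t) ^ 4" by (simp add: exp_minus)
  finally show ?thesis using p1 by (simp only: pos_le_divide_eq zero_less_power mult.commute)
qed

lemma gaussian_le_weight_divide:
  assumes t: "t > 0" and p: "p > (0::real)"
  shows "exp (- pi * t * p\<^sup>2) \<le> 24 * exp (pi * t) / (pi * t) ^ 4 * (1 / p / (1 + p\<^sup>2) ^ 3)"
proof -
  have p1: "0 < 1 + p\<^sup>2" by (simp add: add_pos_nonneg)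
  have "(p - 1)\<^sup>2 \<ge> 0" by simp
  then have "2 * p \<le> 1 + p\<^sup>2" by (simp add: power2_eq_square algebra_simps)
  then have "p \<le> 1 + p\<^sup>2" using p by linarith
  then have "p * (1 + p\<^sup>2) ^ 3 \<le> (1 + p\<^sup>2) * (1 + p\<^sup>2) ^ 3"
    using p1 by (intro mult_right_mono) auto
  then have "p * (1 + p\<^sup>2) ^ 3 \<le> (1 + p\<^sup>2) ^ 4"
    by (simp add: power_Suc[symmetric] del: power_Suc)
  then have "24 * exp (pi * t) / (pi * t) ^ 4 / (1 + p\<^sup>2) ^ 4 \<le> 24 * exp (pi * t) / (pi * t) ^ 4 / (p * (1 + p\<^sup>2) ^ 3)"
    using p p1 t by (intro divide_left_mono) auto
  from order_trans[OF gaussian_le_weight[OF t] this] show ?thesis by simp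
qed


section \<open>The summation formula\<close>

text \<open>
  Convergence with the polynomial weights that occur for Schwartz functions implies convergence with every
  Gaussian weight.
\<close>
lemma integrable_weighted_gaussian:
  fixes c :: "'i \<Rightarrow> complex" and p :: "'i \<Rightarrow> real"
  assumes "\<And>i. p i > 0" "integrable (count_space UNIV) (\<lambda>i. norm (c i) / p i / (1 + (p i)\<^sup>2) ^ 3)" "t > 0"
  shows "integrable (count_space UNIV) (\<lambda>i. norm (c i) * exp (- pi * t * (p i)\<^sup>2))"
proof (rule Bochner_Integration.integrable_bound)
  show "integrable (count_space UNIV) (\<lambda>i. 24 * exp (pi * t) / (pi * t) ^ 4 * (norm (c i) / p i / (1 + (p i)\<^sup>2) ^ 3))"
    by (intro integrable_mult_right assms)
  show "AE i in count_space UNIV. norm (norm (c i) * exp (- pi * t * (p i)\<^sup>2)) \<le>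
     norm (24 * exp (pi * t) / (pi * t) ^ 4 * (norm (c i) / p i / (1 + (p i)\<^sup>2) ^ 3))"
  proof (rule AE_I2)
    fix i
    have "norm (norm (c i) * exp (- pi * t * (p i)\<^sup>2)) \<le> norm (c i) * (24 * exp (pi * t) / (pi * t) ^ 4 * (1 / p i / (1 + (p i)\<^sup>2) ^ 3))"
      using mult_left_mono[OF gaussian_le_weight_divide[OF assms(3) assms(1)[of i]], of "norm (c i)"]
      by (simp add: abs_mult)
    also have "\<dots> = 24 * exp (pi * t) / (pi * t) ^ 4 * (norm (c i) / p i / (1 + (p i)\<^sup>2) ^ 3)"
      by simp
    finally show "norm (norm (c i) * exp (- pi * t * (p i)\<^sup>2)) \<le>
     norm (24 * exp (pi * t) / (pi * t) ^ 4 * (norm (c i) / p i / (1 + (p i)\<^sup>2) ^ 3))"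
      unfolding real_norm_def by (rule order_trans[OF _ abs_ge_self])
  qed
qed simp

lemma gauss_kernel_diff:
  "gauss_kernel t (p - y) - gauss_kernel t (- p - y) =
    2 * sqrt t * exp (- pi * t * y\<^sup>2) * (sinh (2 * pi * t * y * p) * exp (- pi * t * p\<^sup>2))"
proof -
  have "exp (- pi * t * (p - y)\<^sup>2) = exp (- pi * t * y\<^sup>2) * exp (- pi * t * p\<^sup>2) * exp (2 * pi * t * y * p)"
    "exp (- pi * t * (- p - y)\<^sup>2) = exp (- pi * t * y\<^sup>2) * exp (- pi * t * p\<^sup>2) * exp (- (2 * pi * t * y * p))"
    unfolding exp_add[symmetric] by (simp_all add: power2_eq_square algebra_simps)
  then show ?thesis unfolding gauss_kernel_def by (simp add: sinh_def field_simps)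
qed

lemma fourier_odd_part:
  assumes "integrable lborel \<phi>"
  shows "fourier \<phi> \<xi> - fourier \<phi> (- \<xi>) = - 2 * \<i> * (\<integral>y. \<phi> y * of_real (sin (2 * pi * \<xi> * y)) \<partial>lborel)"
proof -
  have int: "integrable lborel (\<lambda>x. \<phi> x * cis (a * x))" for a
    using assms by (intro integrable_mult_unimodular) auto
  have "fourier \<phi> \<xi> - fourier \<phi> (- \<xi>) = (\<integral>y. \<phi> y * cis (- 2 * pi * \<xi> * y) - \<phi> y * cis (- 2 * pi * - \<xi> * y) \<partial>lborel)"
    unfolding fourier_cis using int[of "- 2 * pi * \<xi>"] int[of "- 2 * pi * - \<xi>"] by simp
  also have "\<dots> = (\<integral>y. (- 2 * \<i>) * (\<phi> y * of_real (sin (2 * pi * \<xi> * y))) \<partial>lborel)"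
    by (intro Bochner_Integration.integral_cong refl) (simp add: complex_eq_iff algebra_simps)
  finally show ?thesis by (simp only: integral_mult_right_zero)
qed

text \<open>
  The data of a summation formula: two families of weighted positive numbers whose Gaussian sums are
  exchanged by \<open>t \<mapsto> 1/t\<close> with weight \<open>3/2\<close>.
\<close>
locale gaussian_duality =
  fixes A :: "'i::countable \<Rightarrow> complex" and P :: "'i \<Rightarrow> real"
    and B :: "'j::countable \<Rightarrow> complex" and Q :: "'j \<Rightarrow> real"
  assumes P_pos: "P i > 0" and Q_pos: "Q j > 0"
    and summable_A: "integrable (count_space UNIV) (\<lambda>i. norm (A i) / P i / (1 + (P i)\<^sup>2) ^ 3)"
    and summable_B: "integrable (count_space UNIV) (\<lambda>j. norm (B j) / Q j / (1 + (Q j)\<^sup>2) ^ 3)"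
    and gauss: "t > 0 \<Longrightarrow>
      (\<integral>i. A i * of_real (exp (- pi * t * (P i)\<^sup>2)) \<partial>count_space UNIV) =
      of_real (1 / (t * sqrt t)) * (\<integral>j. B j * of_real (exp (- pi * (Q j)\<^sup>2 / t)) \<partial>count_space UNIV)"
begin

lemmas integrable_gaussian_A = integrable_weighted_gaussian[OF P_pos summable_A]
lemmas integrable_gaussian_B = integrable_weighted_gaussian[OF Q_pos summable_B]

text \<open>
  The identity for translated Gaussians is integrated over the translation \<open>y\<close> against \<open>\<phi> y\<close>. On the
  left this produces convolutions, on the right the Fourier transform of \<open>\<phi>\<close> damped by a Gaussian. The
  damping makes the right-hand side converge absolutely for every integrable \<open>\<phi>\<close>.
\<close>
lemma smoothed_summation_formula:
  fixes \<phi> :: "real \<Rightarrow> complex"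
  assumes t: "t \<ge> 1" and cont: "continuous_on UNIV \<phi>"
    and bound: "\<And>x. norm (\<phi> x) \<le> C / (1 + x\<^sup>2) ^ 3" and int: "integrable lborel \<phi>"
  defines "conv \<equiv> \<lambda>x. \<integral>y. \<phi> y * of_real (gauss_kernel t (x - y)) \<partial>lborel"
  shows "(\<integral>i. A i / of_real (P i) * (conv (P i) - conv (- P i)) \<partial>count_space UNIV) =
    \<i> * (\<integral>j. B j / of_real (Q j) * (of_real (exp (- pi * (Q j)\<^sup>2 / t)) * (fourier \<phi> (Q j) - fourier \<phi> (- Q j))) \<partial>count_space UNIV)"
proof -
  have t0: "t > 0" using t by simp
  have [measurable]: "\<phi> \<in> borel_measurable borel"
    using cont by (rule borel_measurable_continuous_onI)
  have gk: "gauss_kernel t x \<ge> 0" for x using t0 by (simp add: gauss_kernel_def)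
  have nb: "integrable lborel (\<lambda>y. norm (\<phi> y) * gauss_kernel t (x - y))"
      "(\<integral>y. norm (\<phi> y) * gauss_kernel t (x - y) \<partial>lborel) \<le> 8 * C * gauss_mass / (1 + x\<^sup>2) ^ 3" for x
    using bound by (auto intro!: gauss_convolution_bound[OF t])
  have intc: "integrable lborel (\<lambda>y. \<phi> y * of_real (gauss_kernel t (x - y)))" for x
    by (rule Bochner_Integration.integrable_bound[OF nb(1)[of x]])
       (auto simp: norm_mult gauss_kernel_def)
  define F where "F i y = A i / of_real (P i) * (\<phi> y * of_real (gauss_kernel t (P i - y)) - \<phi> y * of_real (gauss_kernel t (- P i - y)))" for i y
  have F_int: "integrable lborel (F i)" for i
    unfolding F_def by (intro integrable_mult_right Bochner_Integration.integrable_diff intc)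
  have F_norm: "integrable (count_space UNIV) (\<lambda>i. \<integral>y. norm (F i y) \<partial>lborel)"
  proof (rule Bochner_Integration.integrable_bound)
    show "integrable (count_space UNIV) (\<lambda>i. 2 * (8 * C * gauss_mass) * (norm (A i) / P i / (1 + (P i)\<^sup>2) ^ 3))"
      by (intro integrable_mult_right summable_A)
    show "AE i in count_space UNIV. norm (\<integral>y. norm (F i y) \<partial>lborel) \<le>
      norm (2 * (8 * C * gauss_mass) * (norm (A i) / P i / (1 + (P i)\<^sup>2) ^ 3))"
    proof (rule AE_I2)
      fix i
      let ?N = "\<lambda>x. \<integral>y. norm (\<phi> y) * gauss_kernel t (x - y) \<partial>lborel"
      have "norm (\<integral>y. norm (F i y) \<partial>lborel) = (\<integral>y. norm (F i y) \<partial>lborel)"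
        by (simp add: integral_nonneg_AE)
      also have "\<dots> \<le> (\<integral>y. norm (A i) / P i * (norm (\<phi> y) * gauss_kernel t (P i - y) + norm (\<phi> y) * gauss_kernel t (- P i - y)) \<partial>lborel)"
      proof (intro integral_mono integrable_norm F_int integrable_mult_right Bochner_Integration.integrable_add nb(1))
        fix y
        have "norm (\<phi> y * of_real (gauss_kernel t (P i - y)) - \<phi> y * of_real (gauss_kernel t (- P i - y))) \<le>
           norm (\<phi> y) * gauss_kernel t (P i - y) + norm (\<phi> y) * gauss_kernel t (- P i - y)"
          by (rule order_trans[OF norm_triangle_ineq4]) (use gk in \<open>simp add: norm_mult\<close>)
        from mult_left_mono[OF this, of "norm (A i) / P i"]
        show "norm (F i y) \<le> norm (A i) / P i * (norm (\<phi> y) * gauss_kernel t (P i - y) + norm (\<phi> y) * gauss_kernel t (- P i - y))"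
          using P_pos[of i] unfolding F_def norm_mult norm_divide by simp
      qed
      also have "\<dots> = norm (A i) / P i * (?N (P i) + ?N (- P i))"
        using nb(1)[of "P i"] nb(1)[of "- P i"] by simp
      also have "\<dots> \<le> norm (A i) / P i * (8 * C * gauss_mass / (1 + (P i)\<^sup>2) ^ 3 + 8 * C * gauss_mass / (1 + (- P i)\<^sup>2) ^ 3)"
        using P_pos[of i] by (intro mult_left_mono add_mono nb) auto
      also have "\<dots> = 2 * (8 * C * gauss_mass) * (norm (A i) / P i / (1 + (P i)\<^sup>2) ^ 3)"
        by (simp add: mult_ac)
      finally show "norm (\<integral>y. norm (F i y) \<partial>lborel) \<le> norm (2 * (8 * C * gauss_mass) * (norm (A i) / P i / (1 + (P i)\<^sup>2) ^ 3))"
        unfolding real_norm_def by (rule order_trans[OF _ abs_ge_self])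
    qed
  qed simp
  have F_inner: "(\<integral>y. F i y \<partial>lborel) = A i / of_real (P i) * (conv (P i) - conv (- P i))" for i
    unfolding F_def conv_def integral_mult_right_zero using intc[of "P i"] intc[of "- P i"] by simp
  define H where "H j y = B j / of_real (Q j) * of_real (exp (- pi * (Q j)\<^sup>2 / t)) * (2 * (\<phi> y * of_real (sin (2 * pi * Q j * y))))" for j y
  have s_int: "integrable lborel (\<lambda>y. \<phi> y * of_real (sin (2 * pi * Q j * y)))" for j
    using int by (intro integrable_mult_unimodular) auto
  have H_int: "integrable lborel (H j)" for j
    unfolding H_def by (intro integrable_mult_right s_int)
  have outer: "(\<integral>i. F i y \<partial>count_space UNIV) = (\<integral>j. H j y \<partial>count_space UNIV)" for y
  proof -
    have "(\<integral>i. F i y \<partial>count_space UNIV) = (\<integral>i. of_real (2 * sqrt t * exp (- pi * t * y\<^sup>2)) * \<phi> y *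
      (A i * of_real (sinh (2 * pi * t * y * P i) * exp (- pi * t * (P i)\<^sup>2) / P i)) \<partial>count_space UNIV)"
    proof (rule Bochner_Integration.integral_cong[OF refl])
      fix i
      have "F i y = A i / of_real (P i) * (\<phi> y * of_real (gauss_kernel t (P i - y) - gauss_kernel t (- P i - y)))"
        unfolding F_def by (simp add: right_diff_distrib)
      then show "F i y = of_real (2 * sqrt t * exp (- pi * t * y\<^sup>2)) * \<phi> y *
        (A i * of_real (sinh (2 * pi * t * y * P i) * exp (- pi * t * (P i)\<^sup>2) / P i))"
        unfolding gauss_kernel_diff by (simp add: mult_ac)
    qed
    also have "\<dots> = of_real (2 * sqrt t * exp (- pi * t * y\<^sup>2)) * \<phi> y *
      (\<integral>j. B j * of_real (exp (pi * t * y\<^sup>2) * (exp (- pi * (Q j)\<^sup>2 / t) / sqrt t * (sin (2 * pi * Q j * y) / Q j))) \<partial>count_space UNIV)"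
      unfolding integral_mult_right_zero
      by (subst translated_gaussian_identity[OF P_pos Q_pos integrable_gaussian_A integrable_gaussian_B gauss t0]) simp_all
    also have "\<dots> = (\<integral>j. H j y \<partial>count_space UNIV)"
      unfolding integral_mult_right_zero[symmetric]
    proof (rule Bochner_Integration.integral_cong[OF refl])
      fix j
      have e: "exp (- pi * t * y\<^sup>2) * exp (pi * t * y\<^sup>2) = 1" by (simp add: exp_add[symmetric])
      have "2 * sqrt t * exp (- pi * t * y\<^sup>2) * (exp (pi * t * y\<^sup>2) * (exp (- pi * (Q j)\<^sup>2 / t) / sqrt t * (sin (2 * pi * Q j * y) / Q j))) =
        (exp (- pi * t * y\<^sup>2) * exp (pi * t * y\<^sup>2)) * (2 * exp (- pi * (Q j)\<^sup>2 / t) * sin (2 * pi * Q j * y) / Q j)"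
        using t0 by (simp add: field_simps)
      also have "\<dots> = 2 * exp (- pi * (Q j)\<^sup>2 / t) * sin (2 * pi * Q j * y) / Q j" unfolding e by simp
      finally have r: "2 * sqrt t * exp (- pi * t * y\<^sup>2) * (exp (pi * t * y\<^sup>2) * (exp (- pi * (Q j)\<^sup>2 / t) / sqrt t * (sin (2 * pi * Q j * y) / Q j))) =
        2 * exp (- pi * (Q j)\<^sup>2 / t) * sin (2 * pi * Q j * y) / Q j" .
      have "of_real (2 * sqrt t * exp (- pi * t * y\<^sup>2)) * \<phi> y * (B j * of_real (exp (pi * t * y\<^sup>2) * (exp (- pi * (Q j)\<^sup>2 / t) / sqrt t * (sin (2 * pi * Q j * y) / Q j)))) =
        \<phi> y * B j * of_real (2 * sqrt t * exp (- pi * t * y\<^sup>2) * (exp (pi * t * y\<^sup>2) * (exp (- pi * (Q j)\<^sup>2 / t) / sqrt t * (sin (2 * pi * Q j * y) / Q j))))"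
        by (simp only: of_real_mult mult_ac)
      also have "\<dots> = H j y" unfolding r H_def by (simp add: mult_ac)
      finally show "of_real (2 * sqrt t * exp (- pi * t * y\<^sup>2)) * \<phi> y * (B j * of_real (exp (pi * t * y\<^sup>2) * (exp (- pi * (Q j)\<^sup>2 / t) / sqrt t * (sin (2 * pi * Q j * y) / Q j)))) = H j y" .
    qed
    finally show ?thesis .
  qed
  have H_norm: "integrable (count_space UNIV) (\<lambda>j. \<integral>y. norm (H j y) \<partial>lborel)"
  proof (rule Bochner_Integration.integrable_bound)
    let ?K = "2 * (\<integral>y. norm (\<phi> y) \<partial>lborel)"
    let ?S = "\<lambda>j. norm (B j) / Q j * exp (- pi * (1 / t) * (Q j)\<^sup>2)"
    show "integrable (count_space UNIV) (\<lambda>j. ?S j * ?K)"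
    proof (rule integrable_mult_left, rule Bochner_Integration.integrable_bound)
      let ?c = "24 * exp (pi * (1 / t)) / (pi * (1 / t)) ^ 4"
      show "integrable (count_space UNIV) (\<lambda>j. ?c * (norm (B j) / Q j / (1 + (Q j)\<^sup>2) ^ 3))"
        by (intro integrable_mult_right summable_B)
      show "AE j in count_space UNIV. norm (?S j) \<le> norm (?c * (norm (B j) / Q j / (1 + (Q j)\<^sup>2) ^ 3))"
      proof (rule AE_I2)
        fix j
        have "?c / (1 + (Q j)\<^sup>2) ^ 4 \<le> ?c / (1 + (Q j)\<^sup>2) ^ 3"
          using t0 by (intro divide_left_mono power_increasing) (auto intro!: mult_pos_pos zero_less_power add_pos_nonneg)
        then have "exp (- pi * (1 / t) * (Q j)\<^sup>2) \<le> ?c / (1 + (Q j)\<^sup>2) ^ 3"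
          using gaussian_le_weight[of "1 / t" "Q j"] t0 by (intro order_trans[OF gaussian_le_weight]) auto
        from mult_left_mono[OF this, of "norm (B j) / Q j"]
        have "norm (?S j) \<le> ?c * (norm (B j) / Q j / (1 + (Q j)\<^sup>2) ^ 3)"
          using Q_pos[of j] by (simp add: mult_ac abs_mult)
        then show "norm (?S j) \<le> norm (?c * (norm (B j) / Q j / (1 + (Q j)\<^sup>2) ^ 3))"
          unfolding real_norm_def by (rule order_trans[OF _ abs_ge_self])
      qed
    qed simp
    show "AE j in count_space UNIV. norm (\<integral>y. norm (H j y) \<partial>lborel) \<le> norm (?S j * ?K)"
    proof (rule AE_I2)
      fix j
      have "norm (\<integral>y. norm (H j y) \<partial>lborel) = (\<integral>y. norm (H j y) \<partial>lborel)"
        by (simp add: integral_nonneg_AE)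
      also have "\<dots> \<le> (\<integral>y. ?S j * (2 * norm (\<phi> y)) \<partial>lborel)"
      proof (intro integral_mono integrable_norm H_int integrable_mult_right int)
        fix y
        have "norm (\<phi> y) * \<bar>sin (2 * pi * Q j * y)\<bar> \<le> norm (\<phi> y) * 1"
          by (intro mult_left_mono) auto
        from mult_left_mono[OF this, of "?S j * 2"]
        show "norm (H j y) \<le> ?S j * (2 * norm (\<phi> y))"
          using Q_pos[of j] unfolding H_def norm_mult norm_divide by (simp add: mult_ac)
      qed
      also have "\<dots> = ?S j * ?K" by simp
      finally show "norm (\<integral>y. norm (H j y) \<partial>lborel) \<le> norm (?S j * ?K)"
        unfolding real_norm_def by (rule order_trans[OF _ abs_ge_self])
    qed
  qed simp
  have H_inner: "(\<integral>y. H j y \<partial>lborel) =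
     \<i> * (B j / of_real (Q j) * (of_real (exp (- pi * (Q j)\<^sup>2 / t)) * (fourier \<phi> (Q j) - fourier \<phi> (- Q j))))" for j
    unfolding H_def integral_mult_right_zero fourier_odd_part[OF int] by (simp add: mult_ac)
  have "(\<integral>i. A i / of_real (P i) * (conv (P i) - conv (- P i)) \<partial>count_space UNIV) =
     (\<integral>i. (\<integral>y. F i y \<partial>lborel) \<partial>count_space UNIV)" by (simp only: F_inner)
  also have "\<dots> = (\<integral>y. (\<integral>i. F i y \<partial>count_space UNIV) \<partial>lborel)"
    by (rule Fubini_count_space_lborel[OF F_int F_norm])
  also have "\<dots> = (\<integral>j. (\<integral>y. H j y \<partial>lborel) \<partial>count_space UNIV)"
    unfolding outer by (rule Fubini_count_space_lborel[OF H_int H_norm, symmetric])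
  finally show ?thesis unfolding H_inner integral_mult_right_zero .
qed

text \<open>
  Both sides of the smoothed formula converge as \<open>t \<rightarrow> \<infinity>\<close>, dominated by the decay of \<open>\<phi>\<close> on the left
  and of its Fourier transform on the right.
\<close>
lemma summation_formula:
  fixes \<phi> :: "real \<Rightarrow> complex"
  assumes cont: "continuous_on UNIV \<phi>"
    and bound: "\<And>x. norm (\<phi> x) \<le> C / (1 + x\<^sup>2) ^ 3" and int: "integrable lborel \<phi>"
    and dual: "\<And>\<xi>. norm (fourier \<phi> \<xi>) \<le> D / (1 + \<xi>\<^sup>2) ^ 3"
  shows "(\<integral>i. A i / of_real (P i) * (\<phi> (P i) - \<phi> (- P i)) \<partial>count_space UNIV) =
    \<i> * (\<integral>j. B j / of_real (Q j) * (fourier \<phi> (Q j) - fourier \<phi> (- Q j)) \<partial>count_space UNIV)"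
proof (rule LIMSEQ_unique)
  define conv where "conv n x = (\<integral>y. \<phi> y * of_real (gauss_kernel (real (Suc n)) (x - y)) \<partial>lborel)" for n x
  have [measurable]: "\<phi> \<in> borel_measurable borel"
    using cont by (rule borel_measurable_continuous_onI)
  have C: "C \<ge> 0" using norm_ge_zero[of "\<phi> 0"] bound[of 0] by (simp del: norm_ge_zero)
  have \<phi>_le: "norm (\<phi> x) \<le> C" for x
  proof -
    have "C / (1 + x\<^sup>2) ^ 3 \<le> C / 1"
      using C by (intro divide_left_mono one_le_power) (auto intro!: add_pos_nonneg)
    then show ?thesis using bound[of x] by simp
  qed
  let ?K = "8 * C * gauss_mass"
  have conv_bound: "norm (conv n x) \<le> ?K / (1 + x\<^sup>2) ^ 3" for n x
  proof -
    have "norm (conv n x) \<le> (\<integral>y. norm (\<phi> y * of_real (gauss_kernel (real (Suc n)) (x - y))) \<partial>lborel)"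
      unfolding conv_def by (rule integral_norm_bound)
    also have "\<dots> = (\<integral>y. norm (\<phi> y) * gauss_kernel (real (Suc n)) (x - y) \<partial>lborel)"
      by (simp add: norm_mult gauss_kernel_def del: of_nat_Suc)
    also have "\<dots> \<le> ?K / (1 + x\<^sup>2) ^ 3"
      using bound by (intro gauss_convolution_bound) auto
    finally show ?thesis .
  qed
  have conv_lim: "(\<lambda>n. conv n x) \<longlonglongrightarrow> \<phi> x" for x
    unfolding conv_def by (rule gauss_convolution_tendsto[OF cont \<phi>_le])
  show "(\<lambda>n. \<integral>i. A i / of_real (P i) * (conv n (P i) - conv n (- P i)) \<partial>count_space UNIV) \<longlonglongrightarrow>
     (\<integral>i. A i / of_real (P i) * (\<phi> (P i) - \<phi> (- P i)) \<partial>count_space UNIV)"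
  proof (rule integral_dominated_convergence[where w = "\<lambda>i. 2 * ?K * (norm (A i) / P i / (1 + (P i)\<^sup>2) ^ 3)"], goal_cases)
    case 4
    show ?case by (intro AE_I2 tendsto_intros conv_lim)
  next
    case (5 n)
    show ?case
    proof (rule AE_I2)
      fix i
      have "norm (conv n (P i) - conv n (- P i)) \<le> 2 * ?K / (1 + (P i)\<^sup>2) ^ 3"
        using norm_triangle_ineq4[of "conv n (P i)" "conv n (- P i)"] conv_bound[of n "P i"] conv_bound[of n "- P i"]
        by simp
      from mult_left_mono[OF this, of "norm (A i) / P i"]
      show "norm (A i / of_real (P i) * (conv n (P i) - conv n (- P i))) \<le> 2 * ?K * (norm (A i) / P i / (1 + (P i)\<^sup>2) ^ 3)"
        using P_pos[of i] by (simp add: norm_mult norm_divide mult_ac)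
    qed
  next
    case 3
    show ?case by (intro integrable_mult_right summable_A)
  qed simp_all
  have "(\<lambda>n. exp (- pi * q\<^sup>2 / real (Suc n))) \<longlonglongrightarrow> 1" for q :: real
    by real_asymp
  from tendsto_of_real[OF this, where 'a = complex]
  have e: "(\<lambda>n. complex_of_real (exp (- pi * q\<^sup>2 / real (Suc n)))) \<longlonglongrightarrow> 1" for q :: real
    by (simp only: of_real_1)
  have e': "(\<lambda>n. complex_of_real (exp (- pi * q\<^sup>2 / real (Suc n))) * z) \<longlonglongrightarrow> z" for q z
    using tendsto_mult[OF e[of q] tendsto_const[of z]] by simp
  have "(\<lambda>n. \<i> * (\<integral>j. B j / of_real (Q j) * (of_real (exp (- pi * (Q j)\<^sup>2 / real (Suc n))) * (fourier \<phi> (Q j) - fourier \<phi> (- Q j))) \<partial>count_space UNIV)) \<longlonglongrightarrow>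
     \<i> * (\<integral>j. B j / of_real (Q j) * (fourier \<phi> (Q j) - fourier \<phi> (- Q j)) \<partial>count_space UNIV)"
  proof (rule tendsto_mult[OF tendsto_const integral_dominated_convergence[where w = "\<lambda>j. 2 * D * (norm (B j) / Q j / (1 + (Q j)\<^sup>2) ^ 3)"]], goal_cases)
    case 4
    show ?case by (intro AE_I2 tendsto_mult tendsto_const e')
  next
    case (5 n)
    show ?case
    proof (rule AE_I2)
      fix j
      let ?e = "exp (- pi * (Q j)\<^sup>2 / real (Suc n))"
      have "norm (fourier \<phi> (Q j) - fourier \<phi> (- Q j)) \<le> 2 * D / (1 + (Q j)\<^sup>2) ^ 3"
        using norm_triangle_ineq4[of "fourier \<phi> (Q j)" "fourier \<phi> (- Q j)"] dual[of "Q j"] dual[of "- Q j"]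
        by simp
      then have "norm (complex_of_real ?e) * norm (fourier \<phi> (Q j) - fourier \<phi> (- Q j)) \<le> 1 * (2 * D / (1 + (Q j)\<^sup>2) ^ 3)"
        by (intro mult_mono) auto
      from mult_left_mono[OF this, of "norm (B j) / Q j"]
      show "norm (B j / of_real (Q j) * (of_real ?e * (fourier \<phi> (Q j) - fourier \<phi> (- Q j)))) \<le> 2 * D * (norm (B j) / Q j / (1 + (Q j)\<^sup>2) ^ 3)"
        using Q_pos[of j] unfolding norm_mult norm_divide by (simp add: mult_ac)
    qed
  next
    case 3
    show ?case by (intro integrable_mult_right summable_B)
  qed simp_all
  then show "(\<lambda>n. \<integral>i. A i / of_real (P i) * (conv n (P i) - conv n (- P i)) \<partial>count_space UNIV) \<longlonglongrightarrow>
     \<i> * (\<integral>j. B j / of_real (Q j) * (fourier \<phi> (Q j) - fourier \<phi> (- Q j)) \<partial>count_space UNIV)"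
    unfolding conv_def by (subst smoothed_summation_formula[OF _ cont bound int]) auto
qed

end


section \<open>Uniqueness of Fourier coefficients\<close>

lemma integrable_on_interval_if_continuous:
  fixes f :: "real \<Rightarrow> 'a :: euclidean_space"
  assumes "continuous_on UNIV f"
  shows "f integrable_on {a..b}"
  using assms by (intro integrable_continuous_interval) (rule continuous_on_subset, auto)

text \<open>
  Multiplication by \<open>a + cos (2 \<pi> (x - x0))\<close> shifts the frequency by at most one, so a function
  orthogonal to all characters stays orthogonal to them.
\<close>
lemma trig_power_integral_zero:
  fixes D :: "real \<Rightarrow> complex"
  assumes cont: "continuous_on UNIV D"
    and coeff: "\<And>k::int. integral {0..1} (\<lambda>x. D x * cis (2 * pi * k * x)) = 0"
  shows "integral {0..1} (\<lambda>x. D x * of_real ((a + cos (2 * pi * (x - x0))) ^ n) * cis (2 * pi * of_int k * x)) = 0"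
proof (induction n arbitrary: k)
  case 0
  then show ?case using coeff by simp
next
  case (Suc n)
  let ?Q = "\<lambda>x. a + cos (2 * pi * (x - x0))"
  let ?g = "\<lambda>k x. D x * of_real (?Q x ^ n) * cis (2 * pi * of_int k * x)"
  have cg: "continuous_on UNIV (?g k)" for k :: int
    by (intro continuous_intros cont)
  have "D x * of_real (?Q x ^ Suc n) * cis (2 * pi * of_int k * x) =
     of_real a * ?g k x + (cis (- 2 * pi * x0) / 2) * ?g (k + 1) x + (cis (2 * pi * x0) / 2) * ?g (k - 1) x" for x
  proof -
    have "cis (2 * pi * of_int (k + 1) * x) = cis (2 * pi * of_int k * x) * cis (2 * pi * x)"
      "cis (2 * pi * of_int (k - 1) * x) = cis (2 * pi * of_int k * x) * cis (- (2 * pi * x))"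
      unfolding cis_mult by (simp_all add: algebra_simps)
    moreover have "complex_of_real (cos (2 * pi * (x - x0))) =
       (cis (- 2 * pi * x0) * cis (2 * pi * x) + cis (2 * pi * x0) * cis (- (2 * pi * x))) / 2"
      unfolding cis_mult by (simp add: complex_eq_iff cos_diff sin_diff algebra_simps)
    ultimately show ?thesis by (simp add: algebra_simps add_divide_distrib)
  qed
  then have "integral {0..1} (\<lambda>x. D x * of_real (?Q x ^ Suc n) * cis (2 * pi * of_int k * x)) =
    integral {0..1} (\<lambda>x. of_real a * ?g k x + (cis (- 2 * pi * x0) / 2) * ?g (k + 1) x + (cis (2 * pi * x0) / 2) * ?g (k - 1) x)"
    by (simp only:)
  also have "\<dots> = of_real a * integral {0..1} (?g k) + (cis (- 2 * pi * x0) / 2) * integral {0..1} (?g (k + 1)) +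
     (cis (2 * pi * x0) / 2) * integral {0..1} (?g (k - 1))"
    by (subst Henstock_Kurzweil_Integration.integral_add,
        (intro integrable_on_interval_if_continuous continuous_intros cont)+,
        subst Henstock_Kurzweil_Integration.integral_add,
        (intro integrable_on_interval_if_continuous continuous_intros cont)+,
        simp only: integral_mult_right)
  also have "\<dots> = 0" by (simp only: Suc mult_zero_right add_0_right)
  finally show ?case .
qed

lemma cos_le_cos_away:
  assumes "0 < d" "d \<le> 1 / 2" "d \<le> \<bar>u\<bar>" "\<bar>u\<bar> \<le> 1 - d"
  shows "cos (2 * pi * u) \<le> cos (2 * pi * d)"
proof (cases "\<bar>u\<bar> \<le> 1 / 2")
  case True
  have "cos (2 * pi * u) = cos (2 * pi * \<bar>u\<bar>)" by (simp add: abs_if)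
  also have "\<dots> \<le> cos (2 * pi * d)"
    using assms True by (intro cos_monotone_0_pi_le) auto
  finally show ?thesis .
next
  case False
  have "cos (2 * pi * u) = cos (2 * pi * \<bar>u\<bar>)" by (simp add: abs_if)
  also have "\<dots> = cos (2 * pi * (1 - \<bar>u\<bar>))" by (simp add: right_diff_distrib cos_diff)
  also have "\<dots> \<le> cos (2 * pi * d)"
    using assms False by (intro cos_monotone_0_pi_le) auto
  finally show ?thesis .
qed

lemma cos_ge_cos_near:
  assumes "0 < d" "d \<le> 1 / 2" "\<bar>u\<bar> \<le> d"
  shows "cos (2 * pi * u) \<ge> cos (2 * pi * d)"
proof -
  have "cos (2 * pi * u) = cos (2 * pi * \<bar>u\<bar>)" by (simp add: abs_if)
  moreover have "\<dots> \<ge> cos (2 * pi * d)"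
    using assms by (intro cos_monotone_0_pi_le) auto
  ultimately show ?thesis by simp
qed

text \<open>
  The powers of \<open>Q x = 1 - cos (2 \<pi> d) + cos (2 \<pi> (x - x0))\<close> grow exponentially near \<open>x0\<close> and are bounded by \<open>1\<close> at
  distance more than \<open>d\<close> from it. If \<open>D x0\<close> were not zero, the integral of \<open>D * Q^n\<close> could not vanish for
  all \<open>n\<close>.
\<close>
lemma zero_if_fourier_coefficients_zero:
  fixes D :: "real \<Rightarrow> complex"
  assumes cont: "continuous_on UNIV D"
    and coeff: "\<And>k::int. integral {0..1} (\<lambda>x. D x * cis (2 * pi * k * x)) = 0"
    and x0: "0 < x0" "x0 < 1"
  shows "D x0 = 0"
proof (rule ccontr)
  assume nz: "D x0 \<noteq> 0"
  \<comment> \<open>\<open>D\<close> is rotated so as to be positive at \<open>x0\<close>.\<close>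
  define E where "E x = Re (cnj (D x0) * D x)" for x
  have contE: "continuous_on UNIV E" unfolding E_def by (intro continuous_intros cont)
  have "E x0 = (norm (D x0))\<^sup>2"
    unfolding E_def cmod_power2 by (simp add: power2_eq_square)
  then have E0: "E x0 > 0" using nz by simp
  define c where "c = E x0 / 2"
  have c: "c > 0" "c < E x0" using E0 by (auto simp: c_def)
  obtain d0 where d0: "d0 > 0" "\<And>x. \<bar>x - x0\<bar> < d0 \<Longrightarrow> \<bar>E x - E x0\<bar> < E x0 - c"
    using contE c unfolding continuous_on_iff dist_real_def by (metis UNIV_I diff_gt_0_iff_gt)
  \<comment> \<open>For \<open>d\<close> at most \<open>x0\<close> and \<open>1 - x0\<close>, no point of the unit interval is within \<open>d\<close> of a translate of \<open>x0\<close> by \<open>\<plusminus>1\<close>.\<close>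
  define d where "d = Min {d0 / 2, x0, 1 - x0, 1 / 4}"
  have d: "0 < d" "d < d0" "d \<le> x0" "d \<le> 1 - x0" "d \<le> 1 / 4"
    using d0 x0 by (auto simp: d_def min_def)
  have near: "E x \<ge> c" if "\<bar>x - x0\<bar> \<le> d" for x
    using d0(2)[of x] that d by linarith
  define Q where "Q x = (1 - cos (2 * pi * d)) + cos (2 * pi * (x - x0))" for x
  have contQ: "continuous_on UNIV Q" unfolding Q_def by (intro continuous_intros)
  have int_zero: "integral {0..1} (\<lambda>x. E x * Q x ^ n) = 0" for n
  proof -
    have i: "(\<lambda>x. D x * of_real (Q x ^ n)) integrable_on {0..1}"
      by (intro integrable_on_interval_if_continuous continuous_intros cont contQ)
    have "integral {0..1} (\<lambda>x. D x * of_real (Q x ^ n)) = 0"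
      using trig_power_integral_zero[OF cont coeff, of "1 - cos (2 * pi * d)" x0 n 0]
      by (simp add: Q_def)
    then have "((\<lambda>x. D x * of_real (Q x ^ n)) has_integral 0) {0..1}"
      using i by (simp add: has_integral_iff)
    from has_integral_mult_right[OF this, of "cnj (D x0)"]
    have "((\<lambda>x. Re (cnj (D x0) * (D x * of_real (Q x ^ n)))) has_integral Re (cnj (D x0) * 0)) {0..1}"
      by (rule has_integral_Re)
    moreover have "Re (cnj (D x0) * (D x * of_real (Q x ^ n))) = E x * Q x ^ n" for x
      unfolding E_def mult.assoc[symmetric] by simp
    ultimately show ?thesis by (simp add: has_integral_iff)
  qed
  have "compact (E ` {0..1})"
    using contE by (intro compact_continuous_image) (auto intro: continuous_on_subset)
  then obtain M where M: "\<And>x. x \<in> {0..1} \<Longrightarrow> \<bar>E x\<bar> \<le> M" "M > 0"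
    using compact_imp_bounded[THEN bounded_pos[THEN iffD1]] by (force simp: real_norm_def)
  \<comment> \<open>The minimum of \<open>Q\<close> over the half-sized neighbourhood, which gives the exponential growth.\<close>
  define r where "r = (1 - cos (2 * pi * d)) + cos (2 * pi * (d / 2))"
  have "cos (2 * pi * d) < cos (2 * pi * (d / 2))"
    using d by (intro cos_monotone_0_pi) auto
  then have r: "r > 1" by (simp add: r_def)
  have ge: "E x * Q x ^ n \<ge> - M" if x: "x \<in> {0..1}" for x n
  proof (cases "\<bar>x - x0\<bar> \<le> d")
    case True
    then have "Q x \<ge> 1" using cos_ge_cos_near[of d "x - x0"] d by (simp add: Q_def)
    then have "E x * Q x ^ n \<ge> 0" using near[OF True] c by (intro mult_nonneg_nonneg zero_le_power) auto
    then show ?thesis using M by linarith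
  next
    case False
    then have "Q x \<le> 1" using cos_le_cos_away[of d "x - x0"] d x by (auto simp: Q_def)
    moreover have "Q x \<ge> -1" using cos_ge_minus_one[of "2 * pi * (x - x0)"] cos_le_one[of "2 * pi * d"]
      unfolding Q_def by linarith
    ultimately have "\<bar>Q x ^ n\<bar> \<le> 1" by (simp add: power_abs power_le_one)
    then have "\<bar>E x\<bar> * \<bar>Q x ^ n\<bar> \<le> M * 1" using M(1)[OF x] M(2) by (intro mult_mono) auto
    then show ?thesis by (simp add: abs_mult[symmetric] abs_le_iff)
  qed
  have big: "E x * Q x ^ n \<ge> c * r ^ n" if "x \<in> {x0 - d / 2..x0 + d / 2}" for x n
  proof -
    have x: "\<bar>x - x0\<bar> \<le> d / 2" using that unfolding atLeastAtMost_iff by linarith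
    then have "r \<le> Q x" using cos_ge_cos_near[of "d / 2" "x - x0"] d by (simp add: Q_def r_def)
    then show ?thesis using near[of x] x d r c by (intro mult_mono power_mono) auto
  qed
  have "d * (c * r ^ n) \<le> M" for n
  proof -
    have sub: "{x0 - d / 2..x0 + d / 2} \<subseteq> {0..1}" using d by auto
    have int: "(\<lambda>x. E x * Q x ^ n + M) integrable_on {a..b}" for a b
      by (intro integrable_on_interval_if_continuous continuous_intros contE contQ)
    have "d * (c * r ^ n) = integral {x0 - d / 2..x0 + d / 2} (\<lambda>x. c * r ^ n)"
      using d by simp
    also have "\<dots> \<le> integral {x0 - d / 2..x0 + d / 2} (\<lambda>x. E x * Q x ^ n + M)"
      using big M(2) by (intro integral_le int) (auto intro: order_trans[OF big])
    also have "\<dots> \<le> integral {0..1} (\<lambda>x. E x * Q x ^ n + M)"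
    proof -
      have nn: "0 \<le> E x * Q x ^ n + M" if "x \<in> {0..1}" for x using ge[OF that, of n] by linarith
      show ?thesis by (rule integral_subset_le[OF sub int int]) (use nn in blast)
    qed
    also have "\<dots> = integral {0..1} (\<lambda>x. E x * Q x ^ n) + integral {0..1::real} (\<lambda>x. M)"
      by (rule Henstock_Kurzweil_Integration.integral_add;
          intro integrable_on_interval_if_continuous continuous_intros contE contQ)
    also have "\<dots> = M" using int_zero by simp
    finally show ?thesis .
  qed
  moreover obtain n where "M / (d * c) < r ^ n" using real_arch_pow[OF r] by blast
  then have "M < d * (c * r ^ n)" using d c by (simp add: field_simps)
  ultimately show False by (meson not_le)
qed

lemma periodic_zero_if_fourier_coefficients_zero:
  fixes D :: "real \<Rightarrow> complex"
  assumes cont: "continuous_on UNIV D"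
    and coeff: "\<And>k::int. integral {0..1} (\<lambda>x. D x * cis (2 * pi * k * x)) = 0"
    and periodic: "\<And>x (n::int). D (x + n) = D x"
  shows "D x = 0"
proof -
  have inner: "D y = 0" if "0 < y" "y < 1" for y
    using zero_if_fourier_coefficients_zero[OF cont coeff that] .
  have "(\<lambda>n. D (1 / (real n + 2))) \<longlonglongrightarrow> D 0"
    by (rule continuous_on_tendsto_compose[OF cont]) (auto, real_asymp)
  moreover have "D (1 / (real n + 2)) = 0" for n by (intro inner) auto
  ultimately have "D 0 = 0" by (simp add: LIMSEQ_const_iff)
  moreover have "D x = D (frac x)"
    using periodic[of "frac x" "\<lfloor>x\<rfloor>"] by (simp add: frac_def)
  ultimately show ?thesis
    using inner[of "frac x"] frac_lt_1[of x] frac_ge_0[of x] by (cases "frac x = 0") auto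
qed


section \<open>The functional equation of the theta function\<close>

lemma integrable_int_weight: "integrable (count_space UNIV) (\<lambda>n::int. 1 / (1 + (real_of_int n)\<^sup>2))"
proof -
  let ?f = "\<lambda>n::int. 1 / (1 + (real_of_int n)\<^sup>2)"
  have "summable (\<lambda>n. inverse (real (Suc n) ^ 2))"
    using inverse_power_summable[of 2, where 'a = real] by (subst summable_Suc_iff) simp
  then have "summable (\<lambda>n. inverse ((real n + 1)\<^sup>2))" by (simp add: add.commute)
  then have sm: "summable (\<lambda>n. 2 * inverse ((real n + 1)\<^sup>2))" by (rule summable_mult)
  have "norm (1 / (1 + (real n)\<^sup>2)) \<le> 2 * inverse ((real n + 1)\<^sup>2)" for n
  proof -
    have "(real n - 1)\<^sup>2 \<ge> 0" by simp
    then have "(real n + 1)\<^sup>2 \<le> 2 * (1 + (real n)\<^sup>2)" by (simp add: power2_eq_square algebra_simps)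
    then show ?thesis by (simp add: divide_simps add_pos_nonneg)
  qed
  then have "summable (\<lambda>n. norm (1 / (1 + (real n)\<^sup>2)))"
    by (intro summable_norm_comparison_test[OF _ sm]) blast
  then have nat: "Infinite_Set_Sum.abs_summable_on (\<lambda>n::nat. 1 / (1 + (real n)\<^sup>2)) UNIV"
    by (simp add: Infinite_Set_Sum.abs_summable_on_nat_iff')
  have "Infinite_Set_Sum.abs_summable_on ?f (range int)" "Infinite_Set_Sum.abs_summable_on ?f (range (\<lambda>n. - int n))"
    by (rule Infinite_Set_Sum.abs_summable_on_reindex; use nat in simp)+
  then have "Infinite_Set_Sum.abs_summable_on ?f (range int \<union> range (\<lambda>n. - int n))"
    by (rule Infinite_Set_Sum.abs_summable_on_union)
  moreover have "n \<in> range int \<union> range (\<lambda>n. - int n)" for n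
    by (cases "n \<ge> 0") (auto intro: image_eqI[of _ _ "nat n"] image_eqI[of _ _ "nat (- n)"])
  then have "range int \<union> range (\<lambda>n. - int n) = UNIV" by blast
  ultimately show ?thesis by (simp add: Infinite_Set_Sum.abs_summable_on_def)
qed

lemma shifted_weight_le: "1 / (1 + (real_of_int n + x)\<^sup>2) \<le> 2 * (1 + x\<^sup>2) * (1 / (1 + (real_of_int n)\<^sup>2))"
proof -
  have le: "1 + (real_of_int n)\<^sup>2 \<le> 2 * (1 + (real_of_int n + x)\<^sup>2) * (1 + x\<^sup>2)"
    using weight_peetre[of "real_of_int n" "- x"] by simp
  have aux: "1 / a \<le> 2 * c * (1 / b)" if "b \<le> 2 * a * c" "a > 0" "b > 0" for a b c :: real
    using that by (simp add: field_simps)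
  show ?thesis by (rule aux[OF le]) (simp_all add: add_pos_nonneg)
qed

lemma integrable_shifted_int_weight: "integrable (count_space UNIV) (\<lambda>n::int. 1 / (1 + (real_of_int n + x)\<^sup>2))"
proof (rule Bochner_Integration.integrable_bound)
  show "integrable (count_space UNIV) (\<lambda>n::int. 2 * (1 + x\<^sup>2) * (1 / (1 + (real_of_int n)\<^sup>2)))"
    by (intro integrable_mult_right integrable_int_weight)
  show "AE n in count_space UNIV. norm (1 / (1 + (real_of_int n + x)\<^sup>2)) \<le> norm (2 * (1 + x\<^sup>2) * (1 / (1 + (real_of_int n)\<^sup>2)))"
    using shifted_weight_le[of _ x] by (intro AE_I2) (simp add: abs_mult)
qed simp

lemma gaussian_le_inverse_weight:
  assumes "t > 0"
  shows "\<exists>K\<ge>0. \<forall>p. exp (- pi * t * p\<^sup>2) \<le> K * (1 / (1 + p\<^sup>2))"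
proof (intro exI conjI allI)
  let ?K = "24 * exp (pi * t) / (pi * t) ^ 4"
  show "?K \<ge> 0" using assms by simp
  fix p :: real
  have "?K / (1 + p\<^sup>2) ^ 4 \<le> ?K / (1 + p\<^sup>2) ^ 1"
    using assms by (intro divide_left_mono power_increasing) (auto intro!: mult_pos_pos zero_less_power add_pos_nonneg)
  then show "exp (- pi * t * p\<^sup>2) \<le> ?K * (1 / (1 + p\<^sup>2))"
    using gaussian_le_weight[OF assms, of p] by simp
qed

lemma continuous_on_integral_count_space:
  fixes F :: "'i \<Rightarrow> real \<Rightarrow> complex"
  assumes cont: "\<And>i. continuous_on UNIV (F i)"
    and bound: "\<And>R. \<exists>w. integrable (count_space UNIV) w \<and> (\<forall>i x. \<bar>x\<bar> \<le> R \<longrightarrow> norm (F i x) \<le> w i)"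
  shows "continuous_on UNIV (\<lambda>x. \<integral>i. F i x \<partial>count_space UNIV)"
  unfolding continuous_on_sequentially
proof safe
  fix u :: "nat \<Rightarrow> real" and a assume u: "u \<longlonglongrightarrow> a"
  then obtain R where R: "\<And>n. \<bar>u n\<bar> \<le> R"
    using convergent_imp_Bseq[OF convergentI[OF u]] unfolding Bseq_def by auto
  obtain w where w: "integrable (count_space UNIV) w" "\<And>i x. \<bar>x\<bar> \<le> R \<Longrightarrow> norm (F i x) \<le> w i"
    using bound by blast
  show "((\<lambda>x. \<integral>i. F i x \<partial>count_space UNIV) \<circ> u) \<longlonglongrightarrow> (\<integral>i. F i a \<partial>count_space UNIV)"
    unfolding o_def
  proof (rule integral_dominated_convergence[where w = w])
    show "AE i in count_space UNIV. (\<lambda>n. F i (u n)) \<longlonglongrightarrow> F i a"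
      using u by (intro AE_I2 continuous_on_tendsto_compose[OF cont]) auto
  qed (use w R in auto)
qed

lemma integral_unit_eq_lborel:
  fixes f :: "real \<Rightarrow> complex"
  assumes "continuous_on UNIV f"
  shows "integral {0..1} f = (\<integral>x. indicator {0..<1} x *\<^sub>R f x \<partial>lborel)"
proof -
  have "set_integrable lborel {0..1} f"
    using assms by (intro borel_integrable_atLeastAtMost') (rule continuous_on_subset, auto)
  then have "integral {0..1} f = (\<integral>x. indicator {0..1} x *\<^sub>R f x \<partial>lborel)"
    using set_borel_integral_eq_integral(2)[of "{0..1}" f] by (simp add: set_lebesgue_integral_def)
  also have "\<dots> = (\<integral>x. indicator {0..<1} x *\<^sub>R f x \<partial>lborel)"
  proof (rule integral_cong_AE)
    have [measurable]: "f \<in> borel_measurable borel" using assms by (rule borel_measurable_continuous_onI)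
    show "(\<lambda>x. indicat_real {0..1} x *\<^sub>R f x) \<in> borel_measurable lborel" "(\<lambda>x. indicat_real {0..<1} x *\<^sub>R f x) \<in> borel_measurable lborel"
      by measurable
    have "AE x in lborel. x \<noteq> (1::real)" by (rule AE_lborel_singleton)
    then show "AE x in lborel. indicat_real {0..1} x *\<^sub>R f x = indicat_real {0..<1} x *\<^sub>R f x"
      by eventually_elim (auto simp: indicator_def)
  qed
  finally show ?thesis .
qed

lemma integral_unit_cis: "integral {0..1} (\<lambda>x. cis (2 * pi * of_int k * x)) = (if k = 0 then 1 else 0)"
proof (cases "k = 0")
  case False
  define c where "c = 2 * of_real pi * \<i> * complex_of_int k"
  have c: "c \<noteq> 0" using False by (simp add: c_def)
  have e: "cis (2 * pi * of_int k * x) = exp (c * of_real x)" for x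
    by (simp add: c_def cis_conv_exp algebra_simps)
  have "((\<lambda>x. exp (c * of_real x)) has_integral exp (c * of_real 1) / c - exp (c * of_real 0) / c) {0..1}"
  proof (rule fundamental_theorem_of_calculus)
    fix x :: real
    have "((\<lambda>x. exp (c * of_real x) / c) has_vector_derivative c * exp (c * of_real x) / c) (at x within {0..1})"
      using c by (auto intro!: derivative_eq_intros has_vector_derivative_real_field)
    then show "((\<lambda>x. exp (c * of_real x) / c) has_vector_derivative exp (c * of_real x)) (at x within {0..1})"
      using c by simp
  qed auto
  moreover have "exp (c * of_real 1) = 1"
    using cis_multiple_2pi[of "of_int k"] e[of 1, symmetric] by simp
  ultimately show ?thesis using False unfolding e by (simp add: has_integral_iff)
qed (simp add: cis_zero)

lemma integral_count_space_single:
  fixes z :: complex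
  shows "(\<integral>k. (if k = c then z else 0) \<partial>count_space UNIV) = z"
proof (cases "z = 0")
  case False
  then have "{k \<in> UNIV. (if k = c then z else 0) \<noteq> 0} = {c}" by auto
  then show ?thesis
    using lebesgue_integral_count_space_finite_support[of UNIV "\<lambda>k. if k = c then z else 0"] by simp
next
  case True
  then show ?thesis by (simp cong: if_cong)
qed

text \<open>
  The line is cut into unit intervals. The decay of \<open>G\<close> lets the sum over the intervals be exchanged with
  the integral over one of them.
\<close>
lemma integral_R_eq_sum_units:
  fixes G :: "real \<Rightarrow> complex"
  assumes cont: "continuous_on UNIV G" and decay: "\<And>y. norm (G y) \<le> K * (1 / (1 + y\<^sup>2))"
  shows "(\<integral>n. (\<integral>x. indicator {0..<1} x *\<^sub>R G (real_of_int n + x) \<partial>lborel) \<partial>count_space UNIV) = (\<integral>y. G y \<partial>lborel)"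
    and "integrable (count_space UNIV) (\<lambda>n::int. \<integral>x. norm (indicator {0..<1} x *\<^sub>R G (real_of_int n + x)) \<partial>lborel)"
    and "integrable lborel (\<lambda>x. indicator {0..<1} x *\<^sub>R G (real_of_int n + x))"
proof -
  have [measurable]: "G \<in> borel_measurable borel" using cont by (rule borel_measurable_continuous_onI)
  have K: "K \<ge> 0" using order_trans[OF norm_ge_zero decay[of 0]] by simp
  let ?F = "\<lambda>n x. indicator {0..<1} x *\<^sub>R G (real_of_int n + x)"
  show intF: "integrable lborel (?F n)" for n
  proof -
    have "integrable lborel (\<lambda>x. indicator {0..1} x *\<^sub>R G (real_of_int n + x))"
      by (intro borel_integrable_compact continuous_on_compose2[OF cont] continuous_intros) auto
    then show ?thesis
      by (rule Bochner_Integration.integrable_bound) (auto intro!: AE_I2 simp: indicator_def)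
  qed
  have le: "norm (?F n x) \<le> 4 * K * (1 / (1 + (real_of_int n)\<^sup>2)) * indicator {0..<1} x" for n x
  proof (cases "x \<in> {0..<1}")
    case True
    then have "x\<^sup>2 \<le> 1" by (simp add: power_le_one)
    then have "2 * (1 + x\<^sup>2) * (1 / (1 + (real_of_int n)\<^sup>2)) \<le> 4 * (1 / (1 + (real_of_int n)\<^sup>2))"
      by (intro mult_right_mono) auto
    then have "1 / (1 + (real_of_int n + x)\<^sup>2) \<le> 4 * (1 / (1 + (real_of_int n)\<^sup>2))"
      using shifted_weight_le[of n x] by linarith
    from order_trans[OF decay mult_left_mono[OF this K]] True show ?thesis by (simp add: mult.commute)
  qed simp
  show sumF: "integrable (count_space UNIV) (\<lambda>n::int. \<integral>x. norm (?F n x) \<partial>lborel)"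
  proof (rule Bochner_Integration.integrable_bound)
    show "integrable (count_space UNIV) (\<lambda>n::int. 4 * K * (1 / (1 + (real_of_int n)\<^sup>2)))"
      by (intro integrable_mult_right integrable_int_weight)
    show "AE n in count_space UNIV. norm (\<integral>x. norm (?F n x) \<partial>lborel) \<le> norm (4 * K * (1 / (1 + (real_of_int n)\<^sup>2)))"
    proof (rule AE_I2)
      fix n :: int
      have "(\<integral>x. norm (?F n x) \<partial>lborel) \<le> (\<integral>x. 4 * K * (1 / (1 + (real_of_int n)\<^sup>2)) * indicator {0..<1::real} x \<partial>lborel)"
      proof (rule Bochner_Integration.integral_mono)
        show "integrable lborel (\<lambda>x. norm (?F n x))" by (intro integrable_norm intF)
        show "integrable lborel (\<lambda>x. 4 * K * (1 / (1 + (real_of_int n)\<^sup>2)) * indicat_real {0..<1::real} x)"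
          by (intro integrable_mult_right) simp
      qed (rule le)
      also have "\<dots> = 4 * K * (1 / (1 + (real_of_int n)\<^sup>2))" by simp
      finally show "norm (\<integral>x. norm (?F n x) \<partial>lborel) \<le> norm (4 * K * (1 / (1 + (real_of_int n)\<^sup>2)))"
        using K by (simp add: integral_nonneg_AE)
    qed
  qed simp
  let ?I = "\<lambda>n y. indicator {real_of_int n..<real_of_int n + 1} y *\<^sub>R G y"
  have shift: "integrable lborel f \<longleftrightarrow> integrable lborel (\<lambda>x. f (real_of_int n + x))"
    "(\<integral>y. f y \<partial>lborel) = (\<integral>x. f (real_of_int n + x) \<partial>lborel)"
    for f :: "real \<Rightarrow> 'b::{banach, second_countable_topology}" and n
    using lborel_integrable_real_affine_iff[of 1 f "real_of_int n"] lborel_integral_real_affine[of 1 f "real_of_int n"]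
    by simp_all
  have ind: "indicator {real_of_int n..<real_of_int n + 1} (real_of_int n + x) = (indicator {0..<1} x :: real)" for n x
    by (simp add: indicator_def)
  have intI: "integrable lborel (?I n)" for n
    by (subst shift(1)[of _ n]) (simp only: ind intF)
  have eqI: "(\<integral>y. ?I n y \<partial>lborel) = (\<integral>x. ?F n x \<partial>lborel)" "(\<integral>y. norm (?I n y) \<partial>lborel) = (\<integral>x. norm (?F n x) \<partial>lborel)" for n
    by (subst shift(2)[of _ n], simp only: ind)+
  have "(\<integral>n. (\<integral>x. ?F n x \<partial>lborel) \<partial>count_space UNIV) = (\<integral>y. (\<integral>n. ?I n y \<partial>count_space UNIV) \<partial>lborel)"
    unfolding eqI(1)[symmetric] using sumF by (intro Fubini_count_space_lborel intI) (simp only: eqI(2))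
  also have "\<dots> = (\<integral>y. G y \<partial>lborel)"
  proof (rule Bochner_Integration.integral_cong[OF refl])
    fix y
    have eq: "y \<in> {real_of_int n..<real_of_int n + 1} \<longleftrightarrow> n = \<lfloor>y\<rfloor>" for n by (auto simp: floor_unique)
    have "(\<integral>n. ?I n y \<partial>count_space UNIV) = (\<integral>n. (if n = \<lfloor>y\<rfloor> then G y else 0) \<partial>count_space UNIV)"
      by (intro Bochner_Integration.integral_cong refl) (simp add: indicator_def eq del: atLeastLessThan_iff)
    then show "(\<integral>n. ?I n y \<partial>count_space UNIV) = G y"
      by (simp only: integral_count_space_single)
  qed
  finally show "(\<integral>n. (\<integral>x. ?F n x \<partial>lborel) \<partial>count_space UNIV) = (\<integral>y. G y \<partial>lborel)" .
qed

text \<open>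
  Both sides are continuous functions of \<open>x\<close> with period \<open>1\<close>. The \<open>m\<close>-th Fourier coefficient of the left-hand side
  unfolds to the Fourier transform of a Gaussian at \<open>m\<close>, which is the coefficient that the right-hand
  side shows.
\<close>
lemma theta_functional_equation:
  assumes t: "t > 0"
  shows "(\<integral>n. of_real (exp (- pi * t * (real_of_int n + x)\<^sup>2)) \<partial>count_space (UNIV :: int set)) =
    of_real (1 / sqrt t) * (\<integral>k. of_real (exp (- pi * (real_of_int k)\<^sup>2 / t)) * cis (2 * pi * real_of_int k * x) \<partial>count_space UNIV)"
proof -
  let ?g = "\<lambda>(n::int) x. complex_of_real (exp (- pi * t * (real_of_int n + x)\<^sup>2))"
  define a where "a k = complex_of_real (1 / sqrt t * exp (- pi * (1 / t) * (real_of_int k)\<^sup>2))" for k :: int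
  let ?h = "\<lambda>k x. a k * cis (2 * pi * real_of_int k * x)"
  define F where "F x = (\<integral>n. ?g n x \<partial>count_space UNIV)" for x
  define H where "H x = (\<integral>k. ?h k x \<partial>count_space UNIV)" for x
  obtain K where K: "K \<ge> 0" "\<And>p. exp (- pi * t * p\<^sup>2) \<le> K * (1 / (1 + p\<^sup>2))"
    using gaussian_le_inverse_weight[OF t] by blast
  obtain L where L: "L \<ge> 0" "\<And>p. exp (- pi * (1 / t) * p\<^sup>2) \<le> L * (1 / (1 + p\<^sup>2))"
    using gaussian_le_inverse_weight[of "1 / t"] t by auto
  have a_le: "norm (a k) \<le> 1 / sqrt t * (L * (1 / (1 + (real_of_int k)\<^sup>2)))" for k
  proof -
    have "norm (a k) = 1 / sqrt t * exp (- pi * (1 / t) * (real_of_int k)\<^sup>2)"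
      unfolding a_def norm_of_real using t by (intro abs_of_nonneg) simp
    then show ?thesis using mult_left_mono[OF L(2)[of "real_of_int k"], of "1 / sqrt t"] t by simp
  qed
  have int_a: "integrable (count_space UNIV) (\<lambda>k. norm (a k))"
    by (rule Bochner_Integration.integrable_bound[of _ "\<lambda>k. 1 / sqrt t * (L * (1 / (1 + (real_of_int k)\<^sup>2)))"])
       (intro integrable_mult_right integrable_int_weight, simp,
        rule AE_I2, simp only: real_norm_def abs_norm_cancel, rule order_trans[OF a_le abs_ge_self])
  have contF: "continuous_on UNIV F"
    unfolding F_def
  proof (rule continuous_on_integral_count_space)
    fix R :: real
    show "\<exists>w. integrable (count_space UNIV) w \<and> (\<forall>i x. \<bar>x\<bar> \<le> R \<longrightarrow> norm (?g i x) \<le> w i)"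
    proof (intro exI conjI allI impI)
      show "integrable (count_space UNIV) (\<lambda>n::int. K * (2 * (1 + R\<^sup>2) * (1 / (1 + (real_of_int n)\<^sup>2))))"
        by (intro integrable_mult_right integrable_int_weight)
      fix n :: int and x :: real assume x: "\<bar>x\<bar> \<le> R"
      have "x\<^sup>2 \<le> R\<^sup>2" using x by (meson abs_le_square_iff abs_ge_self order_trans)
      then have "2 * (1 + x\<^sup>2) * (1 / (1 + (real_of_int n)\<^sup>2)) \<le> 2 * (1 + R\<^sup>2) * (1 / (1 + (real_of_int n)\<^sup>2))"
        by (intro mult_right_mono) auto
      with shifted_weight_le[of n x] have "1 / (1 + (real_of_int n + x)\<^sup>2) \<le> 2 * (1 + R\<^sup>2) * (1 / (1 + (real_of_int n)\<^sup>2))"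
        by linarith
      from order_trans[OF K(2) mult_left_mono[OF this K(1)]]
      show "norm (?g n x) \<le> K * (2 * (1 + R\<^sup>2) * (1 / (1 + (real_of_int n)\<^sup>2)))" by simp
    qed
  qed (intro continuous_intros)
  have contH: "continuous_on UNIV H"
    unfolding H_def
  proof (rule continuous_on_integral_count_space)
    show "\<exists>w. integrable (count_space UNIV) w \<and> (\<forall>i x. \<bar>x\<bar> \<le> R \<longrightarrow> norm (?h i x) \<le> w i)" for R
      by (intro exI[of _ "\<lambda>k. norm (a k)"] conjI int_a)
         (simp only: norm_mult norm_cis mult_1_right order_refl simp_thms)
  qed (intro continuous_intros)
  have coeffF: "integral {0..1} (\<lambda>x. F x * cis (2 * pi * real_of_int m * x)) = a m" for m
  proof -
    define G where "G y = complex_of_real (exp (- pi * t * y\<^sup>2)) * cis (2 * pi * real_of_int m * y)" for y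
    have contG: "continuous_on UNIV G" unfolding G_def by (intro continuous_intros)
    have decayG: "norm (G y) \<le> K * (1 / (1 + y\<^sup>2))" for y using K(2)[of y] by (simp add: G_def norm_mult)
    have gG: "?g n x * cis (2 * pi * real_of_int m * x) = G (real_of_int n + x)" for n x
    proof -
      have "cis (2 * pi * real_of_int m * (real_of_int n + x)) = cis (2 * pi * real_of_int (m * n)) * cis (2 * pi * real_of_int m * x)"
        unfolding cis_mult by (simp add: algebra_simps)
      also have "cis (2 * pi * real_of_int (m * n)) = 1" by (rule cis_multiple_2pi) simp
      finally show ?thesis by (simp add: G_def)
    qed
    have "integral {0..1} (\<lambda>x. F x * cis (2 * pi * real_of_int m * x)) =
      (\<integral>x. indicator {0..<1} x *\<^sub>R (F x * cis (2 * pi * real_of_int m * x)) \<partial>lborel)"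
      by (intro integral_unit_eq_lborel continuous_intros contF)
    also have "\<dots> = (\<integral>x. (\<integral>n. indicator {0..<1} x *\<^sub>R G (real_of_int n + x) \<partial>count_space UNIV) \<partial>lborel)"
      unfolding F_def integral_mult_left_zero[symmetric] gG integral_scaleR_right ..
    also have "\<dots> = (\<integral>y. G y \<partial>lborel)"
      using integral_R_eq_sum_units[OF contG decayG]
      by (subst Fubini_count_space_lborel[symmetric]) auto
    also have "\<dots> = fourier (\<lambda>x. of_real (exp (- pi * t * (x - 0)\<^sup>2))) (- real_of_int m)"
      unfolding fourier_cis G_def by simp
    also have "\<dots> = a m"
      unfolding fourier_gaussian[OF t] a_def by (simp add: field_simps)
    finally show ?thesis .
  qed
  have coeffH: "integral {0..1} (\<lambda>x. H x * cis (2 * pi * real_of_int m * x)) = a m" for m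
  proof -
    let ?E = "\<lambda>k x. indicator {0..<1} x *\<^sub>R (a k * cis (2 * pi * real_of_int (k + m) * x))"
    have hE: "indicator {0..<1} x *\<^sub>R (?h k x * cis (2 * pi * real_of_int m * x)) = ?E k x" for k x
    proof -
      have "cis (2 * pi * real_of_int k * x) * cis (2 * pi * real_of_int m * x) = cis (2 * pi * real_of_int (k + m) * x)"
        unfolding cis_mult by (simp add: algebra_simps)
      then show ?thesis by (simp only: mult.assoc)
    qed
    have nE: "norm (?E k x) = norm (a k) * indicator {0..<1} x" for k x
      by (simp add: norm_mult)
    have intE: "integrable lborel (?E k)" for k
    proof -
      have "integrable lborel (\<lambda>x. norm (a k) * indicat_real {0..<1::real} x)" by (intro integrable_mult_right) simp
      then show ?thesis by (rule Bochner_Integration.integrable_bound) (auto intro!: AE_I2 simp: norm_mult)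
    qed
    have inner: "(\<integral>x. ?E k x \<partial>lborel) = (if k = - m then a m else 0)" for k
    proof -
      have "(\<integral>x. ?E k x \<partial>lborel) = integral {0..1} (\<lambda>x. a k * cis (2 * pi * real_of_int (k + m) * x))"
        by (intro integral_unit_eq_lborel[symmetric] continuous_intros)
      also have "\<dots> = a k * (if k + m = 0 then 1 else 0)"
        by (simp only: integral_mult_right integral_unit_cis)
      also have "\<dots> = (if k = - m then a m else 0)" by (auto simp: a_def)
      finally show ?thesis .
    qed
    have "integral {0..1} (\<lambda>x. H x * cis (2 * pi * real_of_int m * x)) =
      (\<integral>x. indicator {0..<1} x *\<^sub>R (H x * cis (2 * pi * real_of_int m * x)) \<partial>lborel)"
      by (intro integral_unit_eq_lborel continuous_intros contH)
    also have "\<dots> = (\<integral>x. (\<integral>k. ?E k x \<partial>count_space UNIV) \<partial>lborel)"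
      unfolding H_def integral_mult_left_zero[symmetric] integral_scaleR_right[symmetric] hE ..
    also have "\<dots> = (\<integral>k. (\<integral>x. ?E k x \<partial>lborel) \<partial>count_space UNIV)"
    proof (rule Fubini_count_space_lborel[symmetric, OF intE])
      show "integrable (count_space UNIV) (\<lambda>k. \<integral>x. norm (?E k x) \<partial>lborel)"
        unfolding nE using int_a by simp
    qed
    also have "\<dots> = a m" by (simp only: inner integral_count_space_single)
    finally show ?thesis .
  qed
  have "F x - H x = 0"
  proof (rule periodic_zero_if_fourier_coefficients_zero[of "\<lambda>x. F x - H x"])
    show "continuous_on UNIV (\<lambda>x. F x - H x)" by (intro continuous_intros contF contH)
    fix m :: int
    have "integral {0..1} (\<lambda>x. (F x - H x) * cis (2 * pi * real_of_int m * x)) =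
      integral {0..1} (\<lambda>x. F x * cis (2 * pi * real_of_int m * x)) - integral {0..1} (\<lambda>x. H x * cis (2 * pi * real_of_int m * x))"
      unfolding left_diff_distrib
      by (intro Henstock_Kurzweil_Integration.integral_diff integrable_on_interval_if_continuous continuous_intros contF contH)
    then show "integral {0..1} (\<lambda>x. (F x - H x) * cis (2 * pi * real_of_int m * x)) = 0"
      by (simp only: coeffF coeffH diff_self)
  next
    fix x and m :: int
    have "F (x + real_of_int m) = F x"
    proof -
      have "bij_betw (\<lambda>n::int. n + m) UNIV UNIV" by (rule bij_betw_byWitness[where f' = "\<lambda>n. n - m"]) auto
      from integral_bij_count_space[OF this, of "\<lambda>n. ?g n x"]
      show ?thesis unfolding F_def by (simp add: add_ac)
    qed
    moreover have "H (x + real_of_int m) = H x"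
    proof -
      have "cis (2 * pi * real_of_int k * (x + real_of_int m)) = cis (2 * pi * real_of_int k * x)" for k
      proof -
        have "cis (2 * pi * real_of_int k * (x + real_of_int m)) = cis (2 * pi * real_of_int (k * m)) * cis (2 * pi * real_of_int k * x)"
          unfolding cis_mult by (simp add: algebra_simps)
        also have "cis (2 * pi * real_of_int (k * m)) = 1" by (rule cis_multiple_2pi) simp
        finally show ?thesis by simp
      qed
      then show ?thesis by (simp only: H_def)
    qed
    ultimately show "F (x + real_of_int m) - H (x + real_of_int m) = F x - H x" by simp
  qed
  then have "F x = H x" by simp
  also have "H x = of_real (1 / sqrt t) * (\<integral>k. of_real (exp (- pi * (real_of_int k)\<^sup>2 / t)) * cis (2 * pi * real_of_int k * x) \<partial>count_space UNIV)"
    unfolding H_def a_def integral_mult_right_zero[symmetric] by (simp add: mult_ac)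
  finally show ?thesis unfolding F_def .
qed


section \<open>Locally finite point measures\<close>

definition point_functional :: "('i \<Rightarrow> complex) \<Rightarrow> ('i \<Rightarrow> real) \<Rightarrow> (real \<Rightarrow> complex) \<Rightarrow> complex" where
  "point_functional w x f = (\<integral>i. w i * f (x i) \<partial>count_space UNIV)"

text \<open>
  Several indices may share a point; their weights add up, and may cancel.
\<close>
definition atom :: "('i \<Rightarrow> complex) \<Rightarrow> ('i \<Rightarrow> real) \<Rightarrow> real \<Rightarrow> complex" where
  "atom w x y = (\<Sum>i | x i = y. w i)"

definition atoms :: "('i \<Rightarrow> complex) \<Rightarrow> ('i \<Rightarrow> real) \<Rightarrow> real set" where
  "atoms w x = {y. atom w x y \<noteq> 0}"

definition point_measure_of :: "('i \<Rightarrow> complex) \<Rightarrow> ('i \<Rightarrow> real) \<Rightarrow> real set \<Rightarrow> complex" where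
  "point_measure_of w x B = (\<Sum>y\<in>atoms w x \<inter> B. atom w x y)"

lemma integrable_count_space_finite_support:
  fixes f :: "'a \<Rightarrow> complex"
  assumes "finite {a \<in> A. f a \<noteq> 0}"
  shows "integrable (count_space A) f"
proof -
  have "Infinite_Set_Sum.abs_summable_on f A \<longleftrightarrow> Infinite_Set_Sum.abs_summable_on f {a \<in> A. f a \<noteq> 0}"
    by (rule Infinite_Set_Sum.abs_summable_on_cong_neutral) auto
  then show ?thesis using assms by (simp add: Infinite_Set_Sum.abs_summable_on_def integrable_count_space)
qed

locale locally_finite_family =
  fixes w :: "'i \<Rightarrow> complex" and x :: "'i \<Rightarrow> real"
  assumes finite_index: "finite {i. \<bar>x i\<bar> \<le> R}"
begin

lemma atoms_subset: "atoms w x \<subseteq> range x"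
proof
  fix y assume "y \<in> atoms w x"
  then have "{i. x i = y} \<noteq> {}" unfolding atoms_def atom_def by (metis (mono_tags, lifting) mem_Collect_eq sum.empty)
  then show "y \<in> range x" by auto
qed

lemma finite_atoms:
  assumes "bounded B"
  shows "finite (atoms w x \<inter> B)"
proof -
  obtain R where "\<And>y. y \<in> B \<Longrightarrow> \<bar>y\<bar> \<le> R" using assms by (auto simp: bounded_iff)
  then have "atoms w x \<inter> B \<subseteq> x ` {i. \<bar>x i\<bar> \<le> R}" using atoms_subset by fastforce
  then show ?thesis using finite_index finite_surj by blast
qed

lemma discrete_closed_atoms: "discrete_closed (atoms w x)"
  unfolding discrete_closed_def by (auto intro!: finite_atoms)

lemma point_measure_of_singleton: "point_measure_of w x {y} = atom w x y"
  by (cases "y \<in> atoms w x") (auto simp: point_measure_of_def atoms_def)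

lemma pure_point_on_point_measure_of: "pure_point_on (point_measure_of w x) (atoms w x)"
  unfolding pure_point_on_def point_measure_of_singleton
proof safe
  fix B assume "B \<in> bounded_borel"
  then have "finite (atoms w x \<inter> B)" by (intro finite_atoms) (simp add: bounded_borel_def)
  from has_sum_finite[OF this, of "atom w x"]
  show "(atom w x has_sum point_measure_of w x B) (atoms w x \<inter> B)"
    unfolding point_measure_of_def .
qed (simp add: atoms_def)

text \<open>
  A bounded set contains finitely many atoms, each of which lies in exactly one member of a partition.
\<close>
lemma complex_measure_point_measure_of: "complex_measure (point_measure_of w x)"
  unfolding complex_measure_def
proof safe
  fix A :: "nat \<Rightarrow> real set"
  assume A: "disjoint_family A" "bounded (\<Union>i. A i)"
  let ?L = "atoms w x \<inter> (\<Union>i. A i)"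
  have fin: "finite ?L" using A(2) by (rule finite_atoms)
  have "(\<lambda>i. if y \<in> A i then atom w x y else 0) sums atom w x y" if y: "y \<in> ?L" for y
  proof -
    obtain n where n: "y \<in> A n" using y by auto
    have "(y \<in> A i) = (i = n)" for i using A(1) n by (auto simp: disjoint_family_on_def)
    then show ?thesis using sums_single[of n "\<lambda>_. atom w x y"] by simp
  qed
  then have "(\<lambda>i. \<Sum>y\<in>?L. if y \<in> A i then atom w x y else 0) sums (\<Sum>y\<in>?L. atom w x y)"
    by (intro sums_sum)
  moreover have "(\<Sum>y\<in>?L. if y \<in> A i then atom w x y else 0) = point_measure_of w x (A i)" for i
    unfolding point_measure_of_def using fin
    by (subst sum.inter_restrict[symmetric]) (auto intro!: sum.cong)
  ultimately show "(\<lambda>i. point_measure_of w x (A i)) sums point_measure_of w x (\<Union>i. A i)"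
    by (simp add: point_measure_of_def)
qed

lemma countable_atoms: "countable (atoms w x)"
proof -
  have eq: "atoms w x = (\<Union>n::nat. atoms w x \<inter> {- real n..real n})"
  proof safe
    fix y assume "y \<in> atoms w x"
    moreover obtain n :: nat where "\<bar>y\<bar> \<le> real n" using real_arch_simple by blast
    ultimately show "y \<in> (\<Union>n::nat. atoms w x \<inter> {- real n..real n})" by (auto intro!: exI[of _ n])
  qed
  have "countable (atoms w x \<inter> {- real n..real n})" for n
    by (intro countable_finite finite_atoms) auto
  then show ?thesis by (subst eq) (rule countable_UN, auto)
qed

lemma measurable_atom [measurable]: "atom w x \<in> borel_measurable borel"
  by (rule measurable_discrete_difference[OF _ countable_atoms, where f = "\<lambda>_. 0"])
     (auto simp: atoms_def)

text \<open>
  The positive measure is the counting measure of the atoms, the density their weight.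
\<close>
lemma has_complex_density_point_measure_of:
  "has_complex_density (point_measure_of w x) (distr (count_space (atoms w x)) borel (\<lambda>y. y)) (atom w x)"
  unfolding has_complex_density_def
proof (intro conjI ballI)
  fix B assume B: "B \<in> bounded_borel"
  then have [measurable]: "B \<in> sets borel" by (simp add: bounded_borel_def)
  let ?f = "\<lambda>y. indicator B y *\<^sub>R atom w x y"
  have fin: "finite (atoms w x \<inter> B)" using B by (intro finite_atoms) (simp add: bounded_borel_def)
  have supp: "{y \<in> atoms w x. ?f y \<noteq> 0} = atoms w x \<inter> B"
    by (auto simp: atoms_def indicator_def split: if_splits)
  have int: "integrable (count_space (atoms w x)) ?f"
    by (rule integrable_count_space_finite_support) (simp only: supp fin)
  then show "set_integrable (distr (count_space (atoms w x)) borel (\<lambda>y. y)) B (atom w x)"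
    unfolding set_integrable_def by (subst integrable_distr_eq) auto
  have "(\<integral>y. ?f y \<partial>count_space (atoms w x)) = (\<Sum>y\<in>atoms w x \<inter> B. ?f y)"
    using lebesgue_integral_count_space_finite_support[of "atoms w x" ?f] fin unfolding supp[symmetric] by simp
  also have "\<dots> = point_measure_of w x B"
    unfolding point_measure_of_def by (intro sum.cong) auto
  finally show "point_measure_of w x B = (LINT y:B|distr (count_space (atoms w x)) borel (\<lambda>y. y). atom w x y)"
    unfolding set_lebesgue_integral_def by (subst integral_distr) auto
qed simp

lemma has_measure_integral_point_functional:
  assumes f: "f \<in> borel_measurable borel" and bdd: "bounded {y. f y \<noteq> 0}"
  shows "has_measure_integral (point_measure_of w x) f (point_functional w x f)"
proof -
  let ?N = "distr (count_space (atoms w x)) borel (\<lambda>y. y)"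
  obtain R where R: "\<And>y. f y \<noteq> 0 \<Longrightarrow> \<bar>y\<bar> \<le> R" using bdd by (auto simp: bounded_iff)
  define I where "I = {i. \<bar>x i\<bar> \<le> R}"
  have fin: "finite I" unfolding I_def by (rule finite_index)
  have "point_functional w x f = (\<Sum>i\<in>I. w i * f (x i))"
    unfolding point_functional_def using R fin
    by (subst lebesgue_integral_count_space_finite_support)
       (auto simp: I_def intro!: sum.mono_neutral_left elim!: rev_finite_subset)
  also have "\<dots> = (\<Sum>y\<in>x ` I. \<Sum>i | i \<in> I \<and> x i = y. w i * f (x i))"
    using fin by (rule sum.image_gen)
  also have "\<dots> = (\<Sum>y\<in>x ` I. f y * atom w x y)"
  proof (rule sum.cong[OF refl])
    fix y assume "y \<in> x ` I"
    then have "{i. i \<in> I \<and> x i = y} = {i. x i = y}" by (auto simp: I_def)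
    then show "(\<Sum>i | i \<in> I \<and> x i = y. w i * f (x i)) = f y * atom w x y"
      by (simp add: atom_def sum_distrib_left mult.commute)
  qed
  also have "\<dots> = (\<Sum>y | y \<in> atoms w x \<and> f y * atom w x y \<noteq> 0. f y * atom w x y)"
  proof (rule sum.mono_neutral_right)
    show "{y \<in> atoms w x. f y * atom w x y \<noteq> 0} \<subseteq> x ` I"
      using atoms_subset R by (fastforce simp: I_def)
  qed (use fin in \<open>auto simp: atoms_def\<close>)
  also have "\<dots> = (\<integral>y. f y * atom w x y \<partial>count_space (atoms w x))"
  proof (rule lebesgue_integral_count_space_finite_support[symmetric])
    have "{y \<in> atoms w x. f y * atom w x y \<noteq> 0} \<subseteq> atoms w x \<inter> {y. f y \<noteq> 0}" by auto
    then show "finite {y \<in> atoms w x. f y * atom w x y \<noteq> 0}"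
      using finite_atoms[OF bdd] finite_subset by blast
  qed
  also have "\<dots> = (LINT y|?N. f y * atom w x y)"
    using f by (subst integral_distr) auto
  finally show ?thesis
    unfolding has_measure_integral_def using has_complex_density_point_measure_of by blast
qed

end


section \<open>Schwartz functions and temperate point measures\<close>

lemma nth_deriv_0 [simp]: "nth_deriv 0 f = f"
  by (simp add: nth_deriv_def)

lemma nth_deriv_has_vector_derivative:
  assumes "smooth f"
  shows "(nth_deriv n f has_vector_derivative nth_deriv (Suc n) f x) (at x)"
  using assms unfolding smooth_def by (simp add: nth_deriv_def vector_derivative_works)

lemma continuous_on_nth_deriv:
  assumes "smooth f"
  shows "continuous_on A (nth_deriv n f)"
  using nth_deriv_has_vector_derivative[OF assms]
  by (intro continuous_at_imp_continuous_on ballI has_vector_derivative_continuous)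

text \<open>
  All derivatives vanish off the support, and are continuous on this compact set.
\<close>
lemma test_functions_subset_schwartz: "test_functions \<subseteq> schwartz"
proof
  fix f assume "f \<in> test_functions"
  then have sm: "smooth f" and comp: "compact (closure {x. f x \<noteq> 0})" (is "compact ?K")
    by (auto simp: test_functions_def)
  have zero: "nth_deriv n f x = 0" if "x \<notin> ?K" for n x
    using that
  proof (induction n arbitrary: x)
    case 0
    then show ?case using closure_subset[of "{x. f x \<noteq> 0}"] by auto
  next
    case (Suc n)
    have d: "((\<lambda>_. 0) has_vector_derivative nth_deriv (Suc n) f x) (at x)"
      by (rule has_vector_derivative_transform_within_open[OF nth_deriv_has_vector_derivative[OF sm, of n x], of "- ?K"])
         (use Suc in auto)
    show ?case using vector_derivative_at[OF d] by simp
  qed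
  have "bounded (range (\<lambda>x. x ^ m *\<^sub>R nth_deriv n f x))" for m n
  proof -
    let ?g = "\<lambda>x. x ^ m *\<^sub>R nth_deriv n f x"
    have "compact (?g ` ?K)"
      by (intro compact_continuous_image comp continuous_intros continuous_on_nth_deriv sm)
    then have "bounded (insert 0 (?g ` ?K))" by (simp add: compact_imp_bounded)
    moreover have "?g x \<in> insert 0 (?g ` ?K)" for x
      by (cases "x \<in> ?K") (simp_all add: zero)
    then have "range ?g \<subseteq> insert 0 (?g ` ?K)" by blast
    ultimately show ?thesis using bounded_subset by blast
  qed
  then show "f \<in> schwartz" using sm by (simp add: schwartz_def)
qed

lemma weight_le_moments: "(1 + x\<^sup>2) ^ k \<le> 2 ^ k * (1 + x ^ (2 * k))" for x :: real
proof (cases "x\<^sup>2 \<le> 1")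
  case True
  then have "(1 + x\<^sup>2) ^ k \<le> 2 ^ k" by (intro power_mono) auto
  also have "\<dots> \<le> 2 ^ k * (1 + x ^ (2 * k))" by (simp add: power_mult)
  finally show ?thesis .
next
  case False
  then have "(1 + x\<^sup>2) ^ k \<le> (2 * x\<^sup>2) ^ k" by (intro power_mono) auto
  also have "\<dots> \<le> 2 ^ k * (1 + x ^ (2 * k))" by (simp add: power_mult power_mult_distrib)
  finally show ?thesis .
qed

lemma le_weight_if_moments_le:
  fixes z :: complex and x :: real
  assumes "norm z \<le> a" "norm (x ^ (2 * k) *\<^sub>R z) \<le> b"
  shows "norm z \<le> 2 ^ k * (a + b) / (1 + x\<^sup>2) ^ k"
proof -
  have p: "0 < (1 + x\<^sup>2) ^ k" by (intro zero_less_power) (simp add: add_pos_nonneg)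
  have "norm z * (1 + x\<^sup>2) ^ k \<le> norm z * (2 ^ k * (1 + x ^ (2 * k)))"
    by (intro mult_left_mono weight_le_moments) auto
  also have "\<dots> = 2 ^ k * (norm z + norm (x ^ (2 * k) *\<^sub>R z))"
    by (simp add: algebra_simps zero_le_even_power)
  also have "\<dots> \<le> 2 ^ k * (a + b)"
    using assms by (intro mult_left_mono add_mono) auto
  finally show ?thesis using p by (simp add: pos_le_divide_eq)
qed

text \<open>
  Only the moments of order \<open>0\<close> and \<open>2 k\<close> matter, since \<open>(1 + x^2)^k \<le> 2^k (1 + x^(2k))\<close>.
\<close>
lemma schwartz_decay:
  assumes "f \<in> schwartz"
  shows "\<exists>C. \<forall>x. norm (nth_deriv n f x) \<le> C / (1 + x\<^sup>2) ^ k"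
proof -
  have b: "bounded (range (\<lambda>x. x ^ m *\<^sub>R nth_deriv n f x))" for m
    using assms by (simp add: schwartz_def)
  obtain a b where "\<And>x. norm (x ^ 0 *\<^sub>R nth_deriv n f x) \<le> a" "\<And>x. norm (x ^ (2 * k) *\<^sub>R nth_deriv n f x) \<le> b"
    using b[of 0] b[of "2 * k"] unfolding bounded_iff by blast
  then have "norm (nth_deriv n f x) \<le> 2 ^ k * (a + b) / (1 + x\<^sup>2) ^ k" for x
    by (intro le_weight_if_moments_le) auto
  then show ?thesis by blast
qed

lemma integrable_inverse_weight: "integrable lborel (\<lambda>x::real. 1 / (1 + x\<^sup>2))"
  using integrable_inverse_1_plus_square by (simp add: set_integrable_def inverse_eq_divide)

lemma integrable_nth_deriv:
  assumes "f \<in> schwartz"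
  shows "integrable lborel (nth_deriv n f)"
proof -
  obtain C where C: "\<And>x. norm (nth_deriv n f x) \<le> C / (1 + x\<^sup>2) ^ 1" using schwartz_decay[OF assms] by blast
  have meas: "nth_deriv n f \<in> borel_measurable lborel"
    unfolding measurable_lborel2
    using assms by (intro borel_measurable_continuous_onI continuous_on_nth_deriv) (simp add: schwartz_def)
  have int: "integrable lborel (\<lambda>x. C * (1 / (1 + x\<^sup>2)))"
    by (intro integrable_mult_right integrable_inverse_weight)
  have le: "norm (nth_deriv n f x) \<le> norm (C * (1 / (1 + x\<^sup>2)))" for x
    using order_trans[OF C[of x] abs_ge_self] by simp
  show ?thesis
    by (rule Bochner_Integration.integrable_bound[OF int meas AE_I2[OF le]])
qed

lemma fourier_nth_deriv:
  assumes f: "f \<in> schwartz"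
  shows "fourier (nth_deriv n f) \<xi> = (2 * of_real pi * \<i> * of_real \<xi>) ^ n * fourier f \<xi>"
proof (induction n)
  case (Suc n)
  have sm: "smooth f" using f by (simp add: schwartz_def)
  obtain C where C: "\<And>x. norm (nth_deriv n f x) \<le> C / (1 + x\<^sup>2) ^ 1" using schwartz_decay[OF f] by blast
  have lim: "((\<lambda>x. C / (1 + x\<^sup>2) ^ 1) \<longlongrightarrow> 0) at_top" "((\<lambda>x. C / (1 + x\<^sup>2) ^ 1) \<longlongrightarrow> 0) at_bot"
    by real_asymp+
  have "fourier (nth_deriv (Suc n) f) \<xi> = 2 * of_real pi * \<i> * of_real \<xi> * fourier (nth_deriv n f) \<xi>"
    using C by (intro fourier_vector_derivative nth_deriv_has_vector_derivative continuous_on_nth_deriv integrable_nth_deriv f sm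
          Lim_null_comparison[OF _ lim(1)] Lim_null_comparison[OF _ lim(2)] always_eventually allI)
  then show ?case using Suc by simp
qed simp

lemma norm_fourier_le: "norm (fourier f \<xi>) \<le> (\<integral>x. norm (f x) \<partial>lborel)"
proof -
  have "norm (fourier f \<xi>) \<le> (\<integral>x. norm (f x * cis (- 2 * pi * \<xi> * x)) \<partial>lborel)"
    unfolding fourier_cis by (rule integral_norm_bound)
  then show ?thesis by (simp only: norm_mult norm_cis mult_1_right)
qed

text \<open>
  Differentiation becomes multiplication by \<open>2 \<pi> \<i> \<xi>\<close>, so the moment of order \<open>2 k\<close> of the transform
  is bounded by the \<open>L1\<close>-norm of the derivative of order \<open>2 k\<close>.
\<close>
lemma fourier_schwartz_decay:
  assumes f: "f \<in> schwartz"
  shows "\<exists>D. \<forall>\<xi>. norm (fourier f \<xi>) \<le> D / (1 + \<xi>\<^sup>2) ^ k"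
proof -
  let ?I = "\<lambda>n. \<integral>x. norm (nth_deriv n f x) \<partial>lborel"
  have "norm (fourier f \<xi>) \<le> 2 ^ k * (?I 0 + ?I (2 * k)) / (1 + \<xi>\<^sup>2) ^ k" for \<xi>
  proof (rule le_weight_if_moments_le)
    show "norm (fourier f \<xi>) \<le> ?I 0"
      using norm_fourier_le[of f \<xi>] by simp
    have "(1::real) \<le> (2 * pi) ^ (2 * k)" using pi_gt3 by (intro one_le_power) auto
    then have "norm (\<xi> ^ (2 * k) *\<^sub>R fourier f \<xi>) \<le> (2 * pi) ^ (2 * k) * norm (\<xi> ^ (2 * k) *\<^sub>R fourier f \<xi>)"
      using mult_right_mono[of 1 "(2 * pi) ^ (2 * k)" "norm (\<xi> ^ (2 * k) *\<^sub>R fourier f \<xi>)"] by simp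
    also have "\<dots> = norm (fourier (nth_deriv (2 * k) f) \<xi>)"
      unfolding fourier_nth_deriv[OF f] by (simp add: norm_mult norm_power power_mult_distrib power_abs)
    also have "\<dots> \<le> ?I (2 * k)"
      by (rule norm_fourier_le)
    finally show "norm (\<xi> ^ (2 * k) *\<^sub>R fourier f \<xi>) \<le> ?I (2 * k)" .
  qed
  then show ?thesis by blast
qed

text \<open>
  The exponent \<open>3\<close> provides one factor \<open>1 / (1 + x^2)\<close> for each dimension of the lattices to which this
  is applied.
\<close>
locale tempered_family = locally_finite_family w x for w :: "'i \<Rightarrow> complex" and x +
  assumes summable_weights: "integrable (count_space UNIV) (\<lambda>i. norm (w i) / (1 + (x i)\<^sup>2) ^ 3)"
begin

lemma norm_point_functional_le:
  assumes "\<And>y. norm (f y) \<le> C / (1 + y\<^sup>2) ^ 3"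
  shows integrable_point_functional: "integrable (count_space UNIV) (\<lambda>i. w i * f (x i))"
    and "norm (point_functional w x f) \<le> C * (\<integral>i. norm (w i) / (1 + (x i)\<^sup>2) ^ 3 \<partial>count_space UNIV)"
proof -
  have b: "norm (w i * f (x i)) \<le> C * (norm (w i) / (1 + (x i)\<^sup>2) ^ 3)" for i
    using mult_left_mono[OF assms[of "x i"], of "norm (w i)"] by (simp add: norm_mult mult_ac)
  have int: "integrable (count_space UNIV) (\<lambda>i. C * (norm (w i) / (1 + (x i)\<^sup>2) ^ 3))"
    by (intro integrable_mult_right summable_weights)
  show *: "integrable (count_space UNIV) (\<lambda>i. w i * f (x i))"
    by (rule Bochner_Integration.integrable_bound[OF int])
       (simp, rule AE_I2, simp only: real_norm_def, rule order_trans[OF b abs_ge_self])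
  have "norm (point_functional w x f) \<le> (\<integral>i. norm (w i * f (x i)) \<partial>count_space UNIV)"
    unfolding point_functional_def by (rule integral_norm_bound)
  also have "\<dots> \<le> (\<integral>i. C * (norm (w i) / (1 + (x i)\<^sup>2) ^ 3) \<partial>count_space UNIV)"
    using b by (intro integral_mono integrable_norm * int) auto
  finally show "norm (point_functional w x f) \<le> C * (\<integral>i. norm (w i) / (1 + (x i)\<^sup>2) ^ 3 \<partial>count_space UNIV)"
    by (simp only: integral_mult_right_zero)
qed

lemma point_functional_add:
  assumes "\<And>y. norm (f y) \<le> C / (1 + y\<^sup>2) ^ 3" "\<And>y. norm (g y) \<le> D / (1 + y\<^sup>2) ^ 3"
  shows "point_functional w x (\<lambda>y. f y + g y) = point_functional w x f + point_functional w x g"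
  unfolding point_functional_def
  using integrable_point_functional[OF assms(1)] integrable_point_functional[OF assms(2)]
  by (simp add: distrib_left)

lemma point_functional_cmult: "point_functional w x (\<lambda>y. c * f y) = c * point_functional w x f"
  unfolding point_functional_def integral_mult_right_zero[symmetric] by (simp only: mult.left_commute)

lemma norm_moment_le_seminorm:
  assumes "f \<in> schwartz" "g \<in> schwartz"
  shows "norm (y ^ m *\<^sub>R (f y - g y)) \<le> schwartz_seminorm m 0 (\<lambda>y. f y - g y)"
proof -
  have "bounded (range (\<lambda>y. y ^ m *\<^sub>R f y))" "bounded (range (\<lambda>y. y ^ m *\<^sub>R g y))"
    using assms unfolding schwartz_def mem_Collect_eq by (metis nth_deriv_0)+
  then obtain a b where ab: "\<And>y. norm (y ^ m *\<^sub>R f y) \<le> a" "\<And>y. norm (y ^ m *\<^sub>R g y) \<le> b"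
    unfolding bounded_iff by blast
  have "norm (y ^ m *\<^sub>R (f y - g y)) \<le> a + b" for y
    unfolding scaleR_diff_right
    by (rule order_trans[OF norm_triangle_ineq4 add_mono[OF ab]])
  then have "bdd_above (range (\<lambda>y. norm (y ^ m *\<^sub>R (f y - g y))))"
    by (intro bdd_aboveI2)
  then show ?thesis unfolding schwartz_seminorm_def nth_deriv_0 by (rule cSUP_upper[OF UNIV_I])
qed

text \<open>
  Two of the seminorms already control the weighted supremum norm, which controls the functional.
\<close>
lemma point_functional_continuous:
  assumes f: "\<And>k. f k \<in> schwartz" and g: "g \<in> schwartz" and conv: "schwartz_converges f g"
  shows "(\<lambda>k. point_functional w x (f k)) \<longlonglongrightarrow> point_functional w x g"
proof -
  define S where "S k = 2 ^ 3 * (schwartz_seminorm 0 0 (\<lambda>y. f k y - g y) + schwartz_seminorm 6 0 (\<lambda>y. f k y - g y))" for k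
  let ?W = "\<integral>i. norm (w i) / (1 + (x i)\<^sup>2) ^ 3 \<partial>count_space UNIV"
  have "S \<longlonglongrightarrow> 2 ^ 3 * (0 + 0)"
    unfolding S_def using conv unfolding schwartz_converges_def by (intro tendsto_intros) auto
  then have S0: "(\<lambda>k. S k * ?W) \<longlonglongrightarrow> 0" by (simp add: tendsto_mult_left_zero)
  have d: "norm (f k y - g y) \<le> S k / (1 + y\<^sup>2) ^ 3" for k y
    unfolding S_def
    using norm_moment_le_seminorm[OF f g, of y 0 k] norm_moment_le_seminorm[OF f g, of y 6 k]
    by (intro le_weight_if_moments_le) auto
  obtain C where C: "\<And>y. norm (nth_deriv 0 g y) \<le> C / (1 + y\<^sup>2) ^ 3" using schwartz_decay[OF g] by blast
  have "point_functional w x (f k) = point_functional w x g + point_functional w x (\<lambda>y. f k y - g y)" for k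
    using point_functional_add[OF C[unfolded nth_deriv_0] d, of k] by simp
  then have "norm (point_functional w x (f k) - point_functional w x g) \<le> S k * ?W" for k
    using norm_point_functional_le(2)[OF d, of k] by simp
  then show ?thesis
    by (intro LIM_zero_cancel[OF Lim_null_comparison[OF _ S0]] always_eventually allI)
qed

lemma temperate_distribution_point_functional: "temperate_distribution (point_functional w x)"
  unfolding temperate_distribution_def
proof (intro conjI ballI allI impI)
  fix f g assume fg: "f \<in> schwartz" "g \<in> schwartz"
  obtain C D where "\<And>y. norm (nth_deriv 0 f y) \<le> C / (1 + y\<^sup>2) ^ 3" "\<And>y. norm (nth_deriv 0 g y) \<le> D / (1 + y\<^sup>2) ^ 3"
    using schwartz_decay[OF fg(1)] schwartz_decay[OF fg(2)] by blast
  then show "point_functional w x (\<lambda>y. f y + g y) = point_functional w x f + point_functional w x g"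
    unfolding nth_deriv_0 by (rule point_functional_add)
next
  fix f g assume "range f \<subseteq> schwartz \<and> g \<in> schwartz \<and> schwartz_converges f g"
  then show "(\<lambda>k. point_functional w x (f k)) \<longlonglongrightarrow> point_functional w x g"
    by (intro point_functional_continuous) auto
qed (rule point_functional_cmult)

lemma has_measure_integral_test_function:
  assumes "f \<in> test_functions"
  shows "has_measure_integral (point_measure_of w x) f (point_functional w x f)"
proof (rule has_measure_integral_point_functional)
  have sm: "smooth f" and "compact (closure {y. f y \<noteq> 0})" using assms by (auto simp: test_functions_def)
  then show "bounded {y. f y \<noteq> 0}" using bounded_subset[OF compact_imp_bounded closure_subset] by blast
  show "f \<in> borel_measurable borel"
    using continuous_on_nth_deriv[OF sm, of UNIV 0] by (intro borel_measurable_continuous_onI) simp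
qed

lemma is_temperate_measure_point_measure_of:
  "is_temperate_measure (point_measure_of w x) (point_functional w x)"
  unfolding is_temperate_measure_def
  by (intro conjI ballI complex_measure_point_measure_of temperate_distribution_point_functional
      has_measure_integral_test_function)

end

lemma fourier_add:
  assumes "integrable lborel f" "integrable lborel g"
  shows "fourier (\<lambda>y. f y + g y) = (\<lambda>\<xi>. fourier f \<xi> + fourier g \<xi>)"
proof
  fix \<xi>
  have "integrable lborel (\<lambda>x. h x * cis (- 2 * pi * \<xi> * x))" if "integrable lborel h" for h
    using that by (intro integrable_mult_unimodular) auto
  from this[OF assms(1)] this[OF assms(2)]
  show "fourier (\<lambda>y. f y + g y) \<xi> = fourier f \<xi> + fourier g \<xi>"
    unfolding fourier_cis by (simp add: distrib_right)
qed

lemma fourier_cmult: "fourier (\<lambda>y. c * f y) = (\<lambda>\<xi>. c * fourier f \<xi>)"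
  unfolding fourier_def integral_mult_right_zero[symmetric] by (simp only: mult.assoc)

text \<open>
  The transform of the functional agrees with another point functional on all Schwartz functions. It inherits
  continuity from it, and as a measure it is the other point measure, because test functions are
  Schwartz functions.
\<close>
lemma is_temperate_measure_fourier:
  assumes "tempered_family w x" "tempered_family u y"
    and dual: "\<And>f. f \<in> schwartz \<Longrightarrow> point_functional w x (fourier f) = point_functional u y f"
  shows "is_temperate_measure (point_measure_of u y) (fourier_distribution (point_functional w x))"
proof -
  interpret X: tempered_family w x by fact
  interpret Y: tempered_family u y by fact
  have eq: "fourier_distribution (point_functional w x) f = point_functional u y f" if "f \<in> schwartz" for f
    using dual[OF that] by (simp add: fourier_distribution_def)
  have "temperate_distribution (fourier_distribution (point_functional w x))"
    unfolding temperate_distribution_def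
  proof (intro conjI ballI allI impI)
    fix f g assume fg: "f \<in> schwartz" "g \<in> schwartz"
    obtain C D where CD: "\<And>y. norm (fourier f y) \<le> C / (1 + y\<^sup>2) ^ 3" "\<And>y. norm (fourier g y) \<le> D / (1 + y\<^sup>2) ^ 3"
      using fourier_schwartz_decay[OF fg(1)] fourier_schwartz_decay[OF fg(2)] by blast
    show "fourier_distribution (point_functional w x) (\<lambda>x. f x + g x) =
       fourier_distribution (point_functional w x) f + fourier_distribution (point_functional w x) g"
      using integrable_nth_deriv[OF fg(1), of 0] integrable_nth_deriv[OF fg(2), of 0] X.point_functional_add[OF CD]
      by (simp add: fourier_distribution_def fourier_add)
  next
    fix c f
    show "fourier_distribution (point_functional w x) (\<lambda>x. c * f x) = c * fourier_distribution (point_functional w x) f"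
      by (simp add: fourier_distribution_def fourier_cmult X.point_functional_cmult)
  next
    fix f g assume *: "range f \<subseteq> schwartz \<and> g \<in> schwartz \<and> schwartz_converges f g"
    then have "(\<lambda>k. point_functional u y (f k)) \<longlonglongrightarrow> point_functional u y g"
      by (intro Y.point_functional_continuous) auto
    moreover have "fourier_distribution (point_functional w x) (f k) = point_functional u y (f k)" for k
      using * by (intro eq) auto
    moreover have "fourier_distribution (point_functional w x) g = point_functional u y g"
      using * by (intro eq) auto
    ultimately show "(\<lambda>k. fourier_distribution (point_functional w x) (f k)) \<longlonglongrightarrow> fourier_distribution (point_functional w x) g"
      by simp
  qed
  moreover have "has_measure_integral (point_measure_of u y) f (fourier_distribution (point_functional w x) f)"
    if "f \<in> test_functions" for f
    using Y.has_measure_integral_test_function[OF that] eq[of f] test_functions_subset_schwartz that by auto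
  ultimately show ?thesis
    using Y.complex_measure_point_measure_of by (simp add: is_temperate_measure_def)
qed


section \<open>Arithmetic progressions and a transcendental shift\<close>

lemma countable_algebraic: "countable {x :: real. algebraic x}"
proof -
  let ?P = "range (\<lambda>xs :: int list. Poly (map real_of_int xs)) - {0}"
  have "{x :: real. algebraic x} \<subseteq> (\<Union>p\<in>?P. {x. poly p x = 0})"
  proof
    fix x :: real assume "x \<in> {x. algebraic x}"
    then obtain p where p: "\<And>i. coeff p i \<in> \<int>" "p \<noteq> 0" "poly p x = 0"
      by (auto simp: algebraic_def)
    have "map real_of_int (map floor (coeffs p)) = coeffs p"
    proof (rule nth_equalityI)
      fix i assume "i < length (map real_of_int (map floor (coeffs p)))"
      then have i: "i < length (coeffs p)" by simp
      moreover have "coeffs p ! i = coeff p i"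
        using i p(2) by (intro coeffs_nth) (auto simp: length_coeffs)
      moreover obtain z where "coeff p i = of_int z" using p(1)[of i] by (auto elim: Ints_cases)
      ultimately show "map real_of_int (map floor (coeffs p)) ! i = coeffs p ! i" by simp
    qed simp
    then have "Poly (map real_of_int (map floor (coeffs p))) = p" by (simp only: Poly_coeffs)
    then have "p \<in> ?P" using p(2) by (metis Diff_iff rangeI singletonD)
    then show "x \<in> (\<Union>p\<in>?P. {x. poly p x = 0})" using p(3) by blast
  qed
  moreover have "countable (\<Union>p\<in>?P. {x. poly p x = 0})"
    by (rule countable_UN) (auto intro: countable_finite poly_roots_finite)
  ultimately show ?thesis by (rule countable_subset)
qed

text \<open>
  Countability leaves a transcendental number in every interval; the interval is used below to keep the
  shifted lattice away from the origin.
\<close>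
lemma transcendental_exists:
  fixes a b :: real
  assumes "a < b"
  shows "\<exists>x. a < x \<and> x < b \<and> \<not> algebraic x"
proof (rule ccontr)
  assume "\<not> ?thesis"
  then have "{a<..<b} \<subseteq> {x. algebraic x}" by auto
  then have "countable {a<..<b}" using countable_algebraic by (rule countable_subset)
  then show False using assms uncountable_open_interval[of a b] by blast
qed

definition rat_span :: "real \<Rightarrow> real set" where
  "rat_span \<theta> = {q0 + q1 * \<theta> + q2 * \<theta> ^ 4 | q0 q1 q2. q0 \<in> \<rat> \<and> q1 \<in> \<rat> \<and> q2 \<in> \<rat>}"

lemma rat_span_combine:
  assumes "x \<in> rat_span \<theta>" "y \<in> rat_span \<theta>" "q \<in> \<rat>" "r \<in> \<rat>"
  shows "q * x + r * y \<in> rat_span \<theta>"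
proof -
  obtain x0 x1 x2 y0 y1 y2 where
    x: "x = x0 + x1 * \<theta> + x2 * \<theta> ^ 4" "x0 \<in> \<rat>" "x1 \<in> \<rat>" "x2 \<in> \<rat>" and
    y: "y = y0 + y1 * \<theta> + y2 * \<theta> ^ 4" "y0 \<in> \<rat>" "y1 \<in> \<rat>" "y2 \<in> \<rat>"
    using assms unfolding rat_span_def by auto
  have eq: "q * x + r * y = (q * x0 + r * y0) + (q * x1 + r * y1) * \<theta> + (q * x2 + r * y2) * \<theta> ^ 4"
    unfolding x y by (simp add: algebra_simps)
  show ?thesis
    unfolding rat_span_def by (intro CollectI exI conjI, rule eq) (use x y assms(3,4) in auto)
qed

text \<open>
  The hypothesis says that the quadratic polynomial with coefficients \<open>D\<close>, \<open>E\<close> and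
  \<open>\<theta>^2 + \<theta>^8 + F\<close> has a double root. As a polynomial identity in \<open>\<theta>\<close>, the powers \<open>\<theta>^12\<close> and \<open>\<theta>^3\<close> show that \<open>D\<close> is
  rational, and the powers \<open>\<theta>^2\<close>, \<open>\<theta>^8\<close> and \<open>\<theta>^5\<close> that, unless \<open>D = 0\<close>,
  the form \<open>u^2 + v^2\<close> with \<open>u = \<theta>\<close> and \<open>v = \<theta>^4\<close> is a constant times the square of a
  linear form in \<open>u\<close> and \<open>v\<close>. The exponent \<open>4\<close> of the second coordinate keeps these powers apart.
\<close>
lemma discriminant_relation_imp_zero:
  assumes \<theta>: "\<not> algebraic (\<theta> :: real)"
    and D: "D \<in> rat_span \<theta>" and E: "E \<in> rat_span \<theta>" and F: "F \<in> rat_span \<theta>"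
    and rel: "E\<^sup>2 = 4 * D * (\<theta>\<^sup>2 + (\<theta> ^ 4)\<^sup>2 + F)"
  shows "D = 0"
proof -
  obtain D0 D1 D2 where D: "D = D0 + D1 * \<theta> + D2 * \<theta> ^ 4" "D0 \<in> \<rat>" "D1 \<in> \<rat>" "D2 \<in> \<rat>"
    using D unfolding rat_span_def by auto
  obtain E0 E1 E2 where E: "E = E0 + E1 * \<theta> + E2 * \<theta> ^ 4" "E0 \<in> \<rat>" "E1 \<in> \<rat>" "E2 \<in> \<rat>"
    using E unfolding rat_span_def by auto
  obtain F0 F1 F2 where F: "F = F0 + F1 * \<theta> + F2 * \<theta> ^ 4" "F0 \<in> \<rat>" "F1 \<in> \<rat>" "F2 \<in> \<rat>"
    using F unfolding rat_span_def by auto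
  define p where "p = [:E0 * E0 - 4 * (D0 * F0), 2 * (E0 * E1) - 4 * (D0 * F1 + D1 * F0),
    E1 * E1 - 4 * (D0 + D1 * F1), - 4 * D1, 2 * (E0 * E2) - 4 * (D0 * F2 + D2 * F0),
    2 * (E1 * E2) - 4 * (D1 * F2 + D2 * F1), - 4 * D2, 0, E2 * E2 - 4 * (D0 + D2 * F2), - 4 * D1, 0, 0, - 4 * D2:]"
  have "coeff p i \<in> \<rat>" for i
    unfolding p_def using D E F by (auto simp: coeff_pCons split: nat.split)
  moreover have "poly p \<theta> = E\<^sup>2 - 4 * D * (\<theta>\<^sup>2 + (\<theta> ^ 4)\<^sup>2 + F)"
    unfolding p_def D(1) E(1) F(1) by (simp add: algebra_simps power2_eq_square numeral_eq_Suc)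
  ultimately have "p = 0" using \<theta> rel unfolding algebraic_altdef by auto
  then have "D2 = 0" "D1 = 0" "E1 * E1 = 4 * D0" "E2 * E2 = 4 * D0" "E1 * E2 = 0"
    unfolding p_def by auto
  then show "D = 0" using D(1) by auto
qed

text \<open>
  The square of \<open>|m + v|\<close> for \<open>v = (\<theta>, \<theta>^4, 0)\<close>.
\<close>
definition shifted_norm_sq :: "real \<Rightarrow> int \<times> int \<times> int \<Rightarrow> real" where
  "shifted_norm_sq \<theta> = (\<lambda>(m1, m2, m3). (of_int m1 + \<theta>)\<^sup>2 + (of_int m2 + \<theta> ^ 4)\<^sup>2 + (of_int m3)\<^sup>2)"

lemma shifted_norm_sq_in_span: "shifted_norm_sq \<theta> m - (\<theta>\<^sup>2 + (\<theta> ^ 4)\<^sup>2) \<in> rat_span \<theta>"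
proof -
  obtain m1 m2 m3 where m: "m = (m1, m2, m3)" by (cases m)
  have "shifted_norm_sq \<theta> m - (\<theta>\<^sup>2 + (\<theta> ^ 4)\<^sup>2) =
    of_int (m1 * m1 + m2 * m2 + m3 * m3) + of_int (2 * m1) * \<theta> + of_int (2 * m2) * \<theta> ^ 4"
    unfolding shifted_norm_sq_def m by (simp add: power2_eq_square algebra_simps)
  then show ?thesis unfolding rat_span_def using Rats_of_int by blast
qed

text \<open>
  Divided differences of \<open>(a + k d)^2 - |v|^2\<close> at three integers express \<open>d^2\<close>, \<open>2 a d\<close> and
  \<open>a^2 - |v|^2\<close> as rational combinations of its values, which lie in the span because the cross terms
  of \<open>|m + v|^2\<close> are integral multiples of \<open>\<theta>\<close> and \<open>\<theta>^4\<close>.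
\<close>
lemma no_three_terms:
  assumes \<theta>: "\<not> algebraic \<theta>" and k: "k0 \<noteq> k1" "k0 \<noteq> k2" "k1 \<noteq> (k2 :: int)"
    and 0: "(a + of_int k0 * d)\<^sup>2 = shifted_norm_sq \<theta> m0"
    and 1: "(a + of_int k1 * d)\<^sup>2 = shifted_norm_sq \<theta> m1"
    and 2: "(a + of_int k2 * d)\<^sup>2 = shifted_norm_sq \<theta> m2"
  shows "d = 0"
proof -
  \<comment> \<open>\<open>V\<close> is \<open>|v|^2\<close>, and \<open>s k l\<close> below is the divided difference of \<open>y\<close> at \<open>k\<close> and \<open>l\<close>.\<close>
  define V where "V = \<theta>\<^sup>2 + (\<theta> ^ 4)\<^sup>2"
  define y where "y k = (a + of_int k * d)\<^sup>2 - V" for k :: int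
  have y: "y k0 \<in> rat_span \<theta>" "y k1 \<in> rat_span \<theta>" "y k2 \<in> rat_span \<theta>"
    unfolding y_def V_def 0 1 2 by (rule shifted_norm_sq_in_span)+
  define s where "s k l = (y l - y k) / of_int (l - k)" for k l
  have s_in: "s k l \<in> rat_span \<theta>" if "y k \<in> rat_span \<theta>" "y l \<in> rat_span \<theta>" for k l
  proof -
    have "(1 / of_int (l - k)) * y l + (- 1 / of_int (l - k)) * y k \<in> rat_span \<theta>"
      using that by (intro rat_span_combine) auto
    then show ?thesis by (simp add: s_def diff_divide_distrib)
  qed
  have s_eq: "s k l = 2 * a * d + d\<^sup>2 * of_int (k + l)" if "k \<noteq> l" for k l
  proof -
    have "y l - y k = (2 * a * d + d\<^sup>2 * of_int (k + l)) * of_int (l - k)"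
      by (simp add: y_def power2_eq_square algebra_simps)
    then show ?thesis using that by (simp add: s_def)
  qed
  have "(1 / of_int (k2 - k1)) * s k0 k2 + (- 1 / of_int (k2 - k1)) * s k0 k1 \<in> rat_span \<theta>"
    using y by (intro rat_span_combine s_in) auto
  also have "(1 / of_int (k2 - k1)) * s k0 k2 + (- 1 / of_int (k2 - k1)) * s k0 k1 = d\<^sup>2"
  proof -
    have "s k0 k2 - s k0 k1 = d\<^sup>2 * of_int (k2 - k1)"
      unfolding s_eq[OF k(1)] s_eq[OF k(2)] by (simp add: algebra_simps)
    moreover have "(1 / c) * u + (- 1 / c) * v = (u - v) / c" for c u v :: real
      by (simp add: diff_divide_distrib)
    ultimately show ?thesis using k by simp
  qed
  finally have D: "d\<^sup>2 \<in> rat_span \<theta>" .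
  have "1 * s k0 k1 + of_int (- (k0 + k1)) * d\<^sup>2 \<in> rat_span \<theta>"
    using y D by (intro rat_span_combine s_in) auto
  then have E: "2 * a * d \<in> rat_span \<theta>"
    unfolding s_eq[OF k(1)] by (simp add: algebra_simps)
  have "of_int (- k0) * (2 * a * d) + of_int (- (k0 * k0)) * d\<^sup>2 \<in> rat_span \<theta>"
    using D E by (intro rat_span_combine) auto
  with y(1) have "1 * y k0 + 1 * (of_int (- k0) * (2 * a * d) + of_int (- (k0 * k0)) * d\<^sup>2) \<in> rat_span \<theta>"
    by (rule rat_span_combine) auto
  then have F: "a\<^sup>2 - V \<in> rat_span \<theta>"
    by (simp add: y_def power2_eq_square algebra_simps)
  have "(2 * a * d)\<^sup>2 = 4 * d\<^sup>2 * (\<theta>\<^sup>2 + (\<theta> ^ 4)\<^sup>2 + (a\<^sup>2 - V))"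
    by (simp add: V_def power_mult_distrib)
  from discriminant_relation_imp_zero[OF \<theta> D E F this] show ?thesis by simp
qed

lemma finite_progression_indices:
  assumes \<theta>: "\<not> algebraic \<theta>" and d: "d \<noteq> 0"
  shows "finite {k :: int. \<exists>m. (a + of_int k * d)\<^sup>2 = shifted_norm_sq \<theta> m}" (is "finite ?K")
proof (rule ccontr)
  assume "infinite ?K"
  then obtain K where "K \<subseteq> ?K" "card K = 3" using infinite_arbitrarily_large by blast
  then obtain k0 k1 k2 where "k0 \<noteq> k1" "k0 \<noteq> k2" "k1 \<noteq> k2" "k0 \<in> ?K" "k1 \<in> ?K" "k2 \<in> ?K"
    unfolding card_3_iff by auto
  then show False using no_three_terms[OF \<theta>] d by blast
qed

text \<open>
  One length of the lattice is attained only once, so that its point mass cannot be cancelled by others.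
\<close>
lemma shifted_norm_sq_eq_0_vector:
  assumes \<theta>: "\<not> algebraic \<theta>" and eq: "shifted_norm_sq \<theta> m = shifted_norm_sq \<theta> (0, 0, 0)"
  shows "m = (0, 0, 0)"
proof -
  obtain m1 m2 m3 where m: "m = (m1, m2, m3)" by (cases m)
  define p where "p = [:real_of_int (m1 * m1 + m2 * m2 + m3 * m3), of_int (2 * m1), 0, 0, of_int (2 * m2):]"
  have "poly p \<theta> = 0"
    using eq unfolding p_def m shifted_norm_sq_def by (simp add: power2_eq_square algebra_simps numeral_eq_Suc)
  moreover have "coeff p i \<in> \<int>" for i
    unfolding p_def by (auto simp: coeff_pCons split: nat.split)
  ultimately have "p = 0" using \<theta> unfolding algebraic_def by blast
  then have z: "m1 = 0" "m2 = 0" "real_of_int (m1 * m1 + m2 * m2 + m3 * m3) = 0" unfolding p_def by auto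
  then show ?thesis using m by simp
qed


section \<open>Shifted lattices in three-dimensional space\<close>

lemma integral_count_space_triple_product:
  fixes f g h :: "int \<Rightarrow> 'c :: {banach, real_normed_field, second_countable_topology}"
  assumes f: "integrable (count_space UNIV) f" and g: "integrable (count_space UNIV) g"
    and h: "integrable (count_space UNIV) h"
  shows "integrable (count_space UNIV) (\<lambda>(m1, m2, m3). f m1 * (g m2 * h m3))"
    and "(\<integral>m. (case m of (m1, m2, m3) \<Rightarrow> f m1 * (g m2 * h m3)) \<partial>count_space UNIV) =
      (\<integral>n. f n \<partial>count_space UNIV) * ((\<integral>n. g n \<partial>count_space UNIV) * (\<integral>n. h n \<partial>count_space UNIV))"
proof -
  have s: "Infinite_Set_Sum.abs_summable_on f UNIV" "Infinite_Set_Sum.abs_summable_on g UNIV" "Infinite_Set_Sum.abs_summable_on h UNIV"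
    using f g h by (simp_all add: Infinite_Set_Sum.abs_summable_on_def)
  have gh: "Infinite_Set_Sum.abs_summable_on (\<lambda>(x, y). g x * h y) (UNIV \<times> UNIV)"
    using s by (intro abs_summable_on_product) auto
  have e: "(\<lambda>(m1, m2, m3). f m1 * (g m2 * h m3)) = (\<lambda>(x, y). f x * (case y of (u, v) \<Rightarrow> g u * h v))"
    by auto
  have "Infinite_Set_Sum.abs_summable_on (\<lambda>(x, y). f x * (case y of (u, v) \<Rightarrow> g u * h v)) (UNIV \<times> (UNIV \<times> UNIV))"
    using s gh by (intro abs_summable_on_product) auto
  then show "integrable (count_space UNIV) (\<lambda>(m1, m2, m3). f m1 * (g m2 * h m3))"
    unfolding e by (simp add: Infinite_Set_Sum.abs_summable_on_def)
  have "infsetsum (\<lambda>(x, y). f x * (case y of (u, v) \<Rightarrow> g u * h v)) (UNIV \<times> (UNIV \<times> UNIV)) =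
     infsetsum f UNIV * infsetsum (\<lambda>(x, y). g x * h y) (UNIV \<times> UNIV)"
    using s gh by (intro infsetsum_product) auto
  also have "infsetsum (\<lambda>(x, y). g x * h y) (UNIV \<times> UNIV) = infsetsum g UNIV * infsetsum h UNIV"
    using s by (intro infsetsum_product) auto
  finally show "(\<integral>m. (case m of (m1, m2, m3) \<Rightarrow> f m1 * (g m2 * h m3)) \<partial>count_space UNIV) =
      (\<integral>n. f n \<partial>count_space UNIV) * ((\<integral>n. g n \<partial>count_space UNIV) * (\<integral>n. h n \<partial>count_space UNIV))"
    unfolding infsetsum_def e by simp
qed

definition lattice_norm :: "real \<times> real \<times> real \<Rightarrow> int \<times> int \<times> int \<Rightarrow> real" where
  "lattice_norm = (\<lambda>(u1, u2, u3) (m1, m2, m3).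
    sqrt ((of_int m1 + u1)\<^sup>2 + (of_int m2 + u2)\<^sup>2 + (of_int m3 + u3)\<^sup>2))"

lemma lattice_norm_sq:
  "(lattice_norm (u1, u2, u3) (m1, m2, m3))\<^sup>2 = (of_int m1 + u1)\<^sup>2 + (of_int m2 + u2)\<^sup>2 + (of_int m3 + u3)\<^sup>2"
  by (simp add: lattice_norm_def)

lemma lattice_norm_nonneg: "lattice_norm u m \<ge> 0"
  by (simp add: lattice_norm_def split: prod.split)

lemma abs_le_lattice_norm:
  "\<bar>of_int m1 + u1\<bar> \<le> lattice_norm (u1, u2, u3) (m1, m2, m3)"
  "\<bar>of_int m2 + u2\<bar> \<le> lattice_norm (u1, u2, u3) (m1, m2, m3)"
  "\<bar>of_int m3 + u3\<bar> \<le> lattice_norm (u1, u2, u3) (m1, m2, m3)"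
  unfolding lattice_norm_def prod.case by (rule real_le_rsqrt; simp)+

text \<open>
  One factor \<open>1 / (1 + |x|^2)\<close> is spent on each coordinate.
\<close>
lemma integrable_lattice_weight:
  "integrable (count_space UNIV) (\<lambda>m. 1 / (1 + (lattice_norm u m)\<^sup>2) ^ 3)"
proof -
  obtain u1 u2 u3 where u: "u = (u1, u2, u3)" by (cases u)
  let ?w = "\<lambda>x n. 1 / (1 + (real_of_int n + x)\<^sup>2)"
  have "integrable (count_space UNIV) (\<lambda>(m1, m2, m3). ?w u1 m1 * (?w u2 m2 * ?w u3 m3))"
    by (intro integral_count_space_triple_product integrable_shifted_int_weight)
  then show ?thesis
  proof (rule Bochner_Integration.integrable_bound)
    have "norm (1 / (1 + (lattice_norm u m)\<^sup>2) ^ 3) \<le> norm (case m of (m1, m2, m3) \<Rightarrow> ?w u1 m1 * (?w u2 m2 * ?w u3 m3))" for m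
    proof -
      obtain m1 m2 m3 where m: "m = (m1, m2, m3)" by (cases m)
      let ?N = "lattice_norm u m"
      have p: "0 < 1 + y\<^sup>2" for y :: real by (simp add: add_pos_nonneg)
      have sq: "(of_int m1 + u1)\<^sup>2 \<le> ?N\<^sup>2" "(of_int m2 + u2)\<^sup>2 \<le> ?N\<^sup>2" "(of_int m3 + u3)\<^sup>2 \<le> ?N\<^sup>2"
        unfolding u m lattice_norm_sq by simp_all
      have le: "?w x n \<ge> 1 / (1 + ?N\<^sup>2)" if "(of_int n + x)\<^sup>2 \<le> ?N\<^sup>2" for x n
        using that p by (intro divide_left_mono mult_pos_pos) auto
      have "1 / (1 + ?N\<^sup>2) * (1 / (1 + ?N\<^sup>2) * (1 / (1 + ?N\<^sup>2))) \<le> ?w u1 m1 * (?w u2 m2 * ?w u3 m3)"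
        using p by (intro mult_mono le sq mult_nonneg_nonneg) (auto simp: less_imp_le)
      moreover have "1 / (1 + ?N\<^sup>2) * (1 / (1 + ?N\<^sup>2) * (1 / (1 + ?N\<^sup>2))) = 1 / (1 + ?N\<^sup>2) ^ 3"
        by (simp add: power3_eq_cube)
      ultimately show ?thesis using p by (simp add: m less_imp_le)
    qed
    then show "AE m in count_space UNIV. norm (1 / (1 + (lattice_norm u m)\<^sup>2) ^ 3) \<le>
        norm (case m of (m1, m2, m3) \<Rightarrow> ?w u1 m1 * (?w u2 m2 * ?w u3 m3))"
      by (intro AE_I2)
  qed simp
qed

lemma finite_lattice_ball: "finite {m. lattice_norm u m \<le> R}"
proof -
  obtain u1 u2 u3 where u: "u = (u1, u2, u3)" by (cases u)
  have fin: "finite {n :: int. \<bar>of_int n + x\<bar> \<le> R}" for x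
  proof (rule finite_subset)
    show "{n :: int. \<bar>of_int n + x\<bar> \<le> R} \<subseteq> {\<lfloor>- R - x\<rfloor>..\<lceil>R - x\<rceil>}"
      by (auto simp: abs_le_iff floor_le_iff le_ceiling_iff)
  qed simp
  have "{m. lattice_norm u m \<le> R} \<subseteq>
    {n. \<bar>of_int n + u1\<bar> \<le> R} \<times> {n. \<bar>of_int n + u2\<bar> \<le> R} \<times> {n. \<bar>of_int n + u3\<bar> \<le> R}"
  proof
    fix m assume m: "m \<in> {m. lattice_norm u m \<le> R}"
    obtain m1 m2 m3 where "m = (m1, m2, m3)" by (cases m)
    then show "m \<in> {n. \<bar>of_int n + u1\<bar> \<le> R} \<times> {n. \<bar>of_int n + u2\<bar> \<le> R} \<times> {n. \<bar>of_int n + u3\<bar> \<le> R}"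
      using m abs_le_lattice_norm[of m1 u1 u2 u3 m2 m3] abs_le_lattice_norm(2)[of m2 u2 u1 u3 m1 m3]
        abs_le_lattice_norm(3)[of m3 u3 u1 u2 m1 m2] by (simp add: u)
  qed
  then show ?thesis by (rule finite_subset) (intro finite_cartesian_product fin)
qed

text \<open>
  With \<open>odd_point\<close>, the family of point masses \<open>c i\<close> at \<open>p i\<close> and \<open>- c i\<close> at \<open>- p i\<close>.
\<close>
definition odd_weight :: "('i \<Rightarrow> complex) \<Rightarrow> bool \<times> 'i \<Rightarrow> complex" where
  "odd_weight c = (\<lambda>(s, i). if s then c i else - c i)"

definition odd_point :: "('i \<Rightarrow> real) \<Rightarrow> bool \<times> 'i \<Rightarrow> real" where
  "odd_point p = (\<lambda>(s, i). if s then p i else - p i)"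

lemma tempered_family_odd:
  fixes c :: "'i::countable \<Rightarrow> complex"
  assumes sum: "integrable (count_space UNIV) (\<lambda>i. norm (c i) / (1 + (p i)\<^sup>2) ^ 3)"
    and fin: "\<And>R. finite {i. \<bar>p i\<bar> \<le> R}"
  shows "tempered_family (odd_weight c) (odd_point p)"
proof
  fix R
  have "{i. \<bar>odd_point p i\<bar> \<le> R} \<subseteq> (UNIV :: bool set) \<times> {i. \<bar>p i\<bar> \<le> R}"
    by (auto simp: odd_point_def split: if_splits)
  then show "finite {i. \<bar>odd_point p i\<bar> \<le> R}"
    by (rule finite_subset) (simp add: fin)
next
  have "Infinite_Set_Sum.abs_summable_on (\<lambda>(s::bool, i). 1 * (norm (c i) / (1 + (p i)\<^sup>2) ^ 3)) (UNIV \<times> UNIV)"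
  proof (rule abs_summable_on_product)
    show "Infinite_Set_Sum.abs_summable_on (\<lambda>s::bool. 1 :: real) UNIV" by simp
    show "Infinite_Set_Sum.abs_summable_on (\<lambda>i. norm (c i) / (1 + (p i)\<^sup>2) ^ 3) UNIV"
      using sum by (simp add: Infinite_Set_Sum.abs_summable_on_def)
  qed auto
  moreover have "(\<lambda>(s::bool, i). 1 * (norm (c i) / (1 + (p i)\<^sup>2) ^ 3)) =
     (\<lambda>i. norm (odd_weight c i) / (1 + (odd_point p i)\<^sup>2) ^ 3)"
    by (auto simp: odd_weight_def odd_point_def)
  ultimately show "integrable (count_space UNIV) (\<lambda>i. norm (odd_weight c i) / (1 + (odd_point p i)\<^sup>2) ^ 3)"
    by (simp add: Infinite_Set_Sum.abs_summable_on_def)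
qed

lemma point_functional_odd:
  fixes c :: "'i::countable \<Rightarrow> complex"
  assumes fam: "tempered_family (odd_weight c) (odd_point p)"
    and f: "\<And>y. norm (f y) \<le> C / (1 + y\<^sup>2) ^ 3"
  shows "point_functional (odd_weight c) (odd_point p) f = (\<integral>i. c i * (f (p i) - f (- p i)) \<partial>count_space UNIV)"
proof -
  interpret tempered_family "odd_weight c" "odd_point p" by fact
  let ?F = "\<lambda>i. odd_weight c i * f (odd_point p i)"
  have sum: "Infinite_Set_Sum.abs_summable_on ?F (UNIV \<times> UNIV)"
    using integrable_point_functional[OF f] by (simp add: Infinite_Set_Sum.abs_summable_on_def)
  have proj: "Infinite_Set_Sum.abs_summable_on (\<lambda>i. ?F (s, i)) UNIV" for s
    using sum by (subst (asm) abs_summable_on_Sigma_iff) auto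
  have "point_functional (odd_weight c) (odd_point p) f = infsetsum ?F (UNIV \<times> UNIV)"
    by (simp add: point_functional_def infsetsum_def)
  also have "\<dots> = infsetsum (\<lambda>s. infsetsum (\<lambda>i. ?F (s, i)) UNIV) UNIV"
    using sum by (intro infsetsum_Times) auto
  also have "\<dots> = infsetsum (\<lambda>i. ?F (True, i)) UNIV + infsetsum (\<lambda>i. ?F (False, i)) UNIV"
    by (simp add: UNIV_bool add.commute)
  also have "\<dots> = infsetsum (\<lambda>i. ?F (True, i) + ?F (False, i)) UNIV"
    using proj by (intro infsetsum_add[symmetric]) auto
  also have "\<dots> = (\<integral>i. c i * (f (p i) - f (- p i)) \<partial>count_space UNIV)"
    by (simp add: infsetsum_def odd_weight_def odd_point_def algebra_simps)
  finally show ?thesis .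
qed

lemma integrable_gaussian_int:
  assumes "t > 0"
  shows "integrable (count_space UNIV) (\<lambda>n::int. exp (- pi * t * (real_of_int n + x)\<^sup>2))"
proof -
  obtain K where K: "\<And>p. exp (- pi * t * p\<^sup>2) \<le> K * (1 / (1 + p\<^sup>2))"
    using gaussian_le_inverse_weight[OF assms] by blast
  have "integrable (count_space UNIV) (\<lambda>n::int. K * (1 / (1 + (real_of_int n + x)\<^sup>2)))"
    by (intro integrable_mult_right integrable_shifted_int_weight)
  then show ?thesis
    by (rule Bochner_Integration.integrable_bound)
       (simp, rule AE_I2, simp only: real_norm_def abs_exp_cancel, rule order_trans[OF K abs_ge_self])
qed

definition parity_sign :: "int \<Rightarrow> complex" where
  "parity_sign n = (if even n then 1 else - 1)"

lemma parity_sign_cis: "cis (2 * pi * real_of_int n * (- 1 / 2)) = parity_sign n"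
  by (simp add: complex_eq_iff parity_sign_def cos_npi_int sin_npi_int)

text \<open>
  The Gaussian of \<open>|x|^2\<close> is a product over the coordinates, so the sum over the lattice is a product of
  three theta functions: two with a real shift on the right and a character on the left, and one with a
  shift by \<open>-1/2\<close> on the left and the corresponding character \<open>(-1)^m3\<close> on the right.
\<close>
lemma product_theta_identity:
  assumes t: "t > 0"
  shows "(\<integral>k. (case k of (k1, k2, k3) \<Rightarrow> cis (2 * pi * of_int k1 * v1) * cis (2 * pi * of_int k2 * v2)) *
      of_real (exp (- pi * t * (lattice_norm (0, 0, - 1 / 2) k)\<^sup>2)) \<partial>count_space UNIV) =
    of_real (1 / (t * sqrt t)) *
    (\<integral>m. (case m of (m1, m2, m3) \<Rightarrow> parity_sign m3) *
      of_real (exp (- pi * (lattice_norm (v1, v2, 0) m)\<^sup>2 / t)) \<partial>count_space UNIV)"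
proof -
  let ?c = "\<lambda>v k. of_real (exp (- pi * t * (real_of_int k)\<^sup>2)) * cis (2 * pi * real_of_int k * v)"
  let ?d = "\<lambda>k. complex_of_real (exp (- pi * t * (real_of_int k + (- 1 / 2))\<^sup>2))"
  let ?g = "\<lambda>v n. complex_of_real (exp (- pi * (real_of_int n + v)\<^sup>2 / t))"
  let ?s = "\<lambda>n. complex_of_real (exp (- pi * (real_of_int n)\<^sup>2 / t)) * parity_sign n"
  have int_c: "integrable (count_space UNIV) (?c v)" for v
    using integrable_gaussian_int[OF t, of 0] by (intro integrable_mult_unimodular) auto
  have int_d: "integrable (count_space UNIV) ?d"
    using integrable_gaussian_int[OF t, of "- 1 / 2"] by simp
  have int_g: "integrable (count_space UNIV) (?g v)" for v
    using integrable_gaussian_int[of "1 / t" v] t by simp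
  have int_s: "integrable (count_space UNIV) ?s"
    using int_g[of 0] by (intro integrable_mult_unimodular) (auto simp: parity_sign_def)
  have c_eq: "(\<integral>k. ?c v k \<partial>count_space UNIV) = of_real (1 / sqrt t) * (\<integral>n. ?g v n \<partial>count_space UNIV)" for v
    using theta_functional_equation[of "1 / t" v] t by (simp add: real_sqrt_divide field_simps)
  have d_eq: "(\<integral>k. ?d k \<partial>count_space UNIV) = of_real (1 / sqrt t) * (\<integral>n. ?s n \<partial>count_space UNIV)"
    using theta_functional_equation[OF t, of "- 1 / 2"] unfolding parity_sign_cis .
  have "(\<integral>k. (case k of (k1, k2, k3) \<Rightarrow> cis (2 * pi * of_int k1 * v1) * cis (2 * pi * of_int k2 * v2)) *
      of_real (exp (- pi * t * (lattice_norm (0, 0, - 1 / 2) k)\<^sup>2)) \<partial>count_space UNIV) =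
    (\<integral>k. (case k of (k1, k2, k3) \<Rightarrow> ?c v1 k1 * (?c v2 k2 * ?d k3)) \<partial>count_space UNIV)"
  proof (rule Bochner_Integration.integral_cong[OF refl])
    fix k :: "int \<times> int \<times> int"
    obtain k1 k2 k3 where k: "k = (k1, k2, k3)" by (cases k)
    have "- pi * t * (lattice_norm (0, 0, - 1 / 2) k)\<^sup>2 =
       (- pi * t * (real_of_int k1)\<^sup>2) + (- pi * t * (real_of_int k2)\<^sup>2) + (- pi * t * (real_of_int k3 + (- 1 / 2))\<^sup>2)"
      unfolding k lattice_norm_sq by (simp add: algebra_simps)
    then show "(case k of (k1, k2, k3) \<Rightarrow> cis (2 * pi * of_int k1 * v1) * cis (2 * pi * of_int k2 * v2)) *
      of_real (exp (- pi * t * (lattice_norm (0, 0, - 1 / 2) k)\<^sup>2)) =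
      (case k of (k1, k2, k3) \<Rightarrow> ?c v1 k1 * (?c v2 k2 * ?d k3))"
      by (simp only: exp_add of_real_mult k prod.case mult_ac)
  qed
  also have "\<dots> = of_real (1 / sqrt t) * (\<integral>n. ?g v1 n \<partial>count_space UNIV) *
     (of_real (1 / sqrt t) * (\<integral>n. ?g v2 n \<partial>count_space UNIV) * (of_real (1 / sqrt t) * (\<integral>n. ?s n \<partial>count_space UNIV)))"
    unfolding integral_count_space_triple_product(2)[OF int_c int_c int_d] c_eq d_eq ..
  also have "\<dots> = of_real (1 / (t * sqrt t)) *
     ((\<integral>n. ?g v1 n \<partial>count_space UNIV) * ((\<integral>n. ?g v2 n \<partial>count_space UNIV) * (\<integral>n. ?s n \<partial>count_space UNIV)))"
  proof -
    have r: "1 / (t * sqrt t) = 1 / sqrt t * (1 / sqrt t * (1 / sqrt t))"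
      using t by (simp add: field_simps)
    show ?thesis unfolding r of_real_mult by (simp only: mult_ac)
  qed
  also have "(\<integral>n. ?g v1 n \<partial>count_space UNIV) * ((\<integral>n. ?g v2 n \<partial>count_space UNIV) * (\<integral>n. ?s n \<partial>count_space UNIV)) =
     (\<integral>m. (case m of (m1, m2, m3) \<Rightarrow> ?g v1 m1 * (?g v2 m2 * ?s m3)) \<partial>count_space UNIV)"
    by (rule integral_count_space_triple_product(2)[OF int_g int_g int_s, symmetric])
  also have "\<dots> = (\<integral>m. (case m of (m1, m2, m3) \<Rightarrow> parity_sign m3) *
      of_real (exp (- pi * (lattice_norm (v1, v2, 0) m)\<^sup>2 / t)) \<partial>count_space UNIV)"
  proof (rule Bochner_Integration.integral_cong[OF refl])
    fix m :: "int \<times> int \<times> int"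
    obtain m1 m2 m3 where m: "m = (m1, m2, m3)" by (cases m)
    have "- pi * (lattice_norm (v1, v2, 0) m)\<^sup>2 / t =
       (- pi * (real_of_int m1 + v1)\<^sup>2 / t) + (- pi * (real_of_int m2 + v2)\<^sup>2 / t) + (- pi * (real_of_int m3)\<^sup>2 / t)"
      unfolding m lattice_norm_sq by (simp add: algebra_simps add_divide_distrib diff_divide_distrib)
    then show "(case m of (m1, m2, m3) \<Rightarrow> ?g v1 m1 * (?g v2 m2 * ?s m3)) =
      (case m of (m1, m2, m3) \<Rightarrow> parity_sign m3) * of_real (exp (- pi * (lattice_norm (v1, v2, 0) m)\<^sup>2 / t))"
      by (simp only: exp_add of_real_mult m prod.case mult_ac)
  qed
  finally show ?thesis .
qed

lemma integrable_lattice_weight_divide: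
  fixes c :: "int \<times> int \<times> int \<Rightarrow> complex"
  assumes c: "\<And>m. norm (c m) \<le> 1" and \<delta>: "\<delta> > 0" "\<And>m. lattice_norm u m \<ge> \<delta>"
  shows "integrable (count_space UNIV) (\<lambda>m. norm (c m) / lattice_norm u m / (1 + (lattice_norm u m)\<^sup>2) ^ 3)"
proof (rule Bochner_Integration.integrable_bound)
  show "integrable (count_space UNIV) (\<lambda>m. 1 / \<delta> * (1 / (1 + (lattice_norm u m)\<^sup>2) ^ 3))"
    by (intro integrable_mult_right integrable_lattice_weight)
  have "norm (norm (c m) / lattice_norm u m / (1 + (lattice_norm u m)\<^sup>2) ^ 3) \<le>
     norm (1 / \<delta> * (1 / (1 + (lattice_norm u m)\<^sup>2) ^ 3))" for m
  proof -
    have "norm (c m) / lattice_norm u m \<le> 1 / \<delta>" using c \<delta> by (intro frac_le) auto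
    moreover have "0 \<le> norm (c m) / lattice_norm u m" by (simp add: lattice_norm_nonneg)
    ultimately show ?thesis
      using \<delta>(1) by (simp add: abs_mult divide_right_mono add_nonneg_nonneg flip: divide_divide_eq_left)
  qed
  then show "AE m in count_space UNIV. norm (norm (c m) / lattice_norm u m / (1 + (lattice_norm u m)\<^sup>2) ^ 3) \<le>
     norm (1 / \<delta> * (1 / (1 + (lattice_norm u m)\<^sup>2) ^ 3))"
    by (intro AE_I2)
qed simp

text \<open>
  The parameters are chosen so that both shifted lattices avoid the origin: \<open>\<theta>\<close> is at distance at least
  \<open>1/4\<close> from the integers, and so is \<open>1/2\<close>. The length of \<open>v\<close> itself is the point that shows that the
  measure is not zero.
\<close>
theorem theorem2:
  shows "\<exists>(\<mu> :: real set \<Rightarrow> complex) (\<nu> :: real set \<Rightarrow> complex)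
           (T :: (real \<Rightarrow> complex) \<Rightarrow> complex) (\<Lambda> :: real set) (S :: real set).
    is_temperate_measure \<mu> T \<and> real_measure \<mu> \<and> nonzero_measure \<mu> \<and>
    pure_point_on \<mu> \<Lambda> \<and>
    is_temperate_measure \<nu> (fourier_distribution T) \<and>
    pure_point_on \<nu> S \<and>
    discrete_closed \<Lambda> \<and> discrete_closed S \<and>
    (\<forall>a d. d > 0 \<longrightarrow> finite (\<Lambda> \<inter> arith_progression a d))"
proof -
  obtain \<theta> :: real where \<theta>: "1 / 4 < \<theta>" "\<theta> < 3 / 4" "\<not> algebraic \<theta>"
    using transcendental_exists[of "1 / 4" "3 / 4"] by auto
  define p where "p = lattice_norm (\<theta>, \<theta> ^ 4, 0)"
  define q where "q = lattice_norm (0, 0, - 1 / 2)"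
  define a where "a = (\<lambda>(m1 :: int, m2 :: int, m3). parity_sign m3)"
  define b where "b = (\<lambda>(k1, k2, k3 :: int). cis (2 * pi * of_int k1 * \<theta>) * cis (2 * pi * of_int k2 * \<theta> ^ 4))"
  have far: "\<bar>of_int n + x\<bar> \<ge> 1 / 4" if "1 / 4 \<le> x" "x \<le> 3 / 4" for n :: int and x :: real
  proof (cases "n \<ge> 0")
    case False
    then have "real_of_int n \<le> - 1" by linarith
    then show ?thesis using that by linarith
  qed (use that in linarith)
  have p_ge: "p m \<ge> 1 / 4" for m
  proof -
    obtain m1 m2 m3 where m: "m = (m1, m2, m3)" by (cases m)
    have "\<bar>of_int m1 + \<theta>\<bar> \<ge> 1 / 4" using far[of \<theta> m1] \<theta> by simp
    then show ?thesis
      using abs_le_lattice_norm(1)[of m1 \<theta> "\<theta> ^ 4" 0 m2 m3] unfolding p_def m by linarith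
  qed
  have q_ge: "q k \<ge> 1 / 4" for k
  proof -
    obtain k1 k2 k3 where k: "k = (k1, k2, k3)" by (cases k)
    have "\<bar>of_int k3 + (- 1 / 2)\<bar> \<ge> (1 / 4 :: real)" using far[of "1 / 2" "k3 - 1"] by simp
    then show ?thesis
      using abs_le_lattice_norm(3)[of k3 "- 1 / 2" 0 0 k1 k2] unfolding q_def k by linarith
  qed
  have na: "norm (a m) = 1" for m by (cases m) (simp add: a_def parity_sign_def)
  have nb: "norm (b k) = 1" for k by (cases k) (simp add: b_def norm_mult)
  have p_pos: "p m > 0" and q_pos: "q m > 0" for m using p_ge[of m] q_ge[of m] by linarith+
  have sum_a: "integrable (count_space UNIV) (\<lambda>m. norm (a m) / p m / (1 + (p m)\<^sup>2) ^ 3)"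
    using p_ge na unfolding p_def by (intro integrable_lattice_weight_divide[where \<delta> = "1 / 4"]) auto
  have sum_b: "integrable (count_space UNIV) (\<lambda>k. norm (b k) / q k / (1 + (q k)\<^sup>2) ^ 3)"
    using q_ge nb unfolding q_def by (intro integrable_lattice_weight_divide[where \<delta> = "1 / 4"]) auto
  \<comment> \<open>The dual lattice comes first, because the summation formula puts the Fourier transform on the second family.\<close>
  interpret gaussian_duality b q a p
  proof
    fix t :: real assume "t > 0"
    from product_theta_identity[OF this, of \<theta> "\<theta> ^ 4"]
    show "(\<integral>i. b i * of_real (exp (- pi * t * (q i)\<^sup>2)) \<partial>count_space UNIV) =
      of_real (1 / (t * sqrt t)) * (\<integral>j. a j * of_real (exp (- pi * (p j)\<^sup>2 / t)) \<partial>count_space UNIV)"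
      unfolding a_def b_def p_def q_def .
  qed (use p_pos q_pos sum_a sum_b in auto)
  define w where "w = odd_weight (\<lambda>m. a m / of_real (p m))"
  define x where "x = odd_point p"
  define w' where "w' = odd_weight (\<lambda>k. - \<i> * (b k / of_real (q k)))"
  define x' where "x' = odd_point q"
  have fam: "tempered_family w x"
    unfolding w_def x_def
  proof (rule tempered_family_odd)
    show "integrable (count_space UNIV) (\<lambda>i. norm (a i / of_real (p i)) / (1 + (p i)\<^sup>2) ^ 3)"
      using sum_a p_pos by (simp add: norm_divide less_imp_le)
    show "finite {i. \<bar>p i\<bar> \<le> R}" for R
      using finite_lattice_ball[of "(\<theta>, \<theta> ^ 4, 0)" R] lattice_norm_nonneg unfolding p_def by simp
  qed
  have fam': "tempered_family w' x'"
    unfolding w'_def x'_def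
  proof (rule tempered_family_odd)
    show "integrable (count_space UNIV) (\<lambda>i. norm (- \<i> * (b i / of_real (q i))) / (1 + (q i)\<^sup>2) ^ 3)"
      using sum_b q_pos by (simp add: norm_divide norm_mult less_imp_le)
    show "finite {i. \<bar>q i\<bar> \<le> R}" for R
      using finite_lattice_ball[of "(0, 0, - 1 / 2)" R] lattice_norm_nonneg unfolding q_def by simp
  qed
  have dual: "point_functional w x (fourier f) = point_functional w' x' f" if f: "f \<in> schwartz" for f
  proof -
    obtain C where C: "\<And>y. norm (nth_deriv 0 f y) \<le> C / (1 + y\<^sup>2) ^ 3"
      using schwartz_decay[OF f] by blast
    obtain D where D: "\<And>\<xi>. norm (fourier f \<xi>) \<le> D / (1 + \<xi>\<^sup>2) ^ 3"
      using fourier_schwartz_decay[OF f] by blast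
    have cont: "continuous_on UNIV f"
      using continuous_on_nth_deriv[of f UNIV 0] f by (simp add: schwartz_def)
    have int: "integrable lborel f" using integrable_nth_deriv[OF f, of 0] by simp
    have "point_functional w' x' f = (\<integral>k. - \<i> * (b k / of_real (q k)) * (f (q k) - f (- q k)) \<partial>count_space UNIV)"
      using fam' C unfolding w'_def x'_def nth_deriv_0 by (rule point_functional_odd)
    also have "\<dots> = - \<i> * (\<integral>k. b k / of_real (q k) * (f (q k) - f (- q k)) \<partial>count_space UNIV)"
      unfolding mult.assoc by (rule integral_mult_right_zero)
    also have "\<dots> = (\<integral>m. a m / of_real (p m) * (fourier f (p m) - fourier f (- p m)) \<partial>count_space UNIV)"
      using summation_formula[OF cont C[unfolded nth_deriv_0] int D] by (simp flip: mult.assoc)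
    also have "\<dots> = point_functional w x (fourier f)"
      using fam D unfolding w_def x_def by (rule point_functional_odd[symmetric])
    finally show ?thesis ..
  qed
  interpret W: tempered_family w x by (rule fam)
  interpret W': tempered_family w' x' by (rule fam')
  have real: "real_measure (point_measure_of w x)"
  proof -
    have "w i \<in> \<real>" for i
      by (auto simp: w_def odd_weight_def a_def parity_sign_def split: prod.split)
    then show ?thesis unfolding real_measure_def point_measure_of_def atom_def by (auto intro!: sum_in_Reals)
  qed
  have p_sq: "(p m)\<^sup>2 = shifted_norm_sq \<theta> m" for m
    by (cases m) (simp add: p_def lattice_norm_sq shifted_norm_sq_def)
  have nonzero: "nonzero_measure (point_measure_of w x)"
  proof -
    let ?p = "p (0, 0, 0)"
    have uniq: "i = (True, (0, 0, 0))" if eq: "x i = ?p" for i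
    proof -
      obtain s m where i: "i = (s, m)" by (cases i)
      have s: "s"
        using eq p_pos[of m] p_pos[of "(0, 0, 0)"] by (auto simp: i x_def odd_point_def split: if_splits)
      then have "p m = ?p" using eq by (simp add: i x_def odd_point_def)
      then have "shifted_norm_sq \<theta> m = shifted_norm_sq \<theta> (0, 0, 0)" unfolding p_sq[symmetric] by simp
      from shifted_norm_sq_eq_0_vector[OF \<theta>(3) this] s show ?thesis by (simp add: i)
    qed
    have "x (True, (0, 0, 0)) = ?p" by (simp add: x_def odd_point_def)
    then have "{i. x i = ?p} = {(True, (0, 0, 0))}" using uniq by blast
    then have "atom w x ?p = a (0, 0, 0) / of_real ?p" by (simp add: atom_def w_def odd_weight_def)
    moreover have "a (0, 0, 0) \<noteq> 0" "?p \<noteq> 0"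
      using p_pos[of "(0, 0, 0)"] na[of "(0, 0, 0)"] by fastforce+
    ultimately have "point_measure_of w x {?p} \<noteq> 0"
      by (simp add: W.point_measure_of_singleton)
    moreover have "{?p} \<in> bounded_borel" by (simp add: bounded_borel_def)
    ultimately show ?thesis unfolding nonzero_measure_def by blast
  qed
  have progression: "finite (atoms w x \<inter> arith_progression c d)" if "d > 0" for c d
  proof -
    let ?K = "{k :: int. \<exists>m. (c + of_int k * d)\<^sup>2 = shifted_norm_sq \<theta> m}"
    have sq: "(x i)\<^sup>2 = shifted_norm_sq \<theta> (snd i)" for i
      by (cases i) (simp add: x_def odd_point_def p_sq)
    have "atoms w x \<inter> arith_progression c d \<subseteq> (\<lambda>k. c + of_int k * d) ` ?K"
    proof
      fix y assume y: "y \<in> atoms w x \<inter> arith_progression c d"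
      then obtain k :: int where k: "y = c + of_int k * d" by (auto simp: arith_progression_def)
      obtain i where "y = x i" using y W.atoms_subset by auto
      then have "(c + of_int k * d)\<^sup>2 = shifted_norm_sq \<theta> (snd i)" using sq[of i] k by simp
      then have "k \<in> ?K" by blast
      then show "y \<in> (\<lambda>k. c + of_int k * d) ` ?K" using k by blast
    qed
    moreover have "finite ?K" using that by (intro finite_progression_indices \<theta>(3)) simp
    ultimately show ?thesis using finite_surj by blast
  qed
  show ?thesis
    using W.is_temperate_measure_point_measure_of real nonzero W.pure_point_on_point_measure_of
      is_temperate_measure_fourier[OF fam fam' dual] W'.pure_point_on_point_measure_of
      W.discrete_closed_atoms W'.discrete_closed_atoms progression
    by blast
qed

end
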